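(* Let $V$ be a grading-restricted vertex algebra that is freely generated by a finite set $S=\{a^{(1)},\dots,a^{(r)}\}$ of homogeneous elements of positive weights. Then every cohomology class in $H^2_{1/2}(V,V)$ is represented by a map $Y_1:V\otimes V\to V((x))$ such that: (1) $Y_1$ is a cocycle, i.e. satisfies conditions (1)--(6) listed in the context. (2) For every $1\le i,j\le r$, $$Y_1(a^{(i)},x)a^{(j)}=Y_1^-(a^{(i)},x)a^{(j)}+\tfrac12\Big(e^{xD}Y_1^-(a^{(j)},-x)a^{(i)}-Y_1^-(a^{(i)},x)a^{(j)}\Big).$$ (3) For every $p\in\mathbb N$ and $s^{(1)},\dots,s^{(p)},u,v\in S$, the series $Y(s^{(1)},z_1)\cdots Y(s^{(p)},z_p)Y_1(u,z_{p+1})v$ converges absolutely to a $\overline V$-valued rational function. (4) For every $s,u,v\in S$, the series $Y_1(s,z_1)Y(u,z_2)v$ converges absolutely to a $\overline V$-valued rational function.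
   Context: All vector spaces are over $\mathbb C$. A grading-restricted vertex algebra is a vertex algebra $(V,Y,\mathbf 1)$, $Y(u,x)v=\sum_{n\in\mathbb Z}u_nv\,x^{-n-1}$, with a grading $V=\coprod_{n\in\mathbb Z}V_{(n)}$ (by weights), $V_{(n)}=0$ for $n$ sufficiently negative, such that $\mathrm{wt}(u_nv)=\mathrm{wt}\,u+\mathrm{wt}\,v-n-1$. $Dv=v_{-2}\mathbf 1$; $V'=\coprod V_{(n)}^*$; $\overline V=\prod V_{(n)}$. $S=\{a^{(1)},\dots,a^{(r)}\}$ freely generates $V$ if the vectors $a^{(1)}_{-m^{(1)}_1}\cdots a^{(1)}_{-m^{(1)}_{k_1}}\cdots a^{(r)}_{-m^{(r)}_1}\cdots a^{(r)}_{-m^{(r)}_{k_r}}\mathbf 1$ with $k_i\ge0$ and $m^{(i)}_1\ge\cdots\ge m^{(i)}_{k_i}\ge1$ form a basis of $V$. Cocycles: linear maps $Y_1:V\otimes V\to V((x))$, $Y_1(u,x)v=\sum_n u^{def}_nv\,x^{-n-1}$, such that (1) $\mathrm{wt}(u^{def}_nv)=\mathrm{wt}\,u+\mathrm{wt}\,v-n-1$; (2) $Y_1(\mathbf 1,x)v=0$; (3) $Y_1(u,x)\mathbf 1=0$; (4) $[D,Y_1(u,x)]=Y_1(Du,x)=\frac{d}{dx}Y_1(u,x)$; (5) for $v'\in V'$, $u_1,u_2,v\in V$, the series $\langle v',Y_1(u_1,z_1)Y(u_2,z_2)v\rangle+\langle v',Y(u_1,z_1)Y_1(u_2,z_2)v\rangle$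 and $\langle v',Y_1(Y(u_1,z_1-z_2)u_2,z_2)v\rangle+\langle v',Y(Y_1(u_1,z_1-z_2)u_2,z_2)v\rangle$ (only the sums) converge absolutely in $|z_1|>|z_2|>0$, resp. $|z_2|>|z_1-z_2|>0$, to a common rational function with only possible poles at $z_1=0,z_2=0,z_1=z_2$; (6) $Y_1(u,x)v=e^{xD}Y_1(v,-x)u$. Coboundaries: $Y_\phi(u,x)v=Y(\phi(u),x)v-\phi(Y(u,x)v)+Y(u,x)\phi(v)$ for $\phi:V\to V$ linear, grading-preserving, commuting with $D$, $\phi(\mathbf 1)=0$. $H^2_{1/2}(V,V)$ is the space of cocycles modulo the space of the $Y_\phi$. $Y_1^-(u,x)v=\sum_{n\ge0}u^{def}_nv\,x^{-n-1}$ is the singular part (negative powers of $x$). A series in $V[[z_1^{\pm1},\dots,z_n^{\pm1}]]$ converges absolutely to a $\overline V$-valued rational function if, paired with any $v'\in V'$, it converges absolutely (for a product, in the region $|z_1|>\cdots>|z_n|>0$) to a rational function with only possible poles at $z_i=0$ and $z_i=z_j$ $(i\neq j)$. *)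

theory Defs
  imports
    "HOL-Analysis.Analysis"
    "HOL-Computational_Algebra.Formal_Laurent_Series"
    "HOL-Library.Groups_Big_Fun"
begin

section \<open>Vertex operator maps and their modes\<close>

text \<open>
  A map \<open>Y : V \<otimes> V \<rightarrow> V((x))\<close> is a function \<open>Y :: 'v \<Rightarrow> 'v \<Rightarrow> 'v fls\<close> that is bilinear, where
  \<open>Y u v\<close> stands for the Laurent series \<open>Y(u,x)v\<close>.  The mode \<open>u\<^sub>n v\<close> is the coefficient of
  \<open>x^(-n-1)\<close> in that series.
\<close>

definition vmode :: "('v::ab_group_add \<Rightarrow> 'v \<Rightarrow> 'v fls) \<Rightarrow> 'v \<Rightarrow> int \<Rightarrow> 'v \<Rightarrow> 'v" where
  "vmode Y u n v = fls_nth (Y u v) (- n - 1)"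

definition singular_part :: "'v::ab_group_add fls \<Rightarrow> int \<Rightarrow> 'v" where
  "singular_part F k = (if k < 0 then fls_nth F k else 0)"


section \<open>Formal series converging to rational functions\<close>

text \<open>
  Points of \<open>\<complex>\<^sup>n\<close> and exponents are lists of length \<open>n\<close>, with indices starting from \<open>0\<close>.
\<close>

definition polynomial_in :: "nat \<Rightarrow> (complex list \<Rightarrow> complex) \<Rightarrow> bool" where
  "polynomial_in n P \<longleftrightarrow>
    (\<exists>A c. finite A \<and>
      (\<forall>zs. length zs = n \<longrightarrow> P zs = (\<Sum>\<alpha>\<in>A. c \<alpha> * (\<Prod>i<n. zs ! i ^ (\<alpha> :: nat \<Rightarrow> nat) i))))"

definition config :: "nat \<Rightarrow> complex list set" where
  "config n = {zs. length zs = n \<and> distinct zs \<and> 0 \<notin> set zs}"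

text \<open>Rational functions whose only possible poles are at \<open>z\<^sub>i = 0\<close> and \<open>z\<^sub>i = z\<^sub>j\<close>, \<open>i \<noteq> j\<close>.\<close>

definition rational_in :: "nat \<Rightarrow> (complex list \<Rightarrow> complex) \<Rightarrow> bool" where
  "rational_in n f \<longleftrightarrow>
    (\<exists>P k l. polynomial_in n P \<and>
      (\<forall>zs\<in>config n.
        f zs = P zs / ((\<Prod>i<n. zs ! i ^ (k :: nat \<Rightarrow> nat) i) *
                       (\<Prod>j<n. \<Prod>i<j. (zs ! i - zs ! j) ^ (l :: nat \<Rightarrow> nat \<Rightarrow> nat) i j))))"

text \<open>
  \<open>c ns\<close> is the coefficient of \<open>z\<^sub>1^(-n\<^sub>1-1) \<dots> z\<^sub>n^(-n\<^sub>n-1)\<close>.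
\<close>

definition series_term :: "nat \<Rightarrow> (int list \<Rightarrow> complex) \<Rightarrow> complex list \<Rightarrow> int list \<Rightarrow> complex" where
  "series_term n c zs ns = c ns * (\<Prod>i<n. (zs ! i) powi (- (ns ! i) - 1))"

definition abs_sums_to :: "nat \<Rightarrow> (int list \<Rightarrow> complex) \<Rightarrow> complex list \<Rightarrow> complex \<Rightarrow> bool" where
  "abs_sums_to n c zs s \<longleftrightarrow>
    (\<lambda>ns. norm (series_term n c zs ns)) summable_on {ns. length ns = n} \<and>
    (series_term n c zs has_sum s) {ns. length ns = n}"

text \<open>The region \<open>\<bar>z\<^sub>1\<bar> > \<dots> > \<bar>z\<^sub>n\<bar> > 0\<close>.\<close>

definition radial_region :: "nat \<Rightarrow> complex list set" where
  "radial_region n =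
    {zs. length zs = n \<and> 0 \<notin> set zs \<and> sorted_wrt (\<lambda>z w. norm z > norm w) zs}"


section \<open>Grading-restricted vertex algebras\<close>

text \<open>
  The last axiom of the following locale is the Jacobi identity in components (the Borcherds
  identity).  The sums have finite support because \<open>Y\<close> takes values in \<open>V((x))\<close>.
\<close>

locale vertex_algebra = vector_space scale
  for scale :: "complex \<Rightarrow> 'v::ab_group_add \<Rightarrow> 'v" +
  fixes Y :: "'v \<Rightarrow> 'v \<Rightarrow> 'v fls"
    and vac :: 'v
  assumes linear_left: "Vector_Spaces.linear scale scale (\<lambda>u. vmode Y u n v)"
    and linear_right: "Vector_Spaces.linear scale scale (\<lambda>v. vmode Y u n v)"
    and vacuum: "vmode Y vac n v = (if n = -1 then v else 0)"
    and creation_regular: "n \<ge> 0 \<Longrightarrow> vmode Y u n vac = 0"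
    and creation: "vmode Y u (-1) vac = u"
    and jacobi:
      "Sum_any (\<lambda>i::nat. scale (of_int m gchoose i)
          (vmode Y (vmode Y u (l + int i) v) (m + n - int i) w)) =
       Sum_any (\<lambda>i::nat. scale ((-1) ^ i * (of_int l gchoose i))
          (vmode Y u (m + l - int i) (vmode Y v (n + int i) w) -
           scale ((-1) powi l) (vmode Y v (n + l - int i) (vmode Y u (m + int i) w))))"

text \<open>\<open>G n\<close> is the homogeneous subspace \<open>V\<^sub>(\<^sub>n\<^sub>)\<close> of weight \<open>n\<close>.\<close>

locale grading_restricted_vertex_algebra = vertex_algebra scale Y vac
  for scale :: "complex \<Rightarrow> 'v::ab_group_add \<Rightarrow> 'v"
    and Y :: "'v \<Rightarrow> 'v \<Rightarrow> 'v fls"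
    and vac :: 'v +
  fixes G :: "int \<Rightarrow> 'v set"
  assumes G_subspace: "subspace (G n)"
    and G_direct_sum: "\<exists>!c. finite {n. c n \<noteq> 0} \<and> (\<forall>n. c n \<in> G n) \<and> v = Sum_any c"
    and G_bounded_below: "\<exists>N. \<forall>n<N. G n = {0}"
    and vac_weight: "vac \<in> G 0"
    and vmode_weight: "u \<in> G k \<Longrightarrow> v \<in> G l \<Longrightarrow> vmode Y u n v \<in> G (k + l - n - 1)"
begin

definition D :: "'v \<Rightarrow> 'v" where
  "D v = vmode Y v (-2) vac"

text \<open>
  The coefficients of \<open>e\<^sup>x\<^sup>D F(-x)\<close>, where \<open>F k\<close> is the coefficient of \<open>x^k\<close> in \<open>F(x)\<close>.  The sum has
  finite support if \<open>F\<close> has only finitely many negative powers.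
\<close>

definition exp_D_neg :: "(int \<Rightarrow> 'v) \<Rightarrow> int \<Rightarrow> 'v" where
  "exp_D_neg F k =
    Sum_any (\<lambda>i::nat. scale (1 / fact i) ((D ^^ i) (scale ((-1) powi (k - int i)) (F (k - int i)))))"

text \<open>
  \<open>V' = \<Coprod>\<^sub>n V\<^sub>(\<^sub>n\<^sub>)\<^sup>*\<close>, realised as the linear functionals on \<open>V\<close> that vanish on all but finitely
  many homogeneous subspaces.
\<close>

definition graded_dual :: "('v \<Rightarrow> complex) set" where
  "graded_dual =
    {f. Vector_Spaces.linear scale (*) f \<and> finite {n. \<exists>v\<in>G n. f v \<noteq> 0}}"

text \<open>Absolute convergence of a formal series in \<open>n\<close> variables with coefficients in \<open>V\<close> to a rational
  function with values in the algebraic completion of \<open>V\<close>.\<close>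

definition converges_to_rational :: "nat \<Rightarrow> (int list \<Rightarrow> 'v) \<Rightarrow> bool" where
  "converges_to_rational n c \<longleftrightarrow>
    (\<forall>v'\<in>graded_dual. \<exists>f. rational_in n f \<and>
      (\<forall>zs\<in>radial_region n. abs_sums_to n (\<lambda>ns. v' (c ns)) zs (f zs)))"

text \<open>
  The last conjunct of the following definition is the deformed duality property: the first series is
  expanded in \<open>z\<^sub>1\<close>, \<open>z\<^sub>2\<close>, the second one in \<open>z\<^sub>1 - z\<^sub>2\<close>, \<open>z\<^sub>2\<close>, and only the sums of the two terms
  are required to converge.
\<close>

definition cocycle :: "('v \<Rightarrow> 'v \<Rightarrow> 'v fls) \<Rightarrow> bool" where
  "cocycle Y1 \<longleftrightarrow>
    (\<forall>n v. Vector_Spaces.linear scale scale (\<lambda>u. vmode Y1 u n v)) \<and>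
    (\<forall>n u. Vector_Spaces.linear scale scale (\<lambda>v. vmode Y1 u n v)) \<and>
    (\<forall>k l u v n. u \<in> G k \<longrightarrow> v \<in> G l \<longrightarrow> vmode Y1 u n v \<in> G (k + l - n - 1)) \<and>
    (\<forall>v. Y1 vac v = 0) \<and>
    (\<forall>u. Y1 u vac = 0) \<and>
    (\<forall>u v n. D (vmode Y1 u n v) - vmode Y1 u n (D v) = vmode Y1 (D u) n v) \<and>
    (\<forall>u v n. vmode Y1 (D u) n v = scale (- of_int n) (vmode Y1 u (n - 1) v)) \<and>
    (\<forall>v'\<in>graded_dual. \<forall>u1 u2 v. \<exists>f. rational_in 2 f \<and>
      (\<forall>z1 z2. norm z1 > norm z2 \<and> norm z2 > 0 \<longrightarrow>
        abs_sums_to 2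
          (\<lambda>ns. v' (vmode Y1 u1 (ns ! 0) (vmode Y u2 (ns ! 1) v)) +
                v' (vmode Y u1 (ns ! 0) (vmode Y1 u2 (ns ! 1) v)))
          [z1, z2] (f [z1, z2])) \<and>
      (\<forall>z1 z2. norm z2 > norm (z1 - z2) \<and> norm (z1 - z2) > 0 \<longrightarrow>
        abs_sums_to 2
          (\<lambda>ns. v' (vmode Y1 (vmode Y u1 (ns ! 0) u2) (ns ! 1) v) +
                v' (vmode Y (vmode Y1 u1 (ns ! 0) u2) (ns ! 1) v))
          [z1 - z2, z2] (f [z1, z2]))) \<and>
    (\<forall>u v k. fls_nth (Y1 u v) k = exp_D_neg (fls_nth (Y1 v u)) k)"

definition coboundary :: "('v \<Rightarrow> 'v \<Rightarrow> 'v fls) \<Rightarrow> bool" where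
  "coboundary B \<longleftrightarrow>
    (\<exists>\<phi>. Vector_Spaces.linear scale scale \<phi> \<and>
         (\<forall>n. \<phi> ` G n \<subseteq> G n) \<and> (\<forall>v. \<phi> (D v) = D (\<phi> v)) \<and> \<phi> vac = 0 \<and>
         (\<forall>u v n. vmode B u n v =
            vmode Y (\<phi> u) n v - \<phi> (vmode Y u n v) + vmode Y u n (\<phi> v)))"

text \<open>The set of cohomology classes, that is, the elements of \<open>H\<^sup>2\<^sub>1\<^sub>/\<^sub>2(V,V)\<close>.\<close>

definition H2_half :: "('v \<Rightarrow> 'v \<Rightarrow> 'v fls) set set" where
  "H2_half = {Y1. cocycle Y1} //
     {(Y1, Y2). cocycle Y1 \<and> cocycle Y2 \<and> coboundary (\<lambda>u v. Y2 u v - Y1 u v)}"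

text \<open>
  \<open>iterated_modes ss ns v\<close> is \<open>s\<^sup>1\<^sub>n\<^sub>1 \<cdots> s\<^sup>p\<^sub>n\<^sub>p v\<close>; entries of \<open>ns\<close> beyond the length of \<open>ss\<close> are
  ignored.
\<close>

definition iterated_modes :: "'v list \<Rightarrow> int list \<Rightarrow> 'v \<Rightarrow> 'v" where
  "iterated_modes ss ns v = foldr (\<lambda>(s, n). vmode Y s n) (zip ss ns) v"

text \<open>
  The monomials are indexed by the lists \<open>[m\<^sup>(\<^sup>1\<^sup>), \<dots>, m\<^sup>(\<^sup>r\<^sup>)]\<close> of weakly decreasing lists of positive
  integers.  Being a basis is understood for the indexed family of monomials, hence the injectivity.
\<close>

definition pbw_indices :: "nat \<Rightarrow> nat list list set" where
  "pbw_indices r = {ms. length ms = r \<and> (\<forall>m\<in>set ms. sorted_wrt (\<ge>) m \<and> (\<forall>j\<in>set m. j \<ge> 1))}"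

definition pbw_monomial :: "'v list \<Rightarrow> nat list list \<Rightarrow> 'v" where
  "pbw_monomial gens ms =
    foldr (\<lambda>(a, m). foldr (\<lambda>j. vmode Y a (- int j)) m) (zip gens ms) vac"

definition freely_generates :: "'v list \<Rightarrow> bool" where
  "freely_generates gens \<longleftrightarrow>
    inj_on (pbw_monomial gens) (pbw_indices (length gens)) \<and>
    independent (pbw_monomial gens ` pbw_indices (length gens)) \<and>
    span (pbw_monomial gens ` pbw_indices (length gens)) = UNIV"

end

end

theory Submission
  imports Defs
begin

text \<open>
  Let \<open>R(u, v)\<close> be \<open>Y\<^sub>1(u, x)v\<close> minus the average of its singular part and of
  \<open>e\<^sup>x\<^sup>D Y\<^sub>1\<^sup>-(v, -x)u\<close>.  Skew-symmetry makes \<open>R(u, v)\<close> a power series with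
  \<open>R(u, v)(x) = e\<^sup>x\<^sup>D R(v, u)(-x)\<close>, and (2) says that \<open>R\<close> vanishes on the generators.  A coboundary
  \<open>Y\<^sub>\<phi>\<close> with \<open>\<phi>\<close> zero on the generators changes \<open>R\<close> by \<open>- \<phi>(R\<^sup>Y)\<close>, where \<open>R\<^sup>Y\<close> is formed from \<open>Y\<close>
  itself.  Modulo the image of \<open>D\<close>, the coefficients of \<open>R\<^sup>Y(a\<^sup>(\<^sup>i\<^sup>), a\<^sup>(\<^sup>j\<^sup>))\<close> are the quadratic
  monomials \<open>a\<^sup>(\<^sup>i\<^sup>)\<^sub>-\<^sub>m a\<^sup>(\<^sup>j\<^sup>)\<close>.  Filtering \<open>V\<close> by the total weight of the generators, the associated
  graded space is a polynomial algebra on which \<open>D\<close> acts as a derivation; there \<open>D\<close> is injective on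
  nonconstant polynomials and, up to the symmetry for \<open>i = j\<close>, the quadratic monomials and the
  generators are linearly independent modulo the image of \<open>D\<close>.  Hence a \<open>\<phi>\<close> commuting with \<open>D\<close> and
  with the prescribed values exists and can be built weight by weight.

  Once (2) holds, \<open>Y\<^sub>1(u, x)v\<close> is a finite combination of vectors times powers of \<open>x\<close> and of series
  \<open>x^k e\<^sup>x\<^sup>D w = x^k Y(w, x)1\<close>, so (3) follows from the rationality of products of vertex operators.
  That in turn is proved by moving the annihilation modes of the leftmost operator to the right.
  Finally (4) is the difference of the cocycle condition and (3).
\<close>


section \<open>Rational functions\<close>

text \<open>Two obstacles shape the proof. Free generation only says that the ordered monomials form
  a basis, while a commutator of two generator modes involves modes of \<open>u_i v\<close>, an
  arbitrary vector; so it is not clear that reordering lowers a degree defined through monomials.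
  Hence \<open>fil\<close> is built from modes of all homogeneous vectors, where a commutator loses
  at least one because \<open>u_i v\<close> with \<open>i >= 0\<close> has weight
  \<open>d + e - i - 1\<close>, and only then is it identified with the span of the basis monomials
  of bounded \<open>deg\<close>. Positive weights make it vanish in negative degrees and leave only
  constants in degree 0. The second obstacle is that \<phi> can be prescribed only on vectors
  independent modulo the image of \<open>D\<close>. Asking that \<phi> vanish on the generators,
  which removes two of the three terms of the coboundary, puts the generators into the independence
  statement next to the quadratic vectors. The coboundary must also be shown to be a cocycle, and
  since the axiom is the Borcherds identity in components, duality in two variables has to be
  derived from it.\<close>

lemma polynomial_inI:
  assumes "finite X"
    and "\<And>zs. length zs = n \<Longrightarrow> P zs = (\<Sum>x\<in>X. c x * (\<Prod>i<n. zs ! i ^ (\<alpha> x :: nat \<Rightarrow> nat) i))"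
  shows "polynomial_in n P"
  unfolding polynomial_in_def
proof (intro exI conjI allI impI)
  show "finite (\<alpha> ` X)" using assms(1) by simp
  fix zs :: "complex list" assume len: "length zs = n"
  \<comment> \<open>The definition lists each exponent once, while products of polynomials repeat
    exponents; terms with equal exponent are collected.\<close>
  have "P zs = (\<Sum>a\<in>\<alpha> ` X. \<Sum>x\<in>{x\<in>X. \<alpha> x = a}. c x * (\<Prod>i<n. zs ! i ^ \<alpha> x i))"
    unfolding assms(2)[OF len] by (rule sum.image_gen[OF assms(1)])
  also have "\<dots> = (\<Sum>a\<in>\<alpha> ` X. (\<Sum>x\<in>{x\<in>X. \<alpha> x = a}. c x) * (\<Prod>i<n. zs ! i ^ a i))"
    by (rule sum.cong) (auto simp: sum_distrib_right)
  finally show "P zs = (\<Sum>a\<in>\<alpha> ` X. (\<lambda>a. \<Sum>x\<in>{x\<in>X. \<alpha> x = a}. c x) a * (\<Prod>i<n. zs ! i ^ a i))"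
    by simp
qed

lemma polynomial_in_const [intro]: "polynomial_in n (\<lambda>zs. c)"
  by (rule polynomial_inI[where X = "{()}" and c = "\<lambda>_. c" and \<alpha> = "\<lambda>_ _. 0"]) auto

lemma polynomial_in_nth [intro]:
  assumes "j < n"
  shows "polynomial_in n (\<lambda>zs. zs ! j)"
proof (rule polynomial_inI[where X = "{()}" and c = "\<lambda>_. 1" and \<alpha> = "\<lambda>_ i. if i = j then 1 else 0"])
  fix zs :: "complex list"
  have "(\<Prod>i<n. zs ! i ^ (if i = j then 1 else 0)) = (\<Prod>i<n. if i = j then zs ! i else 1)"
    by (rule prod.cong) auto
  then show "zs ! j = (\<Sum>x\<in>{()}. 1 * (\<Prod>i<n. zs ! i ^ (if i = j then 1 else 0)))"
    using assms by simp
qed auto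

lemma polynomial_in_add [intro]:
  assumes "polynomial_in n P" "polynomial_in n Q"
  shows "polynomial_in n (\<lambda>zs. P zs + Q zs)"
proof -
  obtain A c where A: "finite A"
      "\<And>zs. length zs = n \<Longrightarrow> P zs = (\<Sum>\<alpha>\<in>A. c \<alpha> * (\<Prod>i<n. zs ! i ^ (\<alpha> :: nat \<Rightarrow> nat) i))"
    using assms(1) unfolding polynomial_in_def by auto
  obtain B d where B: "finite B"
      "\<And>zs. length zs = n \<Longrightarrow> Q zs = (\<Sum>\<alpha>\<in>B. d \<alpha> * (\<Prod>i<n. zs ! i ^ (\<alpha> :: nat \<Rightarrow> nat) i))"
    using assms(2) unfolding polynomial_in_def by auto
  show ?thesis
    by (rule polynomial_inI[where X = "A <+> B" and c = "case_sum c d" and \<alpha> = "case_sum id id"])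
      (use A B in \<open>auto simp: sum.Plus\<close>)
qed

lemma polynomial_in_mult [intro]:
  assumes "polynomial_in n P" "polynomial_in n Q"
  shows "polynomial_in n (\<lambda>zs. P zs * Q zs)"
proof -
  obtain A c where A: "finite A"
      "\<And>zs. length zs = n \<Longrightarrow> P zs = (\<Sum>\<alpha>\<in>A. c \<alpha> * (\<Prod>i<n. zs ! i ^ (\<alpha> :: nat \<Rightarrow> nat) i))"
    using assms(1) unfolding polynomial_in_def by auto
  obtain B d where B: "finite B"
      "\<And>zs. length zs = n \<Longrightarrow> Q zs = (\<Sum>\<alpha>\<in>B. d \<alpha> * (\<Prod>i<n. zs ! i ^ (\<alpha> :: nat \<Rightarrow> nat) i))"
    using assms(2) unfolding polynomial_in_def by auto
  show ?thesis
    by (rule polynomial_inI[where X = "A \<times> B" and c = "\<lambda>(a, b). c a * d b"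
          and \<alpha> = "\<lambda>(a, b) i. a i + b i"])
      (use A B in \<open>auto simp: sum_product sum.cartesian_product power_add prod.distrib
          intro!: sum.cong\<close>)
qed

lemma polynomial_in_uminus [intro]: "polynomial_in n P \<Longrightarrow> polynomial_in n (\<lambda>zs. - P zs)"
  using polynomial_in_mult[OF polynomial_in_const[of n "-1"]] by simp

lemma polynomial_in_diff [intro]:
  "polynomial_in n P \<Longrightarrow> polynomial_in n Q \<Longrightarrow> polynomial_in n (\<lambda>zs. P zs - Q zs)"
  using polynomial_in_add[OF _ polynomial_in_uminus] by simp

lemma polynomial_in_prod [intro]:
  "(\<And>x. x \<in> X \<Longrightarrow> polynomial_in n (P x)) \<Longrightarrow> polynomial_in n (\<lambda>zs. \<Prod>x\<in>X. P x zs)"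
  by (induction X rule: infinite_finite_induct) auto

lemma polynomial_in_power [intro]: "polynomial_in n P \<Longrightarrow> polynomial_in n (\<lambda>zs. P zs ^ k)"
  by (induction k) auto

lemma polynomial_in_tl:
  assumes "polynomial_in n P"
  shows "polynomial_in (Suc n) (\<lambda>zs. P (tl zs))"
proof -
  obtain A c where A: "finite A"
      "\<And>zs. length zs = n \<Longrightarrow> P zs = (\<Sum>\<alpha>\<in>A. c \<alpha> * (\<Prod>i<n. zs ! i ^ (\<alpha> :: nat \<Rightarrow> nat) i))"
    using assms(1) unfolding polynomial_in_def by auto
  show ?thesis
    by (rule polynomial_inI[where X = A and c = c and \<alpha> = "\<lambda>a. case_nat 0 a"])
      (use A in \<open>auto simp: prod.lessThan_Suc_shift nth_tl simp del: prod.lessThan_Suc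
          intro!: sum.cong prod.cong\<close>)
qed

definition poles :: "nat \<Rightarrow> (nat \<Rightarrow> nat) \<Rightarrow> (nat \<Rightarrow> nat \<Rightarrow> nat) \<Rightarrow> complex list \<Rightarrow> complex" where
  "poles n k l zs = (\<Prod>i<n. zs ! i ^ k i) * (\<Prod>j<n. \<Prod>i<j. (zs ! i - zs ! j) ^ l i j)"

lemma rational_in_iff:
  "rational_in n f \<longleftrightarrow>
    (\<exists>P k l. polynomial_in n P \<and> (\<forall>zs\<in>config n. f zs = P zs / poles n k l zs))"
  by (simp add: rational_in_def poles_def)

lemma polynomial_in_poles: "polynomial_in n (poles n k l)"
  unfolding poles_def
  by (intro polynomial_in_mult polynomial_in_prod polynomial_in_power polynomial_in_diff
      polynomial_in_nth) auto

lemma config_nth: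
  assumes "zs \<in> config n"
  shows "i < n \<Longrightarrow> zs ! i \<noteq> 0" and "i < n \<Longrightarrow> j < n \<Longrightarrow> i \<noteq> j \<Longrightarrow> zs ! i \<noteq> zs ! j"
  using assms unfolding config_def by (auto simp: nth_eq_iff_index_eq) (metis nth_mem)

lemma poles_nonzero: "zs \<in> config n \<Longrightarrow> poles n k l zs \<noteq> 0"
  by (auto simp: poles_def config_nth)

lemma poles_mult:
  "poles n k l zs * poles n k' l' zs = poles n (\<lambda>i. k i + k' i) (\<lambda>i j. l i j + l' i j) zs"
  by (simp add: poles_def power_add prod.distrib)

lemma rational_in_polynomial: "polynomial_in n P \<Longrightarrow> rational_in n P"
  unfolding rational_in_iff
  by (rule exI[of _ P], rule exI[of _ "\<lambda>_. 0"], rule exI[of _ "\<lambda>_ _. 0"]) (simp add: poles_def)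

lemma rational_in_const [intro]: "rational_in n (\<lambda>zs. c)"
  by (intro rational_in_polynomial polynomial_in_const)

lemma rational_in_nth [intro]: "j < n \<Longrightarrow> rational_in n (\<lambda>zs. zs ! j)"
  by (intro rational_in_polynomial polynomial_in_nth)

lemma rational_in_add [intro]:
  assumes "rational_in n f" "rational_in n g"
  shows "rational_in n (\<lambda>zs. f zs + g zs)"
proof -
  obtain P k l where P: "polynomial_in n P" "\<And>zs. zs \<in> config n \<Longrightarrow> f zs = P zs / poles n k l zs"
    using assms(1) unfolding rational_in_iff by auto
  obtain Q k' l' where Q: "polynomial_in n Q" "\<And>zs. zs \<in> config n \<Longrightarrow> g zs = Q zs / poles n k' l' zs"
    using assms(2) unfolding rational_in_iff by auto
  have "polynomial_in n (\<lambda>zs. P zs * poles n k' l' zs + Q zs * poles n k l zs)"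
    by (intro polynomial_in_add polynomial_in_mult P Q polynomial_in_poles)
  moreover have "f zs + g zs = (P zs * poles n k' l' zs + Q zs * poles n k l zs) /
      poles n (\<lambda>i. k i + k' i) (\<lambda>i j. l i j + l' i j) zs" if "zs \<in> config n" for zs
    using that by (simp add: P Q poles_nonzero add_frac_eq flip: poles_mult)
  ultimately show ?thesis
    unfolding rational_in_iff by blast
qed

lemma rational_in_mult [intro]:
  assumes "rational_in n f" "rational_in n g"
  shows "rational_in n (\<lambda>zs. f zs * g zs)"
proof -
  obtain P k l where P: "polynomial_in n P" "\<And>zs. zs \<in> config n \<Longrightarrow> f zs = P zs / poles n k l zs"
    using assms(1) unfolding rational_in_iff by auto
  obtain Q k' l' where Q: "polynomial_in n Q" "\<And>zs. zs \<in> config n \<Longrightarrow> g zs = Q zs / poles n k' l' zs"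
    using assms(2) unfolding rational_in_iff by auto
  have "polynomial_in n (\<lambda>zs. P zs * Q zs)"
    by (intro polynomial_in_mult P Q)
  moreover have "f zs * g zs = (P zs * Q zs) /
      poles n (\<lambda>i. k i + k' i) (\<lambda>i j. l i j + l' i j) zs" if "zs \<in> config n" for zs
    using that by (simp add: P Q flip: poles_mult)
  ultimately show ?thesis
    unfolding rational_in_iff by blast
qed

lemma rational_in_uminus [intro]: "rational_in n f \<Longrightarrow> rational_in n (\<lambda>zs. - f zs)"
  using rational_in_mult[OF rational_in_const[of n "-1"]] by simp

lemma rational_in_diff [intro]:
  "rational_in n f \<Longrightarrow> rational_in n g \<Longrightarrow> rational_in n (\<lambda>zs. f zs - g zs)"
  using rational_in_add[OF _ rational_in_uminus] by simp

lemma rational_in_power [intro]: "rational_in n f \<Longrightarrow> rational_in n (\<lambda>zs. f zs ^ k)"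
  by (induction k) auto

lemma rational_in_inverse_nth:
  assumes "j < n"
  shows "rational_in n (\<lambda>zs. inverse (zs ! j))"
  unfolding rational_in_iff
proof (intro exI conjI ballI)
  show "polynomial_in n (\<lambda>zs. 1)" by auto
  fix zs assume "zs \<in> config n"
  have "(\<Prod>i<n. zs ! i ^ (if i = j then 1 else 0)) = (\<Prod>i<n. if i = j then zs ! i else 1)"
    by (rule prod.cong) auto
  then show "inverse (zs ! j) = 1 / poles n (\<lambda>i. if i = j then 1 else 0) (\<lambda>_ _. 0) zs"
    using assms by (simp add: poles_def inverse_eq_divide)
qed

lemma rational_in_inverse_diff_less:
  assumes "a < b" "b < n"
  shows "rational_in n (\<lambda>zs. inverse (zs ! a - zs ! b))"
  unfolding rational_in_iff
proof (intro exI conjI ballI)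
  show "polynomial_in n (\<lambda>zs. 1)" by auto
  fix zs assume "zs \<in> config n"
  have "(\<Prod>j<n. \<Prod>i<j. (zs ! i - zs ! j) ^ (if i = a \<and> j = b then 1 else 0)) =
        (\<Prod>j<n. if j = b then (\<Prod>i<j. (zs ! i - zs ! j) ^ (if i = a then 1 else 0)) else 1)"
    by (rule prod.cong) auto
  also have "\<dots> = (\<Prod>i<b. if i = a then zs ! i - zs ! b else 1)"
    using assms by (subst prod.delta) (auto simp: if_distrib[of "\<lambda>k. _ ^ k"] cong: if_cong)
  finally show "inverse (zs ! a - zs ! b) =
      1 / poles n (\<lambda>_. 0) (\<lambda>i j. if i = a \<and> j = b then 1 else 0) zs"
    using assms by (simp add: poles_def inverse_eq_divide)
qed

lemma rational_in_inverse_diff: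
  assumes "a \<noteq> b" "a < n" "b < n"
  shows "rational_in n (\<lambda>zs. inverse (zs ! a - zs ! b))"
proof (cases "a < b")
  case False
  then have "rational_in n (\<lambda>zs. - inverse (zs ! b - zs ! a))"
    using assms by (intro rational_in_uminus rational_in_inverse_diff_less) auto
  then show ?thesis by (simp flip: inverse_minus_eq)
qed (use assms rational_in_inverse_diff_less in auto)

lemma rational_in_powi:
  assumes "rational_in n f" "rational_in n (\<lambda>zs. inverse (f zs))"
  shows "rational_in n (\<lambda>zs. f zs powi k)"
  using assms by (cases "k \<ge> 0") (auto simp: power_int_def)

lemma rational_in_powi_nth: "j < n \<Longrightarrow> rational_in n (\<lambda>zs. zs ! j powi k)"
  by (intro rational_in_powi rational_in_nth rational_in_inverse_nth)

lemma rational_in_powi_diff: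
  "a \<noteq> b \<Longrightarrow> a < n \<Longrightarrow> b < n \<Longrightarrow> rational_in n (\<lambda>zs. (zs ! a - zs ! b) powi k)"
  by (intro rational_in_powi rational_in_diff rational_in_nth rational_in_inverse_diff)

lemma rational_in_tl:
  assumes "rational_in n f"
  shows "rational_in (Suc n) (\<lambda>zs. f (tl zs))"
proof -
  obtain P k l where P: "polynomial_in n P" "\<And>zs. zs \<in> config n \<Longrightarrow> f zs = P zs / poles n k l zs"
    using assms(1) unfolding rational_in_iff by auto
  \<comment> \<open>The prepended variable contributes no pole: its own exponent and those of its
    differences with the other variables are 0.\<close>
  let ?k = "case_nat 0 k" and ?l = "\<lambda>i j. case_nat 0 (\<lambda>i. case_nat 0 (l i) j) i"
  have "poles (Suc n) ?k ?l zs = poles n k l (tl zs)" if "length zs = Suc n" for zs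
    unfolding poles_def prod.lessThan_Suc_shift using that by (simp add: nth_tl)
  moreover have "tl zs \<in> config n \<and> length zs = Suc n" if "zs \<in> config (Suc n)" for zs
    using that by (cases zs) (auto simp: config_def)
  ultimately have "f (tl zs) = P (tl zs) / poles (Suc n) ?k ?l zs" if "zs \<in> config (Suc n)" for zs
    using that P(2) by simp
  with polynomial_in_tl[OF P(1)] show ?thesis
    unfolding rational_in_iff by blast
qed


section \<open>Absolutely convergent expansions\<close>

text \<open>Over the complex numbers unconditional summability is the same as absolute
  summability.\<close>

lemma abs_sums_to_iff:
  "abs_sums_to n c zs s \<longleftrightarrow> (series_term n c zs has_sum s) {ns. length ns = n}"
  unfolding abs_sums_to_def
  by (metis summable_on_iff_abs_summable_on_complex has_sum_imp_summable)

lemma abs_sums_to_add: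
  "abs_sums_to n c zs s \<Longrightarrow> abs_sums_to n d zs t \<Longrightarrow> abs_sums_to n (\<lambda>ns. c ns + d ns) zs (s + t)"
  unfolding abs_sums_to_iff series_term_def distrib_right by (rule has_sum_add)

lemma abs_sums_to_cmult:
  "abs_sums_to n c zs s \<Longrightarrow> abs_sums_to n (\<lambda>ns. a * c ns) zs (a * s)"
  unfolding abs_sums_to_iff series_term_def mult.assoc by (rule has_sum_cmult_right)

lemma abs_sums_to_0: "abs_sums_to n (\<lambda>ns. 0) zs 0"
  unfolding abs_sums_to_iff series_term_def by simp

lemma abs_sums_to_cong:
  "(\<And>ns. length ns = n \<Longrightarrow> c ns = d ns) \<Longrightarrow> s = t \<Longrightarrow> abs_sums_to n c zs s = abs_sums_to n d zs t"
  unfolding abs_sums_to_iff series_term_def by (auto intro!: has_sum_cong)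

lemma has_sum_product_complex:
  fixes f g :: "_ \<Rightarrow> complex"
  assumes "(f has_sum a) A" "(g has_sum b) B"
  shows "((\<lambda>(x, y). f x * g y) has_sum (a * b)) (A \<times> B)"
proof -
  have f: "(\<lambda>x. norm (f x)) summable_on A" and g: "(\<lambda>x. norm (g x)) summable_on B"
    using assms by (auto simp flip: summable_on_iff_abs_summable_on_complex dest: has_sum_imp_summable)
  have "(\<lambda>p. norm (case p of (x, y) \<Rightarrow> f x * g y)) summable_on A \<times> B"
  proof (subst Infinite_Sum.abs_summable_on_Sigma_iff, intro conjI ballI)
    have "(\<Sum>\<^sub>\<infinity>y\<in>B. norm (f x * g y)) = norm (f x) * (\<Sum>\<^sub>\<infinity>y\<in>B. norm (g y))" for x
      by (simp add: norm_mult infsum_cmult_right')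
    moreover have "(\<Sum>\<^sub>\<infinity>y\<in>B. norm (g y)) \<ge> 0" by (simp add: infsum_nonneg)
    ultimately show "(\<lambda>x. norm (\<Sum>\<^sub>\<infinity>y\<in>B. norm (case (x, y) of (x, y) \<Rightarrow> f x * g y))) summable_on A"
      using f by (simp add: norm_mult summable_on_cmult_left)
  qed (use g in \<open>auto simp: norm_mult intro: summable_on_cmult_right\<close>)
  then have "(\<lambda>(x, y). f x * g y) summable_on A \<times> B"
    by (rule abs_summable_summable)
  then show ?thesis
    by (intro has_sum_SigmaI[where g = "\<lambda>x. f x * b"])
      (auto intro!: has_sum_cmult_right has_sum_cmult_left assms)
qed

text \<open>Negative \<open>a\<close> is the case of interest. With \<open>z = x / y\<close> this is
  the generalized binomial series in the unit disc, where the principal branch of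
  \<open>powr\<close> agrees with \<open>powi\<close> at an integer exponent.\<close>

lemma binomial_powi_has_sum:
  fixes x y :: complex
  assumes "norm x < norm y"
  shows "((\<lambda>j::nat. (of_int a gchoose j) * x ^ j * y powi (a - int j)) has_sum (y + x) powi a) UNIV"
proof -
  have y: "y \<noteq> 0" using assms by auto
  define z where "z = x / y"
  have z: "norm z < 1" using assms y by (simp add: z_def norm_divide)
  then have z1: "1 + z \<noteq> 0"
    by (metis add_eq_0_iff less_irrefl norm_minus_cancel norm_one)
  have "(\<lambda>n. (of_int a gchoose n) * z ^ n) sums (1 + z) powr of_int a"
    by (rule gen_binomial_complex[OF z])
  then have s: "(\<lambda>n. (of_int a gchoose n) * z ^ n) sums (1 + z) powi a"
    using z1 by (simp add: complex_powr_of_int)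
  have "summable (\<lambda>n. norm ((of_int a gchoose n) * z ^ n))"
    by (rule abs_summable_in_conv_radius) (use z in \<open>auto simp: conv_radius_gchoose one_ereal_def\<close>)
  from norm_summable_imp_has_sum[OF this s]
  have "((\<lambda>n. y powi a * ((of_int a gchoose n) * z ^ n)) has_sum (y powi a * (1 + z) powi a)) UNIV"
    by (rule has_sum_cmult_right)
  also have "y powi a * (1 + z) powi a = (y + x) powi a"
    using y by (simp add: z_def distrib_left flip: power_int_mult_distrib)
  also have "(\<lambda>n. y powi a * ((of_int a gchoose n) * z ^ n)) =
      (\<lambda>j. (of_int a gchoose j) * x ^ j * y powi (a - int j))"
    using y by (auto simp: fun_eq_iff z_def power_int_diff power_divide)
  finally show ?thesis .
qed

text \<open>This is \<open>converges_to_rational\<close> for one functional with the limit named, so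
  that pieces of a product can be multiplied by kernels in a new variable and added up.\<close>

definition radial_expansion :: "nat \<Rightarrow> (int list \<Rightarrow> complex) \<Rightarrow> (complex list \<Rightarrow> complex) \<Rightarrow> bool" where
  "radial_expansion n c f \<longleftrightarrow> rational_in n f \<and> (\<forall>zs\<in>radial_region n. abs_sums_to n c zs (f zs))"

lemma radial_expansion_cong:
  "(\<And>ns. length ns = n \<Longrightarrow> c ns = d ns) \<Longrightarrow> radial_expansion n c f = radial_expansion n d f"
  unfolding radial_expansion_def by (auto cong: abs_sums_to_cong)

lemma radial_expansion_add:
  "radial_expansion n c f \<Longrightarrow> radial_expansion n d g \<Longrightarrow> radial_expansion n (\<lambda>ns. c ns + d ns) (\<lambda>zs. f zs + g zs)"
  unfolding radial_expansion_def by (auto intro: abs_sums_to_add)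

lemma radial_expansion_cmult:
  "radial_expansion n c f \<Longrightarrow> radial_expansion n (\<lambda>ns. a * c ns) (\<lambda>zs. a * f zs)"
  unfolding radial_expansion_def by (auto intro: abs_sums_to_cmult)

lemma radial_expansion_0: "radial_expansion n (\<lambda>ns. 0) (\<lambda>zs. 0)"
  unfolding radial_expansion_def by (auto intro: abs_sums_to_0)

lemma radial_expansion_sum:
  assumes "\<And>x. x \<in> X \<Longrightarrow> \<exists>f. radial_expansion n (c x) f"
  shows "\<exists>f. radial_expansion n (\<lambda>ns. \<Sum>x\<in>X. c x ns) f"
proof -
  obtain f where f: "\<And>x. x \<in> X \<Longrightarrow> radial_expansion n (c x) (f x)" using assms by metis
  have "radial_expansion n (\<lambda>ns. \<Sum>x\<in>X. c x ns) (\<lambda>zs. \<Sum>x\<in>X. f x zs)"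
    using f by (induction X rule: infinite_finite_induct)
      (auto intro: radial_expansion_add radial_expansion_0)
  then show ?thesis by blast
qed

lemma series_term_Cons:
  "series_term (Suc n) c (z # zs) (m # ns) = z powi (- m - 1) * series_term n (\<lambda>ns. c (m # ns)) zs ns"
  unfolding series_term_def prod.lessThan_Suc_shift by (simp add: mult_ac)

lemma radial_region_Suc:
  assumes "zs \<in> radial_region (Suc n)"
  obtains z zs' where "zs = z # zs'" "zs' \<in> radial_region n" "z \<noteq> 0"
    "\<And>j. j < n \<Longrightarrow> norm (zs' ! j) < norm z" "\<And>j. j < n \<Longrightarrow> zs' ! j \<noteq> 0"
proof (cases zs)
  case (Cons z zs')
  with assms show ?thesis
    by (intro that[of z zs']) (auto simp: radial_region_def dest: nth_mem)
qed (use assms in \<open>simp add: radial_region_def\<close>)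

lemma radial_region_nth: "zs \<in> radial_region n \<Longrightarrow> j < n \<Longrightarrow> zs ! j \<noteq> 0"
  by (auto simp: radial_region_def in_set_conv_nth)

text \<open>A new outermost variable that occurs to one power only; this handles one fixed mode of
  the leftmost operator.\<close>

lemma radial_expansion_delta:
  assumes "radial_expansion n c f"
  shows "radial_expansion (Suc n) (\<lambda>ns. if hd ns = k then c (tl ns) else 0)
           (\<lambda>zs. zs ! 0 powi (- k - 1) * f (tl zs))"
  unfolding radial_expansion_def
proof (intro conjI ballI)
  show "rational_in (Suc n) (\<lambda>zs. zs ! 0 powi (- k - 1) * f (tl zs))"
    using assms by (intro rational_in_mult rational_in_powi_nth rational_in_tl)
      (auto simp: radial_expansion_def)
  fix zs assume "zs \<in> radial_region (Suc n)"
  then obtain z zs' where zs: "zs = z # zs'" "zs' \<in> radial_region n"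
    by (rule radial_region_Suc)
  let ?c = "\<lambda>ns. if hd ns = k then c (tl ns) else 0"
  have "(series_term n c zs' has_sum f zs') {ns. length ns = n}"
    using assms zs by (auto simp: radial_expansion_def abs_sums_to_iff)
  then have "((\<lambda>ns. z powi (- k - 1) * series_term n c zs' ns) has_sum z powi (- k - 1) * f zs')
      {ns. length ns = n}"
    by (rule has_sum_cmult_right)
  also have "?this \<longleftrightarrow> (series_term (Suc n) ?c zs has_sum z powi (- k - 1) * f zs')
      ((#) k ` {ns. length ns = n})"
    by (subst has_sum_reindex) (auto simp: o_def zs series_term_Cons)
  also have "\<dots> \<longleftrightarrow> (series_term (Suc n) ?c zs has_sum z powi (- k - 1) * f zs')
      {ns. length ns = Suc n}"
    by (rule has_sum_cong_neutral)
      (auto simp: series_term_def length_Suc_conv image_iff)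
  finally show "abs_sums_to (Suc n) ?c zs (zs ! 0 powi (- k - 1) * f (tl zs))"
    by (simp add: abs_sums_to_iff zs)
qed

lemma series_term_update:
  assumes "j < n" "zs ! j \<noteq> 0" "length ns = n"
  shows "series_term n c zs (ns[j := ns ! j - k]) =
      zs ! j powi k * series_term n (\<lambda>ns. c (ns[j := ns ! j - k])) zs ns"
proof -
  have "(\<Prod>i<n. zs ! i powi (- (ns[j := ns ! j - k] ! i) - 1)) =
      zs ! j powi (- (ns ! j - k) - 1) * (\<Prod>i\<in>{..<n} - {j}. zs ! i powi (- ns ! i - 1))"
    using assms by (subst prod.remove[of _ j]) (auto intro!: prod.cong)
  also have "zs ! j powi (- (ns ! j - k) - 1) = zs ! j powi k * zs ! j powi (- (ns ! j) - 1)"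
    using assms by (simp add: algebra_simps flip: power_int_add)
  also have "zs ! j powi k * zs ! j powi (- ns ! j - 1) * (\<Prod>i\<in>{..<n} - {j}. zs ! i powi (- ns ! i - 1))
      = zs ! j powi k * (\<Prod>i<n. zs ! i powi (- ns ! i - 1))"
    using assms by (subst (2) prod.remove[of _ j]) (auto simp: mult_ac)
  finally show ?thesis by (simp add: series_term_def mult_ac)
qed

lemma has_sum_update:
  assumes "j < n"
  shows "(h has_sum s) {ns :: int list. length ns = n} \<longleftrightarrow>
    ((\<lambda>ns. h (ns[j := ns ! j - k])) has_sum s) {ns. length ns = n}"
  by (rule has_sum_reindex_bij_witness[of _ "\<lambda>ns. ns[j := ns ! j - k]" "\<lambda>ns. ns[j := ns ! j + k]"])
    (use assms in auto)

lemma radial_expansion_shift: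
  assumes "radial_expansion n c f" "j < n"
  shows "radial_expansion n (\<lambda>ns. c (ns[j := ns ! j - k])) (\<lambda>zs. zs ! j powi (- k) * f zs)"
  unfolding radial_expansion_def
proof (intro conjI ballI)
  show "rational_in n (\<lambda>zs. zs ! j powi (- k) * f zs)"
    using assms by (intro rational_in_mult rational_in_powi_nth) (auto simp: radial_expansion_def)
  fix zs assume zs: "zs \<in> radial_region n"
  then have z: "zs ! j \<noteq> 0" using assms by (simp add: radial_region_nth)
  have "(series_term n c zs has_sum f zs) {ns. length ns = n}"
    using assms zs by (auto simp: radial_expansion_def abs_sums_to_iff)
  then have "((\<lambda>ns. series_term n c zs (ns[j := ns ! j - k])) has_sum f zs) {ns. length ns = n}"
    using has_sum_update[OF assms(2)] by blast
  then have "((\<lambda>ns. zs ! j powi k * series_term n (\<lambda>ns. c (ns[j := ns ! j - k])) zs ns) has_sum f zs)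
      {ns. length ns = n}"
    by (rule has_sum_cong[THEN iffD1, rotated]) (use assms z in \<open>simp add: series_term_update\<close>)
  then have "((\<lambda>ns. zs ! j powi (- k) * (zs ! j powi k * series_term n (\<lambda>ns. c (ns[j := ns ! j - k])) zs ns))
      has_sum zs ! j powi (- k) * f zs) {ns. length ns = n}"
    by (rule has_sum_cmult_right)
  then show "abs_sums_to n (\<lambda>ns. c (ns[j := ns ! j - k])) zs (zs ! j powi (- k) * f zs)"
    using z by (simp add: abs_sums_to_iff power_int_minus field_simps)
qed

text \<open>The \<open>i\<close>-th divided derivative in \<open>w\<close> of the geometric series
  of \<open>1 / (z - w)\<close>; the poles at \<open>z_i = z_j\<close> come from here.\<close>

lemma binomial_kernel_has_sum:
  fixes z w :: complex
  assumes "norm w < norm z" "w \<noteq> 0"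
  shows "((\<lambda>m. (of_int m gchoose i) * w powi (m - int i) * z powi (- m - 1))
      has_sum (z - w) powi (- int i - 1)) {0..}"
proof -
  have "((\<lambda>j::nat. (of_int (- int i - 1) gchoose j) * (- w) ^ j * z powi (- int i - 1 - int j))
      has_sum (z + - w) powi (- int i - 1)) UNIV"
    by (rule binomial_powi_has_sum) (use assms in auto)
  also have "?this \<longleftrightarrow> ((\<lambda>m. (of_int m gchoose i) * w powi (m - int i) * z powi (- m - 1))
      has_sum (z - w) powi (- int i - 1)) {int i..}"
  \<comment> \<open>With \<open>m = i + j\<close> the terms agree because
    \<open>binom(i + j, i) = (-1)^j binom(- i - 1, j)\<close>.\<close>
  proof (rule has_sum_reindex_bij_witness[of _ "\<lambda>m. nat (m - int i)" "\<lambda>j. int (i + j)"])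
    fix j :: nat
    have "(of_int (int (i + j)) gchoose i :: complex) = of_nat ((i + j) choose i)"
      by (metis binomial_gbinomial of_int_of_nat_eq)
    also have "\<dots> = of_nat ((i + j) choose j)"
      by (metis add_diff_cancel_left' binomial_symmetric le_add1)
    also have "\<dots> = (- 1) ^ j * (of_int (- int i - 1) gchoose j)"
      using gbinomial_minus[of "of_nat i + 1 :: complex" j]
      by (simp add: binomial_gbinomial add_ac minus_diff_commute uminus_add_conv_diff
          flip: power_mult_distrib mult.assoc)
    finally show "(of_int (int (i + j)) gchoose i) * w powi (int (i + j) - int i) *
        z powi (- int (i + j) - 1) =
        (of_int (- int i - 1) gchoose j) * (- w) ^ j * z powi (- int i - 1 - int j)"
      by (simp add: algebra_simps power_minus[of w])
  qed auto
  also have "\<dots> \<longleftrightarrow> ((\<lambda>m. (of_int m gchoose i) * w powi (m - int i) * z powi (- m - 1))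
      has_sum (z - w) powi (- int i - 1)) {0..}"
  proof (rule has_sum_cong_neutral)
    fix m assume "m \<in> {0..} - {int i..}"
    then have "of_int m = (of_nat (nat m) :: complex)" "nat m < i" by auto
    then show "(of_int m gchoose i) * w powi (m - int i) * z powi (- m - 1) = 0"
      by (metis binomial_eq_0 binomial_gbinomial mult_zero_left of_nat_0)
  qed auto
  finally show ?thesis .
qed

text \<open>The generating function of commutator terms: moving \<open>s_m\<close> with
  \<open>m >= 0\<close> past the \<open>j\<close>-th factor gives \<open>binom(m, i)\<close> times a
  mode of \<open>s_i t_j\<close> with index raised by \<open>m - i\<close>, and the sum over
  \<open>m\<close> is the kernel of \<open>binomial_kernel_has_sum\<close> with \<open>w\<close> the
  \<open>j\<close>-th inner variable.\<close>

lemma radial_expansion_binomial: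
  assumes "radial_expansion n c f" "j < n"
  shows "radial_expansion (Suc n)
      (\<lambda>ns. if hd ns \<ge> 0 then (of_int (hd ns) gchoose i) *
         c ((tl ns)[j := tl ns ! j + hd ns - int i]) else 0)
      (\<lambda>zs. (zs ! 0 - zs ! Suc j) powi (- int i - 1) * f (tl zs))"
  unfolding radial_expansion_def
proof (intro conjI ballI)
  show "rational_in (Suc n) (\<lambda>zs. (zs ! 0 - zs ! Suc j) powi (- int i - 1) * f (tl zs))"
    using assms by (intro rational_in_mult rational_in_powi_diff rational_in_tl)
      (auto simp: radial_expansion_def)
  fix zs assume "zs \<in> radial_region (Suc n)"
  then obtain z zs' where zs: "zs = z # zs'" "zs' \<in> radial_region n"
    and z: "norm (zs' ! j) < norm z" "zs' ! j \<noteq> 0"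
    using assms by (metis radial_region_Suc)
  define w where "w = zs' ! j"
  let ?c = "\<lambda>ns. if hd ns \<ge> 0 then (of_int (hd ns) gchoose i) *
         c ((tl ns)[j := tl ns ! j + hd ns - int i]) else 0"
  let ?s = "(z - w) powi (- int i - 1) * f zs'"
  have "(series_term n c zs' has_sum f zs') {ns. length ns = n}"
    using assms zs by (auto simp: radial_expansion_def abs_sums_to_iff)
  then have "((\<lambda>(m, ns). ((of_int m gchoose i) * w powi (m - int i) * z powi (- m - 1)) *
      series_term n c zs' ns) has_sum ?s) ({0..} \<times> {ns. length ns = n})"
    by (intro has_sum_product_complex binomial_kernel_has_sum) (use z in \<open>auto simp: w_def\<close>)
  also have "?this \<longleftrightarrow> (series_term (Suc n) ?c zs has_sum ?s) {ns. length ns = Suc n \<and> hd ns \<ge> 0}"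
  proof (rule has_sum_reindex_bij_witness[of _
        "\<lambda>ns. (hd ns, (tl ns)[j := tl ns ! j + hd ns - int i])"
        "\<lambda>(m, ns). m # ns[j := ns ! j - (m - int i)]"], goal_cases)
    case (5 mns)
    obtain m ns where mns: "mns = (m, ns)" "length ns = n" "m \<ge> 0" using 5 by (cases mns) auto
    have "series_term n c zs' ns =
       series_term n c zs' ((ns[j := ns ! j - (m - int i)])[j := ns[j := ns ! j - (m - int i)] ! j - (int i - m)])"
      using assms mns by simp
    also have "\<dots> = w powi (int i - m) *
      series_term n (\<lambda>ns. c (ns[j := ns ! j + m - int i])) zs' (ns[j := ns ! j - (m - int i)])"
      using z assms mns by (subst series_term_update) (auto simp: w_def algebra_simps)
    finally have "w powi (m - int i) * series_term n c zs' ns =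
      series_term n (\<lambda>ns. c (ns[j := ns ! j + m - int i])) zs' (ns[j := ns ! j - (m - int i)])"
      using z by (simp add: w_def power_int_diff)
    then show ?case
      using mns unfolding mns(1) prod.case zs(1) series_term_Cons
      by (simp add: series_term_def mult_ac)
  qed (use assms in \<open>auto simp: length_Suc_conv\<close>)
  also have "\<dots> \<longleftrightarrow> (series_term (Suc n) ?c zs has_sum ?s) {ns. length ns = Suc n}"
    by (rule has_sum_cong_neutral) (auto simp: series_term_def)
  finally show "abs_sums_to (Suc n) ?c zs ((zs ! 0 - zs ! Suc j) powi (- int i - 1) * f (tl zs))"
    by (simp add: abs_sums_to_iff zs w_def)
qed


section \<open>Consequences of the Borcherds identity\<close>

lemmas hom_simps =
  module_hom.add module_hom.diff module_hom.neg module_hom.scale module_hom.zero module_hom.sum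

lemma vmode_eventually_0: "\<exists>N::nat. \<forall>n\<ge>int N. vmode B u n v = 0"
proof (intro exI allI impI)
  fix n assume "n \<ge> int (nat (- fls_subdegree (B u v)))"
  then show "vmode B u n v = 0"
    unfolding vmode_def by (intro fls_eq0_below_subdegree) linarith
qed

lemma fls_nth_conv_vmode: "fls_nth (B u v) k = vmode B u (- k - 1) v"
  by (simp add: vmode_def)

lemma gbinomial_zero_left: "(0 :: complex) gchoose i = (if i = 0 then 1 else 0)"
  by (cases i) auto

lemma gbinomial_minus_1: "(- 1 :: complex) gchoose i = (- 1) ^ i"
  using gbinomial_minus[of "1 :: complex" i] binomial_gbinomial[of i i, where 'a = complex]
  by simp

context vertex_algebra
begin

abbreviation mode :: "'v \<Rightarrow> int \<Rightarrow> 'v \<Rightarrow> 'v" where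
  "mode u n v \<equiv> vmode Y u n v"

lemmas mode_left_simps = hom_simps[OF linear_left[folded module_hom_iff_linear]]

lemmas mode_right_simps = hom_simps[OF linear_right[folded module_hom_iff_linear]]

lemmas mode_simps = mode_left_simps mode_right_simps

text \<open>The Borcherds identity at \<open>l = 0\<close>, where only \<open>i = 0\<close> survives
  on the right.\<close>

lemma commutator_formula:
  assumes "\<And>i. i \<ge> I \<Longrightarrow> mode u (int i) v = 0"
  shows "mode u m (mode v n w) = mode v n (mode u m w) +
     (\<Sum>i<I. scale (of_int m gchoose i) (mode (mode u (int i) v) (m + n - int i) w))"
proof -
  have "(\<Sum>i<I. scale (of_int m gchoose i) (mode (mode u (int i) v) (m + n - int i) w)) =
      Sum_any (\<lambda>i::nat. scale (of_int m gchoose i) (mode (mode u (0 + int i) v) (m + n - int i) w))"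
    by (subst Sum_any.expand_superset[of "{..<I}"])
      (use assms in \<open>auto simp: mode_simps not_less intro: ccontr\<close>)
  also have "\<dots> = Sum_any (\<lambda>i::nat. scale ((- 1) ^ i * (of_int 0 gchoose i))
          (mode u (m + 0 - int i) (mode v (n + int i) w) -
           scale ((- 1) powi 0) (mode v (n + 0 - int i) (mode u (m + int i) w))))"
    by (rule jacobi)
  also have "\<dots> = mode u m (mode v n w) - mode v n (mode u m w)"
    by (subst Sum_any.expand_superset[of "{0}"]) (auto simp: gbinomial_zero_left split: if_splits)
  finally show ?thesis by (simp add: algebra_simps)
qed

text \<open>The Borcherds identity at \<open>m = 0\<close>, where only \<open>i = 0\<close> survives
  on the left.\<close>

lemma iterate_formula:
  assumes "\<And>i. i \<ge> I \<Longrightarrow> mode u (int i) w = 0" "\<And>i. i \<ge> I \<Longrightarrow> mode v (n + int i) w = 0"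
  shows "mode (mode u l v) n w =
     (\<Sum>i<I. scale ((- 1) ^ i * (of_int l gchoose i))
        (mode u (l - int i) (mode v (n + int i) w) -
         scale ((- 1) powi l) (mode v (n + l - int i) (mode u (int i) w))))"
proof -
  have "mode (mode u l v) n w =
      Sum_any (\<lambda>i::nat. scale (of_int 0 gchoose i) (mode (mode u (l + int i) v) (0 + n - int i) w))"
    by (subst Sum_any.expand_superset[of "{0}"]) (auto simp: gbinomial_zero_left split: if_splits)
  also have "\<dots> = Sum_any (\<lambda>i::nat. scale ((- 1) ^ i * (of_int l gchoose i))
          (mode u (0 + l - int i) (mode v (n + int i) w) -
           scale ((- 1) powi l) (mode v (n + l - int i) (mode u (0 + int i) w))))"
    by (rule jacobi)
  also have "\<dots> = (\<Sum>i<I. scale ((- 1) ^ i * (of_int l gchoose i))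
        (mode u (l - int i) (mode v (n + int i) w) -
         scale ((- 1) powi l) (mode v (n + l - int i) (mode u (int i) w))))"
    by (subst Sum_any.expand_superset[of "{..<I}"])
      (use assms in \<open>auto simp: mode_simps not_less intro: ccontr\<close>)
  finally show ?thesis .
qed

end

context grading_restricted_vertex_algebra
begin

section \<open>The translation operator \<open>D\<close> and skew-symmetry of
  \<open>Y\<close>\<close>

lemma D_linear: "Vector_Spaces.linear scale scale D"
  using linear_left[of "-2" vac] unfolding D_def[abs_def] .

lemmas D_simps = hom_simps[OF D_linear[folded module_hom_iff_linear]]

lemma gbinomial_minus_2: "(- 1) ^ i * ((- 2 :: complex) gchoose i) = of_nat (Suc i)"
proof -
  have "((- 2 :: complex) gchoose i) = (- 1) ^ i * (of_nat (Suc i) gchoose i)"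
    using gbinomial_minus[of "2::complex" i] by (simp add: algebra_simps)
  also have "of_nat (Suc i) gchoose i = (of_nat (Suc i choose i) :: complex)"
    by (rule binomial_gbinomial[symmetric])
  finally show ?thesis by (simp flip: power_mult_distrib mult.assoc)
qed

text \<open>\<open>D u\<close> is \<open>u_(-2) vac\<close>, and in the iterate formula
  \<open>vac\<close> acts only through its mode \<open>-1\<close>: this leaves
  \<open>i = - 1 - n\<close> from the first half if \<open>n < 0\<close>, \<open>i = n - 1\<close>
  from the second half if \<open>n > 0\<close>, and nothing if \<open>n = 0\<close>.\<close>

lemma mode_D_left: "mode (D u) n w = scale (- of_int n) (mode u (n - 1) w)"
proof -
  obtain N :: nat where N: "\<And>i. i \<ge> N \<Longrightarrow> mode u (int i) w = 0"
    using vmode_eventually_0[of Y u w] by (metis of_nat_mono)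
  define I where "I = N + nat \<bar>n\<bar> + 2"
  have "mode (D u) n w = (\<Sum>i<I. scale ((- 1) ^ i * (of_int (- 2) gchoose i))
        (mode u (- 2 - int i) (mode vac (n + int i) w) -
         scale ((- 1) powi (- 2)) (mode vac (n + (- 2) - int i) (mode u (int i) w))))"
    unfolding D_def by (rule iterate_formula) (auto simp: I_def N vacuum)
  also have "\<dots> = (\<Sum>i<I. scale (of_nat (Suc i))
        ((if n + int i = -1 then mode u (- 2 - int i) w else 0) -
         (if n - 2 - int i = -1 then mode u (int i) w else 0)))"
    by (rule sum.cong) (auto simp: gbinomial_minus_2[unfolded of_nat_Suc] vacuum mode_simps)
  also have "\<dots> = scale (- of_int n) (mode u (n - 1) w)"
  proof -
    consider "n < 0" | "n = 0" | "n > 0" by linarith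
    then show ?thesis
    proof cases
      case 1
      define k where "k = nat (- 1 - n)"
      have n: "n = - 1 - int k" using 1 by (simp add: k_def)
      have "(\<Sum>i<I. scale (of_nat (Suc i))
        ((if n + int i = -1 then mode u (- 2 - int i) w else 0) -
         (if n - 2 - int i = -1 then mode u (int i) w else 0))) =
        (\<Sum>i<I. if i = k then scale (of_nat (Suc k)) (mode u (- 2 - int k) w) else 0)"
        by (rule sum.cong) (auto simp: n)
      also have "\<dots> = scale (of_nat (Suc k)) (mode u (- 2 - int k) w)"
        by (subst sum.delta) (auto simp: I_def n)
      also have "- 2 - int k = n - 1" by (simp add: n)
      finally show ?thesis by (simp add: n algebra_simps)
    next
      case 2
      then show ?thesis by (intro trans[OF sum.neutral]) auto
    next
      case 3
      define k where "k = nat (n - 1)"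
      have n: "n = int k + 1" using 3 by (simp add: k_def)
      have "(\<Sum>i<I. scale (of_nat (Suc i))
        ((if n + int i = -1 then mode u (- 2 - int i) w else 0) -
         (if n - 2 - int i = -1 then mode u (int i) w else 0))) =
        (\<Sum>i<I. if i = k then scale (- of_nat (Suc k)) (mode u (int k) w) else 0)"
        by (rule sum.cong) (auto simp: n simp flip: scale_minus_left)
      also have "\<dots> = scale (- of_nat (Suc k)) (mode u (int k) w)"
        by (subst sum.delta) (auto simp: I_def n)
      also have "- of_nat (Suc k) = (- of_int n :: complex)" by (simp add: n)
      also have "int k = n - 1" by (simp add: n)
      finally show ?thesis .
    qed
  qed
  finally show ?thesis .
qed

lemma D_mode: "D (mode u n v) = mode u n (D v) + mode (D u) n v"
proof -
  obtain N :: nat where N: "\<And>i. i \<ge> N \<Longrightarrow> mode u (int i) vac = 0"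
      "\<And>i. i \<ge> N \<Longrightarrow> mode v (int i) vac = 0"
    by (metis creation_regular of_nat_0_le_iff)
  \<comment> \<open>The left side is an iterate applied to \<open>vac\<close>; since
    \<open>v_(-2 + i) vac = 0\<close> for \<open>i >= 2\<close> and \<open>u_i vac = 0\<close>, two
    terms remain.\<close>
  have "D (mode u n v) = (\<Sum>i<2. scale ((- 1) ^ i * (of_int n gchoose i))
        (mode u (n - int i) (mode v (- 2 + int i) vac) -
         scale ((- 1) powi n) (mode v (- 2 + n - int i) (mode u (int i) vac))))"
    unfolding D_def by (rule iterate_formula) (auto simp: creation_regular)
  also have "\<dots> = mode u n (D v) - scale (of_int n) (mode u (n - 1) v)"
    by (simp add: numeral_2_eq_2 creation_regular creation mode_simps D_def)
  finally show ?thesis by (simp add: mode_D_left)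
qed

lemma D_vac: "D vac = 0"
  by (simp add: D_def vacuum)

text \<open>The coefficients of \<open>Y(u, x) vac = e^(xD) u\<close>: \<open>mode_D_left\<close> at
  index \<open>- 1 - i\<close> brings in the factor \<open>i + 1\<close>. It lets exponentials of
  \<open>D\<close> be read as vertex operators.\<close>

lemma mode_vac: "mode u (- 1 - int i) vac = scale (1 / fact i) ((D ^^ i) u)"
proof (induction i arbitrary: u)
  case (Suc i)
  have "mode (D u) (- 1 - int i) vac = scale (of_nat (Suc i)) (mode u (- 1 - int (Suc i)) vac)"
    by (simp add: mode_D_left algebra_simps)
  then have "mode u (- 1 - int (Suc i)) vac = scale (1 / of_nat (Suc i)) (mode (D u) (- 1 - int i) vac)"
    by (simp del: of_nat_Suc)
  also have "\<dots> = scale (1 / fact (Suc i)) ((D ^^ Suc i) u)"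
    by (simp add: Suc funpow_swap1 del: of_nat_Suc funpow.simps(2))
      (simp add: funpow_swap1 mult.commute)
  finally show ?case .
qed (simp add: creation)

lemma exp_D_neg_eq_sum:
  assumes "\<And>i. i \<ge> I \<Longrightarrow> F (k - int i) = 0"
  shows "exp_D_neg F k = (\<Sum>i<I. scale ((- 1) powi (k - int i) / fact i) ((D ^^ i) (F (k - int i))))"
proof -
  have lin: "(D ^^ i) (scale c x) = scale c ((D ^^ i) x)" "(D ^^ i) 0 = 0" for i c x
    by (induction i) (auto simp: D_simps)
  have "exp_D_neg F k =
    (\<Sum>i<I. scale (1 / fact i) ((D ^^ i) (scale ((-1) powi (k - int i)) (F (k - int i)))))"
    unfolding exp_D_neg_def
    by (rule Sum_any.expand_superset) (use assms lin in \<open>auto simp: not_less intro: ccontr\<close>)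
  then show ?thesis by (simp add: lin)
qed

text \<open>The Borcherds identity with \<open>u\<close> and \<open>v\<close> exchanged, at
  \<open>m = -1\<close>, \<open>n = 0\<close>, applied to \<open>vac\<close>: on the left
  \<open>mode_vac\<close> produces \<open>e^(xD)\<close>, on the right the creation property leaves
  only \<open>i = 0\<close>.\<close>

lemma skew_symmetry: "fls_nth (Y u v) k = exp_D_neg (fls_nth (Y v u)) k"
proof -
  define l where "l = - k - 1"
  obtain I where I: "\<And>i. i \<ge> int I \<Longrightarrow> mode v i u = 0"
    using vmode_eventually_0[of Y v u] by metis
  define J where "J = I + nat \<bar>l\<bar>"
  have J: "mode v (l + int i) u = 0" if "i \<ge> J" for i
    using that by (intro I) (auto simp: J_def)
  have "(\<Sum>i<J. scale ((- 1) ^ i) (mode (mode v (l + int i) u) (- 1 - int i) vac)) =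
    Sum_any (\<lambda>i::nat. scale (of_int (- 1) gchoose i) (mode (mode v (l + int i) u) (- 1 + 0 - int i) vac))"
    by (subst Sum_any.expand_superset[of "{..<J}"])
      (use J in \<open>auto simp: mode_simps not_less gbinomial_minus_1 intro: ccontr\<close>)
  also have "\<dots> = Sum_any (\<lambda>i::nat. scale ((- 1) ^ i * (of_int l gchoose i))
          (mode v (- 1 + l - int i) (mode u (0 + int i) vac) -
           scale ((- 1) powi l) (mode u (0 + l - int i) (mode v (- 1 + int i) vac))))"
    by (rule jacobi)
  also have "\<dots> = - scale ((- 1) powi l) (mode u l v)"
    by (subst Sum_any.expand_superset[of "{0}"])
      (auto simp: creation creation_regular mode_simps gr0_conv_Suc intro: ccontr)
  finally have "- scale ((- 1) powi l) (mode u l v) =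
      (\<Sum>i<J. scale ((- 1) ^ i / fact i) ((D ^^ i) (mode v (l + int i) u)))"
    by (simp add: mode_vac)
  then have "scale (- ((- 1) powi l)) (- scale ((- 1) powi l) (mode u l v)) =
      (\<Sum>i<J. scale (- ((- 1) powi l) * ((- 1) ^ i / fact i)) ((D ^^ i) (mode v (l + int i) u)))"
    by (simp only: scale_sum_right scale_scale)
  moreover have "scale (- ((- 1) powi l)) (- scale ((- 1) powi l) (mode u l v)) = mode u l v"
    by (simp only: scale_minus_right scale_minus_left scale_scale minus_minus
        mult_minus_left power_int_minus_one_mult_self scale_one)
  ultimately have "mode u l v =
      (\<Sum>i<J. scale (- ((- 1) powi l) * ((- 1) ^ i / fact i)) ((D ^^ i) (mode v (l + int i) u)))"
    by (simp only:)
  also have "\<dots> = (\<Sum>i<J. scale ((- 1) powi (k - int i) / fact i) ((D ^^ i) (fls_nth (Y v u) (k - int i))))"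
  proof (rule sum.cong)
    fix i
    have "- ((- 1) powi l) * ((- 1) ^ i / fact i) = ((- 1) powi (k - int i) / fact i :: complex)"
    proof -
      have "(- 1 :: complex) powi (k - int i) = (- 1) powi (- (l + (1 + int i)))"
        by (simp add: l_def)
      also have "\<dots> = (- 1) powi (l + (1 + int i))"
        by (rule power_int_minus_one_minus)
      also have "\<dots> = - ((- 1) powi l) * (- 1) ^ i"
        by (simp add: power_int_add)
      finally show ?thesis by simp
    qed
    moreover have "l + int i = - (k - int i) - 1" by (simp add: l_def)
    ultimately show "scale (- ((- 1) powi l) * ((- 1) ^ i / fact i)) ((D ^^ i) (mode v (l + int i) u)) =
      scale ((- 1) powi (k - int i) / fact i) ((D ^^ i) (fls_nth (Y v u) (k - int i)))"
      by (simp only: fls_nth_conv_vmode)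
  qed auto
  also have "\<dots> = exp_D_neg (fls_nth (Y v u)) k"
    using J by (subst exp_D_neg_eq_sum[of J]) (auto simp: fls_nth_conv_vmode l_def algebra_simps)
  finally show ?thesis by (simp add: fls_nth_conv_vmode l_def)
qed


section \<open>The grading\<close>

lemma G_0: "0 \<in> G n"
  using G_subspace by (rule subspace_0)

lemma G_add: "u \<in> G n \<Longrightarrow> v \<in> G n \<Longrightarrow> u + v \<in> G n"
  using G_subspace by (rule subspace_add)

lemma G_diff: "u \<in> G n \<Longrightarrow> v \<in> G n \<Longrightarrow> u - v \<in> G n"
  using G_subspace by (rule subspace_diff)

lemma G_scale: "v \<in> G n \<Longrightarrow> scale c v \<in> G n"
  using G_subspace by (rule subspace_scale)

lemma G_sum: "(\<And>x. x \<in> A \<Longrightarrow> f x \<in> G n) \<Longrightarrow> sum f A \<in> G n"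
  using G_subspace by (rule subspace_sum)

lemma D_weight: "v \<in> G n \<Longrightarrow> D v \<in> G (n + 1)"
  unfolding D_def using vmode_weight[OF _ vac_weight, of v n "-2"] by (simp add: algebra_simps)

lemma homogeneous_decomposition:
  obtains A c where "finite A" "\<And>n. c n \<in> G n" "v = sum c A"
proof -
  obtain c where "finite {n. c n \<noteq> 0}" "\<forall>n. c n \<in> G n" "v = Sum_any c"
    using G_direct_sum[of v] by blast
  then show ?thesis by (intro that[of "{n. c n \<noteq> 0}" c]) (auto simp: Sum_any.expand_set)
qed

lemma homogeneous_component:
  assumes "finite A" "\<And>k. k \<in> A \<Longrightarrow> c k \<in> G k" "sum c A \<in> G n"
  shows "sum c A = (if n \<in> A then c n else 0)"
proof -
  define c1 where "c1 k = (if k \<in> A then c k else 0)" for k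
  define c2 where "c2 k = (if k = n then sum c A else 0)" for k
  have c1: "finite {k. c1 k \<noteq> 0} \<and> (\<forall>k. c1 k \<in> G k) \<and> sum c A = Sum_any c1"
  proof (intro conjI allI)
    show "finite {k. c1 k \<noteq> 0}"
      by (rule finite_subset[OF _ assms(1)]) (auto simp: c1_def)
    show "c1 k \<in> G k" for k using assms(2) by (auto simp: c1_def G_0)
    show "sum c A = Sum_any c1"
      by (subst Sum_any.expand_superset[OF assms(1)]) (auto simp: c1_def)
  qed
  have c2: "finite {k. c2 k \<noteq> 0} \<and> (\<forall>k. c2 k \<in> G k) \<and> sum c A = Sum_any c2"
  proof (intro conjI allI)
    show "finite {k. c2 k \<noteq> 0}"
      by (rule finite_subset[of _ "{n}"]) (auto simp: c2_def)
    show "c2 k \<in> G k" for k using assms(3) by (auto simp: c2_def G_0)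
    show "sum c A = Sum_any c2"
      by (subst Sum_any.expand_superset[of "{n}"]) (auto simp: c2_def)
  qed
  have "c1 = c2" using c1 c2 G_direct_sum[of "sum c A"] by blast
  then have "c1 n = c2 n" by simp
  then show ?thesis by (simp add: c1_def c2_def)
qed

lemma G_disjoint: "v \<in> G m \<Longrightarrow> v \<in> G n \<Longrightarrow> m \<noteq> n \<Longrightarrow> v = 0"
  using homogeneous_component[of "{m}" "\<lambda>_. v" n] by simp

lemma homogeneous_induct [case_names add homogeneous]:
  assumes "\<And>u v. P u \<Longrightarrow> P v \<Longrightarrow> P (u + v)" "\<And>n v. v \<in> G n \<Longrightarrow> P v"
  shows "P v"
proof -
  obtain A c where A: "finite A" "\<And>n. c n \<in> G n" "v = sum c A"
    using homogeneous_decomposition[of v] by blast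
  have "P (sum c A)"
    using A(1)
  proof (induction A rule: finite_induct)
    case empty
    then show ?case using assms(2)[OF G_0] by simp
  next
    case (insert n A)
    then show ?case using assms(1)[OF assms(2)[OF A(2)[of n]]] by simp
  qed
  then show ?thesis by (simp add: A)
qed

end


section \<open>Duality for two variables\<close>

lemma abs_sums_to_1:
  "abs_sums_to 1 c [z] s \<longleftrightarrow> ((\<lambda>n. c [n] * z powi (- n - 1)) has_sum s) UNIV"
  unfolding abs_sums_to_iff
  by (rule has_sum_reindex_bij_witness[of _ "\<lambda>n. [n]" "\<lambda>ns. ns ! 0"])
    (auto simp: series_term_def length_Suc_conv)

lemma abs_sums_to_2:
  "abs_sums_to 2 c [x, z] s \<longleftrightarrow>
    ((\<lambda>(l, n). c [l, n] * (x powi (- l - 1) * z powi (- n - 1))) has_sum s) UNIV"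
  unfolding abs_sums_to_iff
  by (rule has_sum_reindex_bij_witness[of _ "\<lambda>(l, n). [l, n]" "\<lambda>ns. (ns ! 0, ns ! 1)"])
    (auto simp: series_term_def length_Suc_conv numeral_2_eq_2)

lemma radial_region_2: "zs \<in> radial_region 2 \<longleftrightarrow>
    (\<exists>z1 z2. zs = [z1, z2] \<and> norm z1 > norm z2 \<and> norm z2 > 0)"
  by (auto simp: radial_region_def length_Suc_conv numeral_2_eq_2)

lemma radial_region_1: "[z] \<in> radial_region 1 \<longleftrightarrow> z \<noteq> 0"
  by (auto simp: radial_region_def)

text \<open>The second series is expanded in \<open>z\<^sub>1 - z\<^sub>2\<close> and \<open>z\<^sub>2\<close>.\<close>

definition dual_expansion ::
  "(int list \<Rightarrow> complex) \<Rightarrow> (int list \<Rightarrow> complex) \<Rightarrow> (complex list \<Rightarrow> complex) \<Rightarrow> bool" where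
  "dual_expansion c d f \<longleftrightarrow> rational_in 2 f \<and>
      (\<forall>z1 z2. norm z1 > norm z2 \<and> norm z2 > 0 \<longrightarrow> abs_sums_to 2 c [z1, z2] (f [z1, z2])) \<and>
      (\<forall>z1 z2. norm z2 > norm (z1 - z2) \<and> norm (z1 - z2) > 0 \<longrightarrow>
        abs_sums_to 2 d [z1 - z2, z2] (f [z1, z2]))"

lemma dual_expansion_iff: "dual_expansion c d f \<longleftrightarrow> radial_expansion 2 c f \<and>
      (\<forall>z1 z2. norm z2 > norm (z1 - z2) \<and> norm (z1 - z2) > 0 \<longrightarrow>
        abs_sums_to 2 d [z1 - z2, z2] (f [z1, z2]))"
  unfolding dual_expansion_def radial_expansion_def Ball_def radial_region_2 by blast

lemma dual_expansion_add:
  "dual_expansion c d f \<Longrightarrow> dual_expansion c' d' g \<Longrightarrow>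
    dual_expansion (\<lambda>ns. c ns + c' ns) (\<lambda>ns. d ns + d' ns) (\<lambda>zs. f zs + g zs)"
  unfolding dual_expansion_def by (auto intro: abs_sums_to_add)

lemma dual_expansion_cmult:
  "dual_expansion c d f \<Longrightarrow> dual_expansion (\<lambda>ns. a * c ns) (\<lambda>ns. a * d ns) (\<lambda>zs. a * f zs)"
  unfolding dual_expansion_def by (auto intro: abs_sums_to_cmult)

lemma dual_expansion_0: "dual_expansion (\<lambda>ns. 0) (\<lambda>ns. 0) (\<lambda>zs. 0)"
  unfolding dual_expansion_def by (auto intro: abs_sums_to_0)

lemma dual_expansion_sum:
  assumes "\<And>x. x \<in> X \<Longrightarrow> \<exists>f. dual_expansion (c x) (d x) f"
  shows "\<exists>f. dual_expansion (\<lambda>ns. \<Sum>x\<in>X. c x ns) (\<lambda>ns. \<Sum>x\<in>X. d x ns) f"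
proof -
  from assms have "\<forall>x\<in>X. \<exists>f. dual_expansion (c x) (d x) f" by blast
  from bchoice[OF this] obtain f where f: "\<And>x. x \<in> X \<Longrightarrow> dual_expansion (c x) (d x) (f x)"
    by blast
  have "dual_expansion (\<lambda>ns. \<Sum>x\<in>X. c x ns) (\<lambda>ns. \<Sum>x\<in>X. d x ns) (\<lambda>zs. \<Sum>x\<in>X. f x zs)"
    using f by (induction X rule: infinite_finite_induct)
      (auto intro: dual_expansion_add dual_expansion_0)
  then show ?thesis by blast
qed

lemma dual_expansion_cong:
  assumes "\<And>m n. c [m, n] = c' [m, n]" "\<And>m n. d [m, n] = d' [m, n]"
  shows "dual_expansion c d f = dual_expansion c' d' f"
  unfolding dual_expansion_def using assms by (simp add: abs_sums_to_2)

lemma has_sum_Times_singleton: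
  "(f has_sum s) ({a} \<times> B) \<longleftrightarrow> ((\<lambda>y. f (a, y)) has_sum s) B"
  by (rule has_sum_reindex_bij_witness[of _ "\<lambda>y. (a, y)" snd]) auto

text \<open>The function \<open>z_1^(-k-1) g(z_2)\<close>: where \<open>|z_1 - z_2| < |z_2|\<close>,
  the power of \<open>z_1 = z_2 + (z_1 - z_2)\<close> is expanded by the binomial series, so only
  nonnegative powers of \<open>z_1 - z_2\<close> occur.\<close>

lemma dual_expansion_delta:
  assumes "radial_expansion 1 (\<lambda>ns. g (ns ! 0)) f"
  shows "dual_expansion (\<lambda>ns. if ns ! 0 = k then g (ns ! 1) else 0)
    (\<lambda>ns. if ns ! 0 < 0 then (of_int (- k - 1) gchoose nat (- (ns ! 0) - 1)) *
       g (ns ! 1 - k + ns ! 0) else 0)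
    (\<lambda>zs. zs ! 0 powi (- k - 1) * f (tl zs))"
  unfolding dual_expansion_iff
proof (intro conjI allI impI)
  have "radial_expansion (Suc 1) (\<lambda>ns. if hd ns = k then g (tl ns ! 0) else 0)
           (\<lambda>zs. zs ! 0 powi (- k - 1) * f (tl zs))"
    by (rule radial_expansion_delta[OF assms])
  then show "radial_expansion 2 (\<lambda>ns. if ns ! 0 = k then g (ns ! 1) else 0)
           (\<lambda>zs. zs ! 0 powi (- k - 1) * f (tl zs))"
    by (subst radial_expansion_cong[where d = "\<lambda>ns. if hd ns = k then g (tl ns ! 0) else 0"])
      (auto simp: numeral_2_eq_2 length_Suc_conv)
  fix z1 z2 :: complex
  assume *: "norm z2 > norm (z1 - z2) \<and> norm (z1 - z2) > 0"
  define x where "x = z1 - z2"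
  have x: "norm x < norm z2" "x \<noteq> 0" "z2 \<noteq> 0" using * by (auto simp: x_def)
  have "((\<lambda>j::nat. (of_int (- k - 1) gchoose j) * x ^ j * z2 powi (- k - 1 - int j)) has_sum
      (z2 + x) powi (- k - 1)) UNIV"
    by (rule binomial_powi_has_sum[OF x(1)])
  moreover have "((\<lambda>n. g n * z2 powi (- n - 1)) has_sum f [z2]) UNIV"
    using assms x(3) radial_region_1[of z2] unfolding radial_expansion_def
    by (auto simp: abs_sums_to_1[unfolded One_nat_def])
  ultimately have "((\<lambda>(j, n). (of_int (- k - 1) gchoose j) * x ^ j * z2 powi (- k - 1 - int j) *
      (g n * z2 powi (- n - 1))) has_sum ((z2 + x) powi (- k - 1) * f [z2])) (UNIV \<times> UNIV)"
    by (rule has_sum_product_complex)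
  also have "?this \<longleftrightarrow> ((\<lambda>(l, n). (of_int (- k - 1) gchoose nat (- l - 1)) * g (n - k + l) *
      (x powi (- l - 1) * z2 powi (- n - 1))) has_sum ((z2 + x) powi (- k - 1) * f [z2])) ({..<0} \<times> UNIV)"
  proof (rule has_sum_reindex_bij_witness[of _ "\<lambda>(l, n). (nat (- l - 1), n - k + l)"
        "\<lambda>(j, n). (- 1 - int j, n + k + 1 + int j)"], goal_cases)
    case (5 p)
    obtain j n where p: "p = (j, n)" by (cases p)
    have "z2 powi (- k - 1 - int j) * z2 powi (- n - 1) = z2 powi (- (n + k + 1 + int j) - 1)"
      using x by (simp add: algebra_simps flip: power_int_add)
    then show ?case by (simp add: p)
  qed auto
  also have "\<dots> \<longleftrightarrow> ((\<lambda>(l, n). (if l < 0 then (of_int (- k - 1) gchoose nat (- l - 1)) *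
       g (n - k + l) else 0) *
      (x powi (- l - 1) * z2 powi (- n - 1))) has_sum ((z2 + x) powi (- k - 1) * f [z2])) UNIV"
    by (rule has_sum_cong_neutral) (auto split: if_splits)
  finally show "abs_sums_to 2 (\<lambda>ns. if ns ! 0 < 0 then (of_int (- k - 1) gchoose nat (- (ns ! 0) - 1)) *
       g (ns ! 1 - k + ns ! 0) else 0) [z1 - z2, z2] ([z1, z2] ! 0 powi (- k - 1) * f (tl [z1, z2]))"
    unfolding abs_sums_to_2 by (simp add: x_def cong: if_cong)
qed

text \<open>The function \<open>(z_1 - z_2)^(-i-1) g(z_2)\<close>: a single power of
  \<open>z_1 - z_2\<close> in the second region, the expanded kernel in the first.\<close>

lemma dual_expansion_binomial:
  assumes "radial_expansion 1 (\<lambda>ns. g (ns ! 0)) f"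
  shows "dual_expansion
    (\<lambda>ns. if ns ! 0 \<ge> 0 then (of_int (ns ! 0) gchoose i) * g (ns ! 1 + ns ! 0 - int i) else 0)
    (\<lambda>ns. if ns ! 0 = int i then g (ns ! 1) else 0)
    (\<lambda>zs. (zs ! 0 - zs ! 1) powi (- int i - 1) * f (tl zs))"
  unfolding dual_expansion_iff
proof (intro conjI allI impI)
  have "radial_expansion (Suc 1) (\<lambda>ns. if hd ns \<ge> 0 then (of_int (hd ns) gchoose i) *
         g ((tl ns)[0 := tl ns ! 0 + hd ns - int i] ! 0) else 0)
      (\<lambda>zs. (zs ! 0 - zs ! Suc 0) powi (- int i - 1) * f (tl zs))"
    by (rule radial_expansion_binomial[OF assms]) simp
  then show "radial_expansion 2 (\<lambda>ns. if ns ! 0 \<ge> 0 then (of_int (ns ! 0) gchoose i) * g (ns ! 1 + ns ! 0 - int i) else 0)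
           (\<lambda>zs. (zs ! 0 - zs ! 1) powi (- int i - 1) * f (tl zs))"
    by (subst radial_expansion_cong[where d = "\<lambda>ns. if hd ns \<ge> 0 then (of_int (hd ns) gchoose i) *
         g ((tl ns)[0 := tl ns ! 0 + hd ns - int i] ! 0) else 0"])
      (auto simp: numeral_2_eq_2 length_Suc_conv)
  fix z1 z2 :: complex
  assume *: "norm z2 > norm (z1 - z2) \<and> norm (z1 - z2) > 0"
  define x where "x = z1 - z2"
  have z2: "z2 \<noteq> 0" using * by auto
  have "((\<lambda>n. g n * z2 powi (- n - 1)) has_sum f [z2]) UNIV"
    using assms z2 radial_region_1[of z2] unfolding radial_expansion_def
    by (auto simp: abs_sums_to_1[unfolded One_nat_def])
  then have "((\<lambda>n. x powi (- int i - 1) * (g n * z2 powi (- n - 1))) has_sum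
      x powi (- int i - 1) * f [z2]) UNIV"
    by (rule has_sum_cmult_right)
  then have "((\<lambda>(l, n). x powi (- l - 1) * (g n * z2 powi (- n - 1))) has_sum
      x powi (- int i - 1) * f [z2]) ({int i} \<times> UNIV)"
    by (simp add: has_sum_Times_singleton)
  also have "?this \<longleftrightarrow> ((\<lambda>(l, n). (if l = int i then g n else 0) *
      (x powi (- l - 1) * z2 powi (- n - 1))) has_sum x powi (- int i - 1) * f [z2]) UNIV"
    by (rule has_sum_cong_neutral) (auto split: if_splits)
  finally show "abs_sums_to 2 (\<lambda>ns. if ns ! 0 = int i then g (ns ! 1) else 0) [z1 - z2, z2]
      (([z1, z2] ! 0 - [z1, z2] ! 1) powi (- int i - 1) * f (tl [z1, z2]))"
    unfolding abs_sums_to_2 by (simp add: x_def cong: if_cong)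
qed


section \<open>Rationality of products\<close>

context grading_restricted_vertex_algebra
begin

section \<open>Functionals in the graded dual\<close>

lemma graded_dual_linear: "v' \<in> graded_dual \<Longrightarrow> module_hom scale (*) v'"
  by (simp add: graded_dual_def module_hom_iff_linear)

lemmas graded_dual_simps = hom_simps[OF graded_dual_linear]

lemma graded_dual_compose:
  assumes "v' \<in> graded_dual" "Vector_Spaces.linear scale scale f" "\<And>n. f ` G n \<subseteq> G (n + d)"
  shows "(\<lambda>v. v' (f v)) \<in> graded_dual"
proof -
  have "Vector_Spaces.linear scale (*) (v' \<circ> f)"
    using assms by (intro Vector_Spaces.linear_compose) (auto simp: graded_dual_def)
  moreover have "{n. \<exists>v\<in>G n. v' (f v) \<noteq> 0} \<subseteq> (\<lambda>n. n - d) ` {n. \<exists>v\<in>G n. v' v \<noteq> 0}"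
    using assms(3) by (force intro: image_eqI[where x = "_ + d"])
  moreover have "finite {n. \<exists>v\<in>G n. v' v \<noteq> 0}"
    using assms by (simp add: graded_dual_def)
  ultimately show ?thesis
    unfolding graded_dual_def o_def by (blast intro: finite_subset)
qed

lemma graded_dual_add:
  assumes "f \<in> graded_dual" "g \<in> graded_dual"
  shows "(\<lambda>v. f v + g v) \<in> graded_dual"
proof -
  interpret vector_space_pair scale "(*) :: complex \<Rightarrow> _" by unfold_locales (auto simp: algebra_simps)
  have "{n. \<exists>v\<in>G n. f v + g v \<noteq> 0} \<subseteq> {n. \<exists>v\<in>G n. f v \<noteq> 0} \<union> {n. \<exists>v\<in>G n. g v \<noteq> 0}" by auto
  with assms show ?thesis
    unfolding graded_dual_def by (auto intro: linear_compose_add finite_subset)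
qed

lemma graded_dual_mode:
  assumes "v' \<in> graded_dual"
  shows "(\<lambda>w. v' (mode u n w)) \<in> graded_dual"
proof (induction u rule: homogeneous_induct)
  case (add u v)
  then show ?case
    using graded_dual_add[OF add] assms by (simp add: mode_simps graded_dual_simps)
next
  case (homogeneous k u)
  show ?case
  proof (rule graded_dual_compose[OF assms linear_right, where d = "k - n - 1"])
    show "mode u n ` G l \<subseteq> G (l + (k - n - 1))" for l
      using vmode_weight[OF homogeneous, of _ l n] by (auto simp: algebra_simps)
  qed
qed

lemma graded_dual_eq_0:
  assumes "v' \<in> graded_dual" "\<And>n w. w \<in> G n \<Longrightarrow> v' w = 0"
  shows "v' w = 0"
  by (induction w rule: homogeneous_induct) (use assms in \<open>auto simp: graded_dual_simps\<close>)

text \<open>For homogeneous \<open>u\<close>, \<open>u_(-1-m)\<close> raises weights by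
  \<open>wt u + m\<close>. The grading is bounded below and the functional sees finitely many
  weights, so for large \<open>m\<close> the image lies above all of them.\<close>

lemma graded_dual_creation_eventually_0:
  assumes "v' \<in> graded_dual"
  shows "\<exists>M::nat. \<forall>m\<ge>M. \<forall>w. v' (mode u (- 1 - int m) w) = 0"
proof (induction u rule: homogeneous_induct)
  case (add u v)
  then obtain M N where M: "\<forall>m\<ge>M. \<forall>w. v' (mode u (- 1 - int m) w) = 0"
    and N: "\<forall>m\<ge>N. \<forall>w. v' (mode v (- 1 - int m) w) = 0" by blast
  then show ?case using assms
    by (intro exI[of _ "max M N"]) (auto simp: mode_simps graded_dual_simps)
next
  case (homogeneous k u)
  obtain N where N: "\<forall>n<N. G n = {0}" using G_bounded_below by blast
  have fin: "finite {n. \<exists>v\<in>G n. v' v \<noteq> 0}" using assms by (simp add: graded_dual_def)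
  define B where "B = Max {n. \<exists>v\<in>G n. v' v \<noteq> 0}"
  have B: "n \<le> B" if "v \<in> G n" "v' v \<noteq> 0" for n v
    unfolding B_def by (rule Max_ge[OF fin]) (use that in blast)
  show ?case
  \<comment> \<open>A vector of weight \<open>n >= N\<close> is sent to weight
    \<open>k + n + m\<close>, which this bound places above \<open>B\<close>.\<close>
  proof (intro exI[of _ "nat (B - N - k + 1)"] allI impI)
    fix m :: nat and w assume m: "m \<ge> nat (B - N - k + 1)"
    show "v' (mode u (- 1 - int m) w) = 0"
    proof (rule graded_dual_eq_0[OF graded_dual_mode[OF assms]])
      fix n x assume x: "x \<in> G n"
      show "v' (mode u (- 1 - int m) x) = 0"
      proof (cases "n < N")
        case True
        then have "x = 0" using N x by auto
        then show ?thesis using assms by (simp add: mode_simps graded_dual_simps)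
      next
        case False
        have "mode u (- 1 - int m) x \<in> G (k + n - (- 1 - int m) - 1)"
          by (rule vmode_weight[OF homogeneous x])
        from B[OF this] False m show ?thesis by linarith
      qed
    qed
  qed
qed

section \<open>Products of several vertex operators\<close>

lemma iterated_modes_Nil [simp]: "iterated_modes [] ns v = v"
  by (simp add: iterated_modes_def)

lemma iterated_modes_Cons [simp]:
  "iterated_modes (s # ss) (n # ns) v = mode s n (iterated_modes ss ns v)"
  by (simp add: iterated_modes_def)

lemma iterated_modes_0 [simp]: "iterated_modes ss ns 0 = 0"
  by (induction ss ns rule: list_induct2') (auto simp: iterated_modes_def mode_simps)

text \<open>Each commutator turns one factor \<open>t_j\<close> into \<open>s_i t_j\<close> and
  keeps the number of factors, which is what makes an induction on that number possible.\<close>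

lemma mode_iterated_modes:
  assumes "length ns = length ts" "\<And>j i. j < length ts \<Longrightarrow> i \<ge> I \<Longrightarrow> mode s (int i) (ts ! j) = 0"
  shows "mode s m (iterated_modes ts ns v) = iterated_modes ts ns (mode s m v) +
    (\<Sum>j<length ts. \<Sum>i<I. scale (of_int m gchoose i)
      (iterated_modes (ts[j := mode s (int i) (ts ! j)]) (ns[j := ns ! j + m - int i]) v))"
  using assms
proof (induction ts arbitrary: ns)
  case (Cons t ts)
  obtain n ns' where ns: "ns = n # ns'" "length ns' = length ts" using Cons.prems(1) by (cases ns) auto
  have t: "mode s (int i) t = 0" if "i \<ge> I" for i using Cons.prems(2)[of 0 i] that by simp
  have ts: "mode s (int i) (ts ! j) = 0" if "j < length ts" "i \<ge> I" for i j
    using Cons.prems(2)[of "Suc j" i] that by simp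
  have "mode s m (iterated_modes (t # ts) ns v) = mode t n (mode s m (iterated_modes ts ns' v)) +
     (\<Sum>i<I. scale (of_int m gchoose i) (mode (mode s (int i) t) (m + n - int i) (iterated_modes ts ns' v)))"
    unfolding ns iterated_modes_Cons by (rule commutator_formula[OF t])
  also have "mode s m (iterated_modes ts ns' v) = iterated_modes ts ns' (mode s m v) +
    (\<Sum>j<length ts. \<Sum>i<I. scale (of_int m gchoose i)
      (iterated_modes (ts[j := mode s (int i) (ts ! j)]) (ns'[j := ns' ! j + m - int i]) v))"
    by (rule Cons.IH[OF ns(2) ts])
  finally show ?case
    unfolding length_Cons sum.lessThan_Suc_shift
    by (simp add: ns(1) mode_simps add_ac)
qed auto

theorem product_rationality:
  assumes "v' \<in> graded_dual"
  shows "\<exists>f. radial_expansion (length ss) (\<lambda>ns. v' (iterated_modes ss ns v)) f"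
  using assms
proof (induction "length ss" arbitrary: ss v' v)
  case 0
  have "radial_expansion 0 (\<lambda>ns. v' v) (\<lambda>zs. v' v)"
    by (auto simp: radial_expansion_def abs_sums_to_iff series_term_def
        intro!: has_sum_finiteI)
  then show ?case using 0 by auto
next
  case (Suc n)
  obtain s ts where ss: "ss = s # ts" "length ts = n" using Suc.hyps(2) by (cases ss) auto
  obtain M where M: "\<And>m w. m \<ge> M \<Longrightarrow> v' (mode s (- 1 - int m) w) = 0"
    using graded_dual_creation_eventually_0[OF Suc.prems] by blast
  obtain K where K: "\<And>k. k \<ge> int K \<Longrightarrow> mode s k v = 0"
    using vmode_eventually_0[of Y s v] by blast
  have "\<forall>t. \<exists>I::nat. \<forall>i\<ge>I. mode s (int i) t = 0"
    using vmode_eventually_0[of Y s] by (metis of_nat_mono)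
  then obtain I0 :: "'v \<Rightarrow> nat" where I0: "\<And>t i. i \<ge> I0 t \<Longrightarrow> mode s (int i) t = 0" by metis
  define I where "I = (\<Sum>t\<in>set ts. I0 t)"
  have I: "mode s (int i) (ts ! j) = 0" if "j < length ts" "i \<ge> I" for i j
  proof (rule I0)
    have "I0 (ts ! j) \<le> I" unfolding I_def using that by (intro member_le_sum) auto
    then show "I0 (ts ! j) \<le> i" using that by simp
  qed
  \<comment> \<open>Three kinds of terms: a creation mode stays on the left and is absorbed into the
    functional (\<open>c1\<close>), an annihilation mode reaches \<open>v\<close>
    (\<open>c2\<close>), or it is consumed by the \<open>j\<close>-th factor (\<open>c3\<close>).
    Each leaves one factor fewer but changes the functional, the vector or the list, so the
    induction is over all of these.\<close>
  define c1 where "c1 m ns = (if hd ns = - 1 - int m then v' (mode s (- 1 - int m) (iterated_modes ts (tl ns) v)) else 0)" for m ns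
  define c2 where "c2 k ns = (if hd ns = int k then v' (iterated_modes ts (tl ns) (mode s (int k) v)) else 0)" for k ns
  define c3 where "c3 j i ns = (if hd ns \<ge> 0 then (of_int (hd ns) gchoose i) *
         v' (iterated_modes (ts[j := mode s (int i) (ts ! j)]) ((tl ns)[j := tl ns ! j + hd ns - int i]) v) else 0)" for j i ns
  have c1: "\<exists>f. radial_expansion (Suc n) (c1 m) f" for m
  proof -
    obtain f where "radial_expansion n (\<lambda>ns. v' (mode s (- 1 - int m) (iterated_modes ts ns v))) f"
      using Suc.hyps(1)[OF ss(2)[symmetric] graded_dual_mode[OF Suc.prems]] unfolding ss(2) by blast
    from radial_expansion_delta[OF this, of "- 1 - int m"] show ?thesis
      unfolding c1_def[abs_def] by blast
  qed
  have c2: "\<exists>f. radial_expansion (Suc n) (c2 k) f" for k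
  proof -
    obtain f where "radial_expansion n (\<lambda>ns. v' (iterated_modes ts ns (mode s (int k) v))) f"
      using Suc.hyps(1)[OF ss(2)[symmetric] Suc.prems] unfolding ss(2) by blast
    from radial_expansion_delta[OF this, of "int k"] show ?thesis
      unfolding c2_def[abs_def] by blast
  qed
  have c3: "\<exists>f. radial_expansion (Suc n) (c3 j i) f" if "j < n" for j i
  proof -
    have len: "n = length (ts[j := mode s (int i) (ts ! j)])" using ss(2) by simp
    obtain f where "radial_expansion n
        (\<lambda>ns. v' (iterated_modes (ts[j := mode s (int i) (ts ! j)]) ns v)) f"
      using Suc.hyps(1)[OF len Suc.prems] unfolding len[symmetric] by blast
    from radial_expansion_binomial[OF this that, of i] show ?thesis
      unfolding c3_def[abs_def] by blast
  qed
  have "v' (iterated_modes ss ns v) = (\<Sum>m<M. c1 m ns) + (\<Sum>k<K. c2 k ns) + (\<Sum>j<n. \<Sum>i<I. c3 j i ns)"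
    if len: "length ns = Suc n" for ns
  proof -
    obtain m ns' where ns: "ns = m # ns'" "length ns' = n" using len by (cases ns) auto
    show ?thesis
    proof (cases "m < 0")
      case True
      define p where "p = nat (- 1 - m)"
      have m: "m = - 1 - int p" using True by (simp add: p_def)
      have "(\<Sum>q<M. c1 q ns) = (\<Sum>q<M. if q = p then v' (mode s m (iterated_modes ts ns' v)) else 0)"
        by (rule sum.cong) (auto simp: c1_def ns(1) m)
      also have "\<dots> = v' (mode s m (iterated_modes ts ns' v))"
        using M[of p] by (simp add: m)
      moreover have "c2 k ns = 0" "c3 j i ns = 0" for k i j
        using True by (auto simp: c2_def c3_def ns(1))
      ultimately show ?thesis by (simp add: ss ns)
    next
      case False
      define p where "p = nat m"
      have m: "m = int p" using False by (simp add: p_def)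
      have "(\<Sum>q<K. c2 q ns) = (\<Sum>q<K. if q = p then v' (iterated_modes ts ns' (mode s m v)) else 0)"
        by (rule sum.cong) (auto simp: c2_def ns(1) m)
      also have "\<dots> = v' (iterated_modes ts ns' (mode s m v))"
      proof (cases "p < K")
        case False
        then have "mode s m v = 0" using K[of m] by (simp add: m)
        then show ?thesis using False Suc.prems by (simp add: graded_dual_simps)
      qed simp
      moreover have "c1 k ns = 0" for k
        using False by (auto simp: c1_def ns(1))
      moreover have "c3 j i ns = v' (scale (of_int m gchoose i)
         (iterated_modes (ts[j := mode s (int i) (ts ! j)]) (ns'[j := ns' ! j + m - int i]) v))" for i j
        using False Suc.prems by (simp add: c3_def ns(1) graded_dual_simps)
      moreover have "mode s m (iterated_modes ts ns' v) = iterated_modes ts ns' (mode s m v) +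
        (\<Sum>j<length ts. \<Sum>i<I. scale (of_int m gchoose i)
          (iterated_modes (ts[j := mode s (int i) (ts ! j)]) (ns'[j := ns' ! j + m - int i]) v))"
        using I by (intro mode_iterated_modes) (auto simp: ns ss)
      ultimately show ?thesis using Suc.prems
        by (simp add: ss ns(1) graded_dual_simps)
    qed
  qed
  moreover have "\<exists>f. radial_expansion (Suc n) (\<lambda>ns. \<Sum>m<M. c1 m ns) f"
    by (rule radial_expansion_sum[OF c1])
  moreover have "\<exists>f. radial_expansion (Suc n) (\<lambda>ns. \<Sum>k<K. c2 k ns) f"
    by (rule radial_expansion_sum[OF c2])
  moreover have "\<exists>f. radial_expansion (Suc n) (\<lambda>ns. \<Sum>j<n. \<Sum>i<I. c3 j i ns) f"
    by (rule radial_expansion_sum[OF radial_expansion_sum[OF c3]]) auto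
  ultimately obtain f1 f2 f3 where
    decomp: "\<And>ns. length ns = Suc n \<Longrightarrow>
      v' (iterated_modes ss ns v) = (\<Sum>m<M. c1 m ns) + (\<Sum>k<K. c2 k ns) + (\<Sum>j<n. \<Sum>i<I. c3 j i ns)"
    and f: "radial_expansion (Suc n) (\<lambda>ns. \<Sum>m<M. c1 m ns) f1"
      "radial_expansion (Suc n) (\<lambda>ns. \<Sum>k<K. c2 k ns) f2"
      "radial_expansion (Suc n) (\<lambda>ns. \<Sum>j<n. \<Sum>i<I. c3 j i ns) f3"
    by blast
  have "radial_expansion (Suc n) (\<lambda>ns. v' (iterated_modes ss ns v)) (\<lambda>zs. f1 zs + f2 zs + f3 zs)"
    by (rule radial_expansion_cong[THEN iffD2, OF decomp radial_expansion_add[OF radial_expansion_add[OF f(1,2)] f(3)]])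
  then show ?case unfolding Suc.hyps(2)[symmetric] by blast
qed

lemma converges_to_rational_iff:
  "converges_to_rational n c \<longleftrightarrow> (\<forall>v'\<in>graded_dual. \<exists>f. radial_expansion n (\<lambda>ns. v' (c ns)) f)"
  by (simp add: converges_to_rational_def radial_expansion_def)

lemma one_point_rationality:
  assumes "v' \<in> graded_dual"
  shows "\<exists>f. radial_expansion 1 (\<lambda>ns. v' (mode u (ns ! 0) v)) f"
proof -
  obtain f where "radial_expansion (length [u]) (\<lambda>ns. v' (iterated_modes [u] ns v)) f"
    using product_rationality[OF assms] by blast
  then have "radial_expansion 1 (\<lambda>ns. v' (mode u (ns ! 0) v)) f"
    by (subst radial_expansion_cong[where d = "\<lambda>ns. v' (iterated_modes [u] ns v)"])
      (auto simp: length_Suc_conv)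
  then show ?thesis by blast
qed

text \<open>With \<open>a = - l - 1\<close> the power of \<open>z_1 - z_2\<close>, the iterate
  formula is regrouped into the coefficients that \<open>dual_expansion_delta\<close> attaches to
  \<open>z_1^m\<close> and \<open>z_1^(-k-1)\<close>. Thus both expansions in the duality come from
  the same finite list of functions.\<close>

lemma iterate_expansion:
  assumes "\<And>m w. m \<ge> M \<Longrightarrow> v' (mode u (- 1 - int m) w) = 0"
    and "\<And>k. k \<ge> int K \<Longrightarrow> mode u k w = 0" and v': "v' \<in> graded_dual" and l: "l < 0"
  shows "v' (mode (mode u l v) n w) =
    (\<Sum>m<M. (of_nat m gchoose nat (- l - 1)) * v' (mode u (- 1 - int m) (mode v (n - (- 1 - int m) + l) w))) +
    (\<Sum>k<K. (of_int (- int k - 1) gchoose nat (- l - 1)) * v' (mode v (n - int k + l) (mode u (int k) w)))"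
proof -
  define a where "a = nat (- l - 1)"
  have la: "l = - 1 - int a" using l by (simp add: a_def)
  obtain N where N: "\<And>k. k \<ge> int N \<Longrightarrow> mode v k w = 0"
    using vmode_eventually_0[of Y v w] by blast
  define J where "J = K + M + N + nat \<bar>n\<bar>"
  \<comment> \<open>Both coefficient identities are
    \<open>binom(- a - 1, i) = (-1)^i binom(a + i, i)\<close>, the second time with \<open>a\<close>
    and \<open>i\<close> exchanged.\<close>
  have coeff: "(- 1) ^ i * (of_int l gchoose i) = (of_nat (a + i) gchoose a :: complex)" for i
  proof -
    have "(of_int l gchoose i :: complex) = (- 1) ^ i * (of_nat (a + i) gchoose i)"
      using gbinomial_minus[of "of_nat a + 1 :: complex" i] by (simp add: la algebra_simps)
    also have "of_nat (a + i) gchoose i = (of_nat (a + i choose i) :: complex)"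
      by (rule binomial_gbinomial[symmetric])
    also have "a + i choose i = a + i choose a"
      by (metis add_diff_cancel_right' binomial_symmetric le_add2)
    finally show ?thesis by (simp add: binomial_gbinomial flip: power_mult_distrib mult.assoc)
  qed
  have coeff': "- (of_nat (a + i) gchoose a) * (- 1) powi l = (of_int (- int i - 1) gchoose a :: complex)" for i
  proof -
    have "(- 1 :: complex) powi l = (- 1) powi (- l)" by (simp add: power_int_minus_one_minus)
    also have "\<dots> = - ((- 1) ^ a)" by (simp add: la power_int_add)
    finally show ?thesis
      using gbinomial_minus[of "of_nat i + 1 :: complex" a] by (simp add: add_ac minus_diff_commute mult.commute)
  qed
  have "v' (mode (mode u l v) n w) = v' (\<Sum>i<J. scale (of_nat (a + i) gchoose a)
        (mode u (l - int i) (mode v (n + int i) w) -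
         scale ((- 1) powi l) (mode v (n + l - int i) (mode u (int i) w))))"
    unfolding coeff[symmetric]
    by (subst iterate_formula[of J]) (use assms N in \<open>auto simp: J_def\<close>)
  also have "\<dots> = (\<Sum>i<J. (of_nat (a + i) gchoose a) *
        v' (mode u (l - int i) (mode v (n + int i) w)) +
        (- (of_nat (a + i) gchoose a) * (- 1) powi l) * v' (mode v (n + l - int i) (mode u (int i) w)))"
    using v' by (simp add: graded_dual_simps right_diff_distrib mult.assoc)
  also have "\<dots> = (\<Sum>i<J. (of_nat (a + i) gchoose a) *
        v' (mode u (l - int i) (mode v (n + int i) w))) +
        (\<Sum>i<J. (of_int (- int i - 1) gchoose a) * v' (mode v (n - int i + l) (mode u (int i) w)))"
    unfolding coeff' sum.distrib by (simp add: algebra_simps)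
  also have "(\<Sum>i<J. (of_int (- int i - 1) gchoose a) * v' (mode v (n - int i + l) (mode u (int i) w))) =
      (\<Sum>i<K. (of_int (- int i - 1) gchoose a) * v' (mode v (n - int i + l) (mode u (int i) w)))"
    by (rule sum.mono_neutral_right) (use assms v' in \<open>auto simp: J_def mode_simps graded_dual_simps\<close>)
  also have "(\<Sum>i<J. (of_nat (a + i) gchoose a) * v' (mode u (l - int i) (mode v (n + int i) w))) =
      (\<Sum>m\<in>{a..<a + J}. (of_nat m gchoose a) * v' (mode u (- 1 - int m) (mode v (n - (- 1 - int m) + l) w)))"
    by (rule sum.reindex_bij_witness[of _ "\<lambda>m. m - a" "\<lambda>i. a + i"])
      (auto simp: la algebra_simps)
  also have "\<dots> = (\<Sum>m<a + J. (of_nat m gchoose a) * v' (mode u (- 1 - int m) (mode v (n - (- 1 - int m) + l) w)))"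
    by (rule sum.mono_neutral_left) (auto simp flip: binomial_gbinomial)
  also have "\<dots> = (\<Sum>m<M. (of_nat m gchoose a) * v' (mode u (- 1 - int m) (mode v (n - (- 1 - int m) + l) w)))"
    by (rule sum.mono_neutral_right) (use assms in \<open>auto simp: J_def\<close>)
  finally show ?thesis by (simp add: a_def)
qed

abbreviation two_point_dual where
  "two_point_dual v' u v w \<equiv> dual_expansion (\<lambda>ns. v' (mode u (ns ! 0) (mode v (ns ! 1) w)))
    (\<lambda>ns. v' (mode (mode u (ns ! 0) v) (ns ! 1) w))"

text \<open>The decomposition of \<open>product_rationality\<close> for two operators with both
  expansions kept: \<open>c1\<close>, \<open>c2\<close>, \<open>c3\<close> add up to the product
  side, \<open>d1\<close>, \<open>d2\<close>, \<open>d3\<close> to the iterate side, and each pair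
  belongs to one rational function.\<close>

theorem two_point_duality:
  assumes v': "v' \<in> graded_dual"
  shows "\<exists>f. two_point_dual v' u v w f"
proof -
  obtain M where M: "\<And>m w. m \<ge> M \<Longrightarrow> v' (mode u (- 1 - int m) w) = 0"
    using graded_dual_creation_eventually_0[OF v'] by blast
  obtain K where K: "\<And>k. k \<ge> int K \<Longrightarrow> mode u k w = 0"
    using vmode_eventually_0[of Y u w] by blast
  obtain I where I: "\<And>k. k \<ge> int I \<Longrightarrow> mode u k v = 0"
    using vmode_eventually_0[of Y u v] by blast
  define c1 d1 where "c1 m ns = (if ns ! 0 = - 1 - int m then v' (mode u (- 1 - int m) (mode v (ns ! 1) w)) else 0)"
    and "d1 m ns = (if ns ! 0 < 0 then (of_int (- (- 1 - int m) - 1) gchoose nat (- (ns ! 0) - 1)) *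
       v' (mode u (- 1 - int m) (mode v (ns ! 1 - (- 1 - int m) + ns ! 0) w)) else 0)" for m :: nat and ns
  define c2 d2 where "c2 k ns = (if ns ! 0 = int k then v' (mode v (ns ! 1) (mode u (int k) w)) else 0)"
    and "d2 k ns = (if ns ! 0 < 0 then (of_int (- int k - 1) gchoose nat (- (ns ! 0) - 1)) *
       v' (mode v (ns ! 1 - int k + ns ! 0) (mode u (int k) w)) else 0)" for k :: nat and ns
  define c3 d3 where "c3 i ns = (if ns ! 0 \<ge> 0 then (of_int (ns ! 0) gchoose i) *
       v' (mode (mode u (int i) v) (ns ! 1 + ns ! 0 - int i) w) else 0)"
    and "d3 i ns = (if ns ! 0 = int i then v' (mode (mode u (int i) v) (ns ! 1) w) else 0)" for i :: nat and ns
  have 1: "\<exists>f. dual_expansion (c1 m) (d1 m) f" for m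
  proof -
    obtain f where "radial_expansion 1 (\<lambda>ns. v' (mode u (- 1 - int m) (mode v (ns ! 0) w))) f"
      using one_point_rationality[OF graded_dual_mode[OF v']] by blast
    from dual_expansion_delta[where k = "- 1 - int m",
        of "\<lambda>n. v' (mode u (- 1 - int m) (mode v n w))", OF this] show ?thesis
      unfolding c1_def[abs_def] d1_def[abs_def] by blast
  qed
  have 2: "\<exists>f. dual_expansion (c2 k) (d2 k) f" for k
  proof -
    obtain f where "radial_expansion 1 (\<lambda>ns. v' (mode v (ns ! 0) (mode u (int k) w))) f"
      using one_point_rationality[OF v'] by blast
    from dual_expansion_delta[where k = "int k",
        of "\<lambda>n. v' (mode v n (mode u (int k) w))", OF this] show ?thesis
      unfolding c2_def[abs_def] d2_def[abs_def] by blast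
  qed
  have 3: "\<exists>f. dual_expansion (c3 i) (d3 i) f" for i
  proof -
    obtain f where "radial_expansion 1 (\<lambda>ns. v' (mode (mode u (int i) v) (ns ! 0) w)) f"
      using one_point_rationality[OF v'] by blast
    from dual_expansion_binomial[where i = i,
        of "\<lambda>n. v' (mode (mode u (int i) v) n w)", OF this] show ?thesis
      unfolding c3_def[abs_def] d3_def[abs_def] by blast
  qed
  have c: "v' (mode u m (mode v n w)) =
    (\<Sum>k<M. c1 k [m, n]) + (\<Sum>k<K. c2 k [m, n]) + (\<Sum>i<I. c3 i [m, n])" for m n
  proof (cases "m < 0")
    case True
    define p where "p = nat (- 1 - m)"
    have m: "m = - 1 - int p" using True by (simp add: p_def)
    have "(\<Sum>q<M. c1 q [m, n]) = (\<Sum>q<M. if q = p then v' (mode u m (mode v n w)) else 0)"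
      by (rule sum.cong) (auto simp: c1_def m)
    also have "\<dots> = v' (mode u m (mode v n w))"
      using M[of p] by (simp add: m)
    finally show ?thesis using True by (simp add: c2_def c3_def)
  next
    case False
    define p where "p = nat m"
    have m: "m = int p" using False by (simp add: p_def)
    have "(\<Sum>q<K. c2 q [m, n]) = (\<Sum>q<K. if q = p then v' (mode v n (mode u m w)) else 0)"
      by (rule sum.cong) (auto simp: c2_def m)
    also have "\<dots> = v' (mode v n (mode u m w))"
      using K[of m] v' by (simp add: m mode_simps graded_dual_simps)
    finally have "(\<Sum>q<K. c2 q [m, n]) = v' (mode v n (mode u m w))" .
    moreover have "(\<Sum>i<I. c3 i [m, n]) =
      v' (\<Sum>i<I. scale (of_int m gchoose i) (mode (mode u (int i) v) (m + n - int i) w))"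
      using False v' by (simp add: c3_def graded_dual_simps algebra_simps)
    ultimately show ?thesis
      using False v' I by (simp add: commutator_formula[of I] graded_dual_simps c1_def)
  qed
  have d: "v' (mode (mode u l v) n w) =
    (\<Sum>k<M. d1 k [l, n]) + (\<Sum>k<K. d2 k [l, n]) + (\<Sum>i<I. d3 i [l, n])" for l n
  proof (cases "l < 0")
    case True
    then show ?thesis
      by (subst iterate_expansion[OF M K v']) (auto simp: d1_def d2_def d3_def)
  next
    case False
    define p where "p = nat l"
    have l: "l = int p" using False by (simp add: p_def)
    have "(\<Sum>q<I. d3 q [l, n]) = (\<Sum>q<I. if q = p then v' (mode (mode u l v) n w) else 0)"
      by (rule sum.cong) (auto simp: d3_def l)
    also have "\<dots> = v' (mode (mode u l v) n w)"
      using I[of l] v' by (simp add: l mode_simps graded_dual_simps)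
    finally show ?thesis using False by (simp add: d1_def d2_def)
  qed
  obtain f1 where f1: "dual_expansion (\<lambda>ns. \<Sum>k<M. c1 k ns) (\<lambda>ns. \<Sum>k<M. d1 k ns) f1"
    using dual_expansion_sum[of "{..<M}" c1 d1] 1 by blast
  obtain f2 where f2: "dual_expansion (\<lambda>ns. \<Sum>k<K. c2 k ns) (\<lambda>ns. \<Sum>k<K. d2 k ns) f2"
    using dual_expansion_sum[of "{..<K}" c2 d2] 2 by blast
  obtain f3 where f3: "dual_expansion (\<lambda>ns. \<Sum>k<I. c3 k ns) (\<lambda>ns. \<Sum>k<I. d3 k ns) f3"
    using dual_expansion_sum[of "{..<I}" c3 d3] 3 by blast
  have "two_point_dual v' u v w (\<lambda>zs. f1 zs + f2 zs + f3 zs)"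
    by (rule dual_expansion_cong[THEN iffD1, OF _ _ dual_expansion_add[OF dual_expansion_add[OF f1 f2] f3]])
      (simp_all add: c d)
  then show ?thesis by blast
qed

end


context grading_restricted_vertex_algebra
begin

section \<open>The operator \<open>F(x) \<mapsto> e\<^sup>x\<^sup>D F(-x)\<close>\<close>

lemma scale_half_double: "scale (1 / 2) (x + x) = x"
proof -
  have "scale (1 / 2) (x + x) = scale (1 / 2 + 1 / 2) x"
    by (simp only: scale_left_distrib scale_right_distrib)
  then show ?thesis by simp
qed

lemma D_pow_linear: "module_hom scale scale (D ^^ i)"
proof (induction i)
  case (Suc i)
  have "module_hom scale scale (D \<circ> D ^^ i)"
    by (rule module_hom_compose[OF Suc D_linear[folded module_hom_iff_linear]])
  then show ?case by (simp add: o_def)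
qed (simp add: module_hom_iff_linear linear_id[unfolded id_def] id_def)

lemmas D_pow_simps = hom_simps[OF D_pow_linear]

lemma D_pow_weight: "v \<in> G n \<Longrightarrow> (D ^^ i) v \<in> G (n + int i)"
  by (induction i) (auto simp: algebra_simps dest: D_weight)

lemma exp_D_neg_eq:
  assumes "\<And>j. j < N \<Longrightarrow> F j = 0" "k < N + int L"
  shows "exp_D_neg F k = (\<Sum>i<L. scale ((- 1) powi (k - int i) / fact i) ((D ^^ i) (F (k - int i))))"
  by (rule exp_D_neg_eq_sum) (use assms in auto)

lemma exp_D_neg_lower:
  assumes "\<And>j. j < N \<Longrightarrow> F j = 0" "k < N"
  shows "exp_D_neg F k = 0"
  by (subst exp_D_neg_eq[of N _ _ 0]) (use assms in auto)

lemma exp_D_neg_diff: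
  assumes "\<And>j. j < N \<Longrightarrow> F j = 0" "\<And>j. j < N \<Longrightarrow> H j = 0"
  shows "exp_D_neg (\<lambda>k. F k - H k) k = exp_D_neg F k - exp_D_neg H k"
proof -
  have L: "k < N + int (nat (k - N + 1))" by linarith
  show ?thesis
    using assms by (simp add: exp_D_neg_eq[OF _ L] D_pow_simps scale_right_diff_distrib sum_subtractf)
qed

lemma exp_D_neg_add:
  assumes "\<And>j. j < N \<Longrightarrow> F j = 0" "\<And>j. j < N \<Longrightarrow> H j = 0"
  shows "exp_D_neg (\<lambda>k. F k + H k) k = exp_D_neg F k + exp_D_neg H k"
proof -
  have L: "k < N + int (nat (k - N + 1))" by linarith
  show ?thesis
    using assms by (simp add: exp_D_neg_eq[OF _ L] D_pow_simps scale_right_distrib sum.distrib)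
qed

lemma exp_D_neg_scale:
  assumes "\<And>j. j < N \<Longrightarrow> F j = 0"
  shows "exp_D_neg (\<lambda>k. scale c (F k)) k = scale c (exp_D_neg F k)"
proof -
  have L: "k < N + int (nat (k - N + 1))" by linarith
  show ?thesis
    using assms by (simp add: exp_D_neg_eq[OF _ L] D_pow_simps scale_sum_right mult.commute)
qed

text \<open>This is \<open>e^(xD) e^(-xD) = 1\<close>: the coefficient of \<open>D^n\<close> is an
  alternating sum of binomial coefficients, zero unless \<open>n = 0\<close>.\<close>

lemma exp_D_neg_involution:
  assumes N: "\<And>j. j < N \<Longrightarrow> F j = 0"
  shows "exp_D_neg (exp_D_neg F) k = F k"
proof -
  define L where "L = nat (k - N + 1)"
  define h where "h i j = scale ((- 1) ^ j / (fact i * fact j)) ((D ^^ (i + j)) (F (k - int (i + j))))" for i j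
  have "exp_D_neg (exp_D_neg F) k =
    (\<Sum>i<L. scale ((- 1) powi (k - int i) / fact i) ((D ^^ i) (exp_D_neg F (k - int i))))"
    by (rule exp_D_neg_eq[of N]) (use exp_D_neg_lower[OF N] in \<open>auto simp: L_def\<close>)
  also have "\<dots> = (\<Sum>i<L. \<Sum>j<L - i. h i j)"
  proof (rule sum.cong)
    fix i assume "i \<in> {..<L}"
    then have "k - int i < N + int (L - i)" by (auto simp: L_def)
    from exp_D_neg_eq[OF N this]
    have *: "exp_D_neg F (k - int i) = (\<Sum>j<L - i. scale ((- 1) powi (k - int i - int j) / fact j)
        ((D ^^ j) (F (k - int i - int j))))" .
    have "(- 1) powi (k - int i) * (- 1) powi (k - int i - int j) = ((- 1) ^ j :: complex)" for j
    proof -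
      have "(- 1 :: complex) powi (k - int i - int j) = (- 1) powi (- (k - int i - int j))"
        by (simp only: power_int_minus_one_minus)
      then have "(- 1) powi (k - int i) * (- 1) powi (k - int i - int j) =
          ((- 1) powi (k - int i + - (k - int i - int j)) :: complex)"
        by (subst power_int_add) auto
      then show ?thesis by simp
    qed
    then show "scale ((- 1) powi (k - int i) / fact i) ((D ^^ i) (exp_D_neg F (k - int i))) =
      (\<Sum>j<L - i. h i j)"
      by (simp add: * h_def D_pow_simps scale_sum_right funpow_add diff_diff_eq mult.commute)
  qed auto
  also have "\<dots> = (\<Sum>(i, j)\<in>{(i, j). i + j < L}. h i j)"
    by (subst sum.Sigma) (auto intro!: sum.cong)
  also have "\<dots> = (\<Sum>n<L. \<Sum>i\<le>n. h i (n - i))"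
    by (rule sum.triangle_reindex)
  also have "\<dots> = (\<Sum>n<L. if n = 0 then F k else 0)"
  proof (rule sum.cong)
    fix n
    have "(\<Sum>i\<le>n. h i (n - i)) = (\<Sum>i\<le>n. scale ((- 1) ^ (n - i) / (fact i * fact (n - i)))
        ((D ^^ n) (F (k - int n))))"
      by (rule sum.cong) (auto simp: h_def)
    also have "\<dots> = scale (\<Sum>i\<le>n. (- 1) ^ (n - i) / (fact i * fact (n - i))) ((D ^^ n) (F (k - int n)))"
      by (simp only: scale_sum_left)
    also have "(\<Sum>i\<le>n. (- 1) ^ (n - i) / (fact i * fact (n - i)) :: complex) =
        (\<Sum>i\<le>n. (- 1) ^ n / fact n * ((- 1) ^ i * of_nat (n choose i)))"
      by (rule sum.cong) (auto simp: binomial_fact power_diff field_simps)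
    also have "\<dots> = (if n = 0 then 1 else 0)"
      using choose_alternating_sum[of n, where 'a = complex]
      unfolding sum_distrib_left[symmetric] by simp
    finally show "(\<Sum>i\<le>n. h i (n - i)) = (if n = 0 then F k else 0)" by simp
  qed auto
  also have "\<dots> = F k"
    using N[of k] by (cases "L = 0") (auto simp: L_def)
  finally show ?thesis .
qed

lemma fls_nth_lower: "\<exists>N. \<forall>j<N. fls_nth f j = 0"
  by (intro exI[of _ "fls_subdegree f"]) (auto intro: fls_eq0_below_subdegree)


section \<open>The part of a skew-symmetric map not determined by its singular part\<close>

text \<open>The series \<open>R\<close> of the overview, for an arbitrary \<open>B\<close>. Its
  vanishing is the normal form (2), by \<open>reg_eq_0_iff\<close>.\<close>

definition reg :: "('v \<Rightarrow> 'v \<Rightarrow> 'v fls) \<Rightarrow> 'v \<Rightarrow> 'v \<Rightarrow> int \<Rightarrow> 'v" where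
  "reg B u v k = fls_nth (B u v) k -
     scale (1 / 2) (singular_part (B u v) k + exp_D_neg (singular_part (B v u)) k)"

definition skew_symmetric :: "('v \<Rightarrow> 'v \<Rightarrow> 'v fls) \<Rightarrow> bool" where
  "skew_symmetric B \<longleftrightarrow> (\<forall>u v k. fls_nth (B u v) k = exp_D_neg (fls_nth (B v u)) k)"

lemma singular_part_lower: "\<exists>N. \<forall>j<N. singular_part f j = 0"
  using fls_nth_lower[of f] by (auto simp: singular_part_def)

text \<open>\<open>e^(xD)\<close> only raises powers of \<open>x\<close>, so negative powers receive
  contributions from negative powers only.\<close>

lemma exp_D_neg_singular_part:
  assumes "k < 0"
  shows "exp_D_neg (singular_part f) k = exp_D_neg (fls_nth f) k"
proof -
  obtain N where N: "\<And>j. j < N \<Longrightarrow> fls_nth f j = 0" using fls_nth_lower by blast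
  have L: "k < N + int (nat (k - N + 1))" by linarith
  show ?thesis
    by (subst (1 2) exp_D_neg_eq[OF _ L]) (use N assms in \<open>auto simp: singular_part_def intro!: sum.cong\<close>)
qed

text \<open>At a negative power, skew-symmetry makes both halves of the average equal to the
  coefficient itself.\<close>

lemma reg_negative:
  assumes "skew_symmetric B" "k < 0"
  shows "reg B u v k = 0"
proof -
  have "singular_part (B u v) k = fls_nth (B u v) k"
    using assms by (simp add: singular_part_def)
  moreover have "exp_D_neg (singular_part (B v u)) k = fls_nth (B u v) k"
    using assms by (simp add: exp_D_neg_singular_part skew_symmetric_def)
  ultimately show ?thesis by (simp add: reg_def scale_half_double)
qed

text \<open>The subtracted average is itself skew-symmetric, because the involution exchanges its
  two halves.\<close>

lemma reg_skew:
  assumes "skew_symmetric B"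
  shows "reg B u v k = exp_D_neg (reg B v u) k"
proof -
  obtain N1 where N1: "\<forall>j<N1. fls_nth (B u v) j = 0" using fls_nth_lower by blast
  obtain N2 where N2: "\<forall>j<N2. fls_nth (B v u) j = 0" using fls_nth_lower by blast
  define N where "N = min N1 N2"
  have N: "fls_nth (B v u) j = 0" "singular_part (B v u) j = 0" "singular_part (B u v) j = 0"
    if "j < N" for j
    using N1 N2 that by (auto simp: N_def singular_part_def)
  have E: "exp_D_neg (singular_part (B u v)) j = 0" if "j < N" for j
    by (rule exp_D_neg_lower[of N]) (use N that in auto)
  have "exp_D_neg (reg B v u) k = exp_D_neg (fls_nth (B v u)) k -
      scale (1 / 2) (exp_D_neg (singular_part (B v u)) k + exp_D_neg (exp_D_neg (singular_part (B u v))) k)"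
    unfolding reg_def[abs_def] using N E
    by (simp add: exp_D_neg_diff[of N] exp_D_neg_scale[of N] exp_D_neg_add[of N])
  also have "exp_D_neg (exp_D_neg (singular_part (B u v))) k = singular_part (B u v) k"
    by (rule exp_D_neg_involution) (use N in auto)
  also have "exp_D_neg (fls_nth (B v u)) k = fls_nth (B u v) k"
    using assms unfolding skew_symmetric_def by metis
  finally have "exp_D_neg (reg B v u) k = fls_nth (B u v) k -
      scale (1 / 2) (exp_D_neg (singular_part (B v u)) k + singular_part (B u v) k)" .
  then show ?thesis
    by (simp only: reg_def[of B u v] add.commute)
qed

lemma reg_skew_sum:
  assumes "skew_symmetric B"
  shows "reg B u v (int k) = (\<Sum>i\<le>k. scale ((- 1) ^ (k - i) / fact i) ((D ^^ i) (reg B v u (int (k - i)))))"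
proof -
  have "reg B u v (int k) = (\<Sum>i<Suc k. scale ((- 1) powi (int k - int i) / fact i) ((D ^^ i) (reg B v u (int k - int i))))"
    unfolding reg_skew[OF assms, of u v]
    by (rule exp_D_neg_eq[of 0]) (use reg_negative[OF assms] in auto)
  also have "\<dots> = (\<Sum>i\<le>k. scale ((- 1) ^ (k - i) / fact i) ((D ^^ i) (reg B v u (int (k - i)))))"
    by (rule sum.cong) (auto simp: of_nat_diff simp flip: power_int_of_nat)
  finally show ?thesis .
qed

definition graded_map :: "('v \<Rightarrow> 'v \<Rightarrow> 'v fls) \<Rightarrow> bool" where
  "graded_map B \<longleftrightarrow> (\<forall>k l u v n. u \<in> G k \<longrightarrow> v \<in> G l \<longrightarrow> vmode B u n v \<in> G (k + l - n - 1))"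

lemma graded_map_nth:
  assumes "graded_map B" "u \<in> G a" "v \<in> G b"
  shows "fls_nth (B u v) k \<in> G (a + b + k)"
proof -
  have "vmode B u (- k - 1) v \<in> G (a + b - (- k - 1) - 1)"
    using assms unfolding graded_map_def by blast
  then show ?thesis by (simp add: vmode_def add.assoc)
qed

lemma exp_D_neg_weight:
  assumes "\<And>k. F k \<in> G (a + k)" "\<And>j. j < N \<Longrightarrow> F j = 0"
  shows "exp_D_neg F k \<in> G (a + k)"
proof -
  have L: "k < N + int (nat (k - N + 1))" by linarith
  have "(D ^^ i) (F (k - int i)) \<in> G (a + k)" for i
    using D_pow_weight[OF assms(1)[of "k - int i"], of i] by simp
  then show ?thesis
    by (subst exp_D_neg_eq[OF _ L]) (use assms in \<open>auto intro!: G_sum G_scale\<close>)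
qed

lemma reg_weight:
  assumes "graded_map B" "u \<in> G a" "v \<in> G b"
  shows "reg B u v k \<in> G (a + b + k)"
proof -
  have s: "singular_part (B u v) k \<in> G (a + b + k)" "singular_part (B v u) k \<in> G (a + b + k)" for k
    using graded_map_nth[OF assms] graded_map_nth[OF assms(1,3,2)]
    by (auto simp: singular_part_def G_0 add.commute)
  obtain N where "\<And>j. j < N \<Longrightarrow> singular_part (B v u) j = 0" using singular_part_lower by blast
  then have "exp_D_neg (singular_part (B v u)) k \<in> G (a + b + k)"
    by (intro exp_D_neg_weight s) auto
  with s show ?thesis unfolding reg_def
    by (intro G_diff G_scale G_add graded_map_nth[OF assms]) auto
qed

lemma graded_map_Y: "graded_map Y"
  using vmode_weight by (auto simp: graded_map_def)

lemma skew_symmetric_Y: "skew_symmetric Y"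
  using skew_symmetry by (auto simp: skew_symmetric_def)

text \<open>At a power \<open>k >= 0\<close> the polar part vanishes, and every term that
  \<open>e^(xD)\<close> sends there from a polar series carries at least one \<open>D\<close>. So
  the subtracted average lies in the image of \<open>D\<close>.\<close>

lemma reg_Y_mod_D:
  assumes "u \<in> G a" "v \<in> G b"
  obtains x where "x \<in> G (a + b + int k - 1)" "mode u (- 1 - int k) v = reg Y u v (int k) + D x"
proof -
  obtain N where N: "\<And>j. j < N \<Longrightarrow> singular_part (Y v u) j = 0" using singular_part_lower by blast
  define L where "L = nat (int k - N + 1)"
  define F where "F = singular_part (Y v u)"
  have F: "F j \<in> G (a + b + j)" for j
    using graded_map_nth[OF graded_map_Y assms(2,1)] by (auto simp: F_def singular_part_def G_0 add.commute)
  have "int k < N + int (Suc L)" by (simp add: L_def)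
  from exp_D_neg_eq[OF N this]
  have "exp_D_neg F (int k) =
    (\<Sum>i<Suc L. scale ((- 1) powi (int k - int i) / fact i) ((D ^^ i) (F (int k - int i))))"
    by (simp add: F_def)
  also have "\<dots> = (\<Sum>i<L. scale ((- 1) powi (int k - int (Suc i)) / fact (Suc i)) ((D ^^ Suc i) (F (int k - int (Suc i)))))"
    unfolding sum.lessThan_Suc_shift by (simp add: F_def singular_part_def)
  also have "\<dots> = D (\<Sum>i<L. scale ((- 1) powi (int k - int (Suc i)) / fact (Suc i)) ((D ^^ i) (F (int k - int (Suc i)))))"
    (is "_ = D ?x")
    by (simp add: D_simps)
  finally have E: "exp_D_neg F (int k) = D ?x" .
  have "(D ^^ i) (F (int k - int (Suc i))) \<in> G (a + b + int k - 1)" for i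
    using D_pow_weight[OF F[of "int k - int (Suc i)"], of i] by (simp add: algebra_simps)
  then have "scale (1 / 2) ?x \<in> G (a + b + int k - 1)"
    by (intro G_scale G_sum) auto
  moreover have "mode u (- 1 - int k) v = reg Y u v (int k) + D (scale (1 / 2) ?x)"
    unfolding D_simps(4) E[symmetric] by (simp add: reg_def F_def singular_part_def vmode_def)
  ultimately show ?thesis by (rule that)
qed


section \<open>Coboundaries\<close>

definition coboundary_map :: "('v \<Rightarrow> 'v) \<Rightarrow> bool" where
  "coboundary_map \<phi> \<longleftrightarrow> Vector_Spaces.linear scale scale \<phi> \<and>
     (\<forall>n. \<phi> ` G n \<subseteq> G n) \<and> (\<forall>v. \<phi> (D v) = D (\<phi> v)) \<and> \<phi> vac = 0"

lemma coboundary_map_linear: "coboundary_map \<phi> \<Longrightarrow> module_hom scale scale \<phi>"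
  by (simp add: coboundary_map_def module_hom_iff_linear)

lemmas coboundary_map_simps = hom_simps[OF coboundary_map_linear]

lemma coboundary_map_D_pow: "coboundary_map \<phi> \<Longrightarrow> \<phi> ((D ^^ i) v) = (D ^^ i) (\<phi> v)"
  by (induction i) (auto simp: coboundary_map_def)

definition cobd :: "('v \<Rightarrow> 'v) \<Rightarrow> 'v \<Rightarrow> 'v \<Rightarrow> 'v fls" where
  "cobd \<phi> u v = Abs_fls (\<lambda>k. fls_nth (Y (\<phi> u) v) k - \<phi> (fls_nth (Y u v) k) + fls_nth (Y u (\<phi> v)) k)"

lemma fls_nth_cobd:
  assumes "coboundary_map \<phi>"
  shows "fls_nth (cobd \<phi> u v) k = fls_nth (Y (\<phi> u) v) k - \<phi> (fls_nth (Y u v) k) + fls_nth (Y u (\<phi> v)) k"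
proof -
  obtain N1 N2 N3 where "\<forall>j<N1. fls_nth (Y (\<phi> u) v) j = 0" "\<forall>j<N2. fls_nth (Y u v) j = 0"
    "\<forall>j<N3. fls_nth (Y u (\<phi> v)) j = 0"
    using fls_nth_lower by meson
  then show ?thesis
    unfolding cobd_def using assms
    by (intro nth_Abs_fls_lower_bound[of "min N1 (min N2 N3)"]) (simp add: coboundary_map_simps)
qed

lemma vmode_cobd:
  assumes "coboundary_map \<phi>"
  shows "vmode (cobd \<phi>) u n v = mode (\<phi> u) n v - \<phi> (mode u n v) + mode u n (\<phi> v)"
  using fls_nth_cobd[OF assms] by (simp add: vmode_def)

abbreviation product_coeff where
  "product_coeff B v' u1 u2 v \<equiv> \<lambda>ns. v' (vmode B u1 (ns ! 0) (mode u2 (ns ! 1) v)) +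
     v' (mode u1 (ns ! 0) (vmode B u2 (ns ! 1) v))"

abbreviation iterate_coeff where
  "iterate_coeff B v' u1 u2 v \<equiv> \<lambda>ns. v' (vmode B (mode u1 (ns ! 0) u2) (ns ! 1) v) +
     v' (mode (vmode B u1 (ns ! 0) u2) (ns ! 1) v)"

lemma cocycle_iff:
  "cocycle Y1 \<longleftrightarrow>
    (\<forall>n v. module_hom scale scale (\<lambda>u. vmode Y1 u n v)) \<and>
    (\<forall>n u. module_hom scale scale (\<lambda>v. vmode Y1 u n v)) \<and>
    graded_map Y1 \<and> (\<forall>v. Y1 vac v = 0) \<and> (\<forall>u. Y1 u vac = 0) \<and>
    (\<forall>u v n. D (vmode Y1 u n v) - vmode Y1 u n (D v) = vmode Y1 (D u) n v) \<and>
    (\<forall>u v n. vmode Y1 (D u) n v = scale (- of_int n) (vmode Y1 u (n - 1) v)) \<and>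
    (\<forall>v'\<in>graded_dual. \<forall>u1 u2 v. \<exists>f. dual_expansion
      (product_coeff Y1 v' u1 u2 v) (iterate_coeff Y1 v' u1 u2 v) f) \<and>
    skew_symmetric Y1"
  by (simp add: cocycle_def dual_expansion_def graded_map_def skew_symmetric_def module_hom_iff_linear)

lemma exp_D_neg_map:
  assumes "coboundary_map \<phi>" "\<And>j. j < N \<Longrightarrow> F j = 0"
  shows "exp_D_neg (\<lambda>k. \<phi> (F k)) k = \<phi> (exp_D_neg F k)"
proof -
  have L: "k < N + int (nat (k - N + 1))" by linarith
  show ?thesis
    using assms by (simp add: exp_D_neg_eq[OF _ L] coboundary_map_simps coboundary_map_D_pow)
qed

lemma skew_symmetric_cobd:
  assumes \<phi>: "coboundary_map \<phi>"
  shows "skew_symmetric (cobd \<phi>)"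
  unfolding skew_symmetric_def
proof (intro allI)
  fix u v k
  obtain N1 where N1: "\<forall>j<N1. fls_nth (Y (\<phi> v) u) j = 0" using fls_nth_lower by blast
  obtain N2 where N2: "\<forall>j<N2. fls_nth (Y v u) j = 0" using fls_nth_lower by blast
  obtain N3 where N3: "\<forall>j<N3. fls_nth (Y v (\<phi> u)) j = 0" using fls_nth_lower by blast
  define N where "N = min N1 (min N2 N3)"
  have N: "fls_nth (Y (\<phi> v) u) j = 0" "fls_nth (Y v u) j = 0" "fls_nth (Y v (\<phi> u)) j = 0"
    if "j < N" for j using that N1 N2 N3 by (auto simp: N_def)
  have "exp_D_neg (fls_nth (cobd \<phi> v u)) k = exp_D_neg (\<lambda>k. fls_nth (Y (\<phi> v) u) k -
      \<phi> (fls_nth (Y v u) k) + fls_nth (Y v (\<phi> u)) k) k"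
    by (rule arg_cong[where f = "\<lambda>F. exp_D_neg F k"]) (simp add: fun_eq_iff fls_nth_cobd[OF \<phi>])
  also have "\<dots> = exp_D_neg (fls_nth (Y (\<phi> v) u)) k - \<phi> (exp_D_neg (fls_nth (Y v u)) k) +
      exp_D_neg (fls_nth (Y v (\<phi> u))) k"
    using N \<phi> by (simp add: exp_D_neg_add[of N] exp_D_neg_diff[of N] exp_D_neg_map[of \<phi> N] coboundary_map_simps)
  also have "\<dots> = fls_nth (cobd \<phi> u v) k"
    by (simp add: fls_nth_cobd[OF \<phi>] flip: skew_symmetry)
  finally show "fls_nth (cobd \<phi> u v) k = exp_D_neg (fls_nth (cobd \<phi> v u)) k" by simp
qed

text \<open>For condition (5), the terms of the two summands in which \<phi> is applied to the inner
  product or iterate cancel. What remains is the duality of \<open>Y\<close> with \<phi> applied to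
  \<open>u1\<close>, to \<open>u2\<close>, to \<open>v\<close>, or composed with the
  functional.\<close>

lemma cocycle_cobd:
  assumes \<phi>: "coboundary_map \<phi>"
  shows "cocycle (cobd \<phi>)"
  unfolding cocycle_iff
proof (intro conjI allI ballI)
  note vm = vmode_cobd[OF \<phi>]
  have G: "\<phi> v \<in> G n" if "v \<in> G n" for v n using \<phi> that by (auto simp: coboundary_map_def)
  have D: "\<phi> (D v) = D (\<phi> v)" for v using \<phi> by (auto simp: coboundary_map_def)
  show "module_hom scale scale (\<lambda>u. vmode (cobd \<phi>) u n v)"
    "module_hom scale scale (\<lambda>w. vmode (cobd \<phi>) u n w)" for n u v
    by (unfold_locales; use \<phi> in \<open>simp add: vm mode_simps coboundary_map_simps algebra_simps\<close>)+
  show "graded_map (cobd \<phi>)"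
    unfolding graded_map_def vm by (auto intro!: G_add G_diff vmode_weight G)
  have \<phi>1: "\<phi> vac = 0" using \<phi> by (simp add: coboundary_map_def)
  show "cobd \<phi> vac v = 0" for v
  proof (rule fls_eqI)
    fix k
    have "vmode (cobd \<phi>) vac (- k - 1) v = 0"
      using \<phi> by (simp add: vm \<phi>1 vacuum mode_simps coboundary_map_simps)
    then show "fls_nth (cobd \<phi> vac v) k = fls_nth 0 k" by (simp add: vmode_def)
  qed
  show "cobd \<phi> u vac = 0" for u
  proof (rule fls_eqI)
    fix k
    have "vmode (cobd \<phi>) u (- k - 1) vac = 0"
    proof (cases "k < 0")
      case True
      then show ?thesis using \<phi> by (simp add: vm \<phi>1 creation_regular mode_simps coboundary_map_simps)
    next
      case False
      then have "- k - 1 = - 1 - int (nat k)" by simp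
      then show ?thesis
        using \<phi> by (simp only: vm \<phi>1 mode_vac mode_simps coboundary_map_simps coboundary_map_D_pow)
          simp
    qed
    then show "fls_nth (cobd \<phi> u vac) k = fls_nth 0 k" by (simp add: vmode_def)
  qed
  show "D (vmode (cobd \<phi>) u n v) - vmode (cobd \<phi>) u n (D v) = vmode (cobd \<phi>) (D u) n v" for u v n
  proof -
    have "\<phi> (mode (D u) n v) = D (\<phi> (mode u n v)) - \<phi> (mode u n (D v))"
      using D_mode[of u n v] \<phi> by (simp add: coboundary_map_simps flip: D)
    then show ?thesis
      by (simp add: vm D D_simps D_mode algebra_simps)
  qed
  show "vmode (cobd \<phi>) (D u) n v = scale (- of_int n) (vmode (cobd \<phi>) u (n - 1) v)" for u v n
    using \<phi> by (simp add: vm D mode_D_left coboundary_map_simps algebra_simps)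
  show "skew_symmetric (cobd \<phi>)" by (rule skew_symmetric_cobd[OF \<phi>])
  fix v' u1 u2 v assume v': "v' \<in> graded_dual"
  have v'': "(\<lambda>x. v' (\<phi> x)) \<in> graded_dual"
    by (rule graded_dual_compose[OF v', where d = 0]) (use \<phi> in \<open>auto simp: coboundary_map_def\<close>)
  obtain f1 where f1: "two_point_dual v' (\<phi> u1) u2 v f1"
    using two_point_duality[OF v'] by blast
  obtain f2 where f2: "two_point_dual v' u1 (\<phi> u2) v f2"
    using two_point_duality[OF v'] by blast
  obtain f3 where f3: "two_point_dual v' u1 u2 (\<phi> v) f3"
    using two_point_duality[OF v'] by blast
  obtain f4 where f4: "two_point_dual (\<lambda>x. v' (\<phi> x)) u1 u2 v f4"
    using two_point_duality[OF v''] by blast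
  note f = dual_expansion_add[OF dual_expansion_add[OF f1 f2]
      dual_expansion_add[OF f3 dual_expansion_cmult[OF f4, of "- 1"]]]
  show "\<exists>f. dual_expansion
      (product_coeff (cobd \<phi>) v' u1 u2 v) (iterate_coeff (cobd \<phi>) v' u1 u2 v) f"
    by (rule exI, rule dual_expansion_cong[THEN iffD1, OF _ _ f])
      (use v' \<phi> in \<open>simp_all add: vm mode_simps graded_dual_simps\<close>)
qed

lemma cocycle_add:
  assumes A: "cocycle A" and B: "cocycle B"
  shows "cocycle (\<lambda>u v. A u v + B u v)"
proof -
  let ?C = "\<lambda>u v. A u v + B u v"
  have vm: "vmode ?C u n v = vmode A u n v + vmode B u n v" for u n v
    by (simp add: vmode_def)
  note A' = A[unfolded cocycle_iff] and B' = B[unfolded cocycle_iff]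
  interpret p: vector_space_pair scale scale by unfold_locales
  have AD: "D (vmode A u n v) - vmode A u n (D v) = vmode A (D u) n v"
    "D (vmode B u n v) - vmode B u n (D v) = vmode B (D u) n v" for u n v
    using A B by (simp_all add: cocycle_def)
  have gr: "graded_map A" "graded_map B"
    using A B by (simp_all add: cocycle_iff)
  have lin: "Vector_Spaces.linear scale scale (\<lambda>u. vmode A u n v)"
    "Vector_Spaces.linear scale scale (\<lambda>v. vmode A u n v)"
    "Vector_Spaces.linear scale scale (\<lambda>u. vmode B u n v)"
    "Vector_Spaces.linear scale scale (\<lambda>v. vmode B u n v)" for n u v
    using A B by (simp_all add: cocycle_def)
  show ?thesis
    unfolding cocycle_iff
  proof (intro conjI allI ballI)
    show "module_hom scale scale (\<lambda>u. vmode ?C u n v)" for n v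
      unfolding vm module_hom_iff_linear
      by (intro p.linear_compose_add) (use lin in blast)+
    show "module_hom scale scale (\<lambda>v. vmode ?C u n v)" for n u
      unfolding vm module_hom_iff_linear
      by (intro p.linear_compose_add) (use lin in blast)+
    show "graded_map ?C"
      unfolding graded_map_def vm
    proof (intro allI impI G_add)
      fix k l u v n assume "u \<in> G k" "v \<in> G l"
      then show "vmode A u n v \<in> G (k + l - n - 1)" "vmode B u n v \<in> G (k + l - n - 1)"
        using gr unfolding graded_map_def by blast+
    qed
    show "?C vac v = 0" "?C u vac = 0" for u v
      using A' B' by simp_all
    show "D (vmode ?C u n v) - vmode ?C u n (D v) = vmode ?C (D u) n v" for u v n
      by (simp add: vm D_simps flip: AD)
    show "vmode ?C (D u) n v = scale (- of_int n) (vmode ?C u (n - 1) v)" for u v n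
      using A' B' by (simp add: vm scale_right_distrib)
    show "skew_symmetric ?C"
      unfolding skew_symmetric_def
    proof (intro allI)
      fix u v k
      obtain N1 where N1: "\<forall>j<N1. fls_nth (A v u) j = 0" using fls_nth_lower by blast
      obtain N2 where N2: "\<forall>j<N2. fls_nth (B v u) j = 0" using fls_nth_lower by blast
      have "exp_D_neg (fls_nth (?C v u)) k = exp_D_neg (\<lambda>k. fls_nth (A v u) k + fls_nth (B v u) k) k"
        by (rule arg_cong[where f = "\<lambda>F. exp_D_neg F k"]) (simp add: fun_eq_iff)
      also have "\<dots> = exp_D_neg (fls_nth (A v u)) k + exp_D_neg (fls_nth (B v u)) k"
        by (rule exp_D_neg_add[of "min N1 N2"]) (use N1 N2 in auto)
      also have "\<dots> = fls_nth (?C u v) k"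
        using A' B' by (simp add: skew_symmetric_def)
      finally show "fls_nth (?C u v) k = exp_D_neg (fls_nth (?C v u)) k" by simp
    qed
    fix v' u1 u2 v assume v': "v' \<in> graded_dual"
    from A' v' obtain f where f: "dual_expansion
      (product_coeff A v' u1 u2 v) (iterate_coeff A v' u1 u2 v) f" by blast
    from B' v' obtain g where g: "dual_expansion
      (product_coeff B v' u1 u2 v) (iterate_coeff B v' u1 u2 v) g" by blast
    show "\<exists>f. dual_expansion
      (product_coeff ?C v' u1 u2 v) (iterate_coeff ?C v' u1 u2 v) f"
      by (rule exI, rule dual_expansion_cong[THEN iffD1, OF _ _ dual_expansion_add[OF f g]])
        (use v' in \<open>simp_all add: vm mode_simps graded_dual_simps\<close>)
  qed
qed


section \<open>Matching the undetermined parts\<close>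

text \<open>\<open>reg_skew_sum\<close> recovers the coefficients for \<open>(v, u)\<close> from
  those for \<open>(u, v)\<close> by a formula in \<open>D\<close> common to \<open>Y\<close> and
  \<open>A\<close>, and \<phi> commutes with \<open>D\<close>.\<close>

lemma map_reg_swap:
  assumes "coboundary_map \<phi>" "skew_symmetric A"
    and "\<And>k. \<phi> (reg Y u v (int k)) = reg A u v (int k)"
  shows "\<phi> (reg Y v u (int k)) = reg A v u (int k)"
  using assms
  by (simp add: reg_skew_sum[of _ v u] skew_symmetric_Y coboundary_map_simps coboundary_map_D_pow
      del: of_nat_diff)

text \<open>The term \<open>i = 0\<close> of the skew-symmetry of \<open>R(u, u)\<close> is
  \<open>(-1)^k\<close> times the left side; for odd \<open>k\<close> it moves over and doubles it.
  So odd coefficients follow from lower ones, and on the diagonal only even ones are free to be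
  matched.\<close>

lemma reg_diagonal_odd:
  assumes "skew_symmetric B" "odd k"
  shows "reg B u u (int k) = scale (1 / 2) (\<Sum>i\<in>{1..k}. scale ((- 1) ^ (k - i) / fact i) ((D ^^ i) (reg B u u (int (k - i)))))"
proof -
  have "reg B u u (int k) = (\<Sum>i\<le>k. scale ((- 1) ^ (k - i) / fact i) ((D ^^ i) (reg B u u (int (k - i)))))"
    by (rule reg_skew_sum[OF assms(1)])
  also have "\<dots> = - reg B u u (int k) +
      (\<Sum>i\<in>{1..k}. scale ((- 1) ^ (k - i) / fact i) ((D ^^ i) (reg B u u (int (k - i)))))"
    using assms(2) by (simp add: sum.atMost_shift sum.atLeast1_atMost_eq lessThan_Suc_atMost
        atLeast0AtMost[symmetric] sum.atLeast_Suc_atMost)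
  finally have "reg B u u (int k) + reg B u u (int k) =
      (\<Sum>i\<in>{1..k}. scale ((- 1) ^ (k - i) / fact i) ((D ^^ i) (reg B u u (int (k - i)))))"
    by (simp add: eq_neg_iff_add_eq_0 algebra_simps)
  then have "scale (1 / 2) (reg B u u (int k) + reg B u u (int k)) = scale (1 / 2)
      (\<Sum>i\<in>{1..k}. scale ((- 1) ^ (k - i) / fact i) ((D ^^ i) (reg B u u (int (k - i)))))"
    by simp
  then show ?thesis by (simp only: scale_half_double)
qed

lemma map_reg_diagonal:
  assumes \<phi>: "coboundary_map \<phi>" and A: "skew_symmetric A"
    and even: "\<And>k. even k \<Longrightarrow> \<phi> (reg Y u u (int k)) = reg A u u (int k)"
  shows "\<phi> (reg Y u u (int k)) = reg A u u (int k)"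
proof (induction k rule: less_induct)
  case (less k)
  show ?case
  proof (cases "even k")
    case False
    with less show ?thesis
      by (simp add: reg_diagonal_odd[OF A False] reg_diagonal_odd[OF skew_symmetric_Y False]
          coboundary_map_simps[OF \<phi>] coboundary_map_D_pow[OF \<phi>] del: of_nat_diff)
  qed (rule even)
qed

lemma reg_add_cobd:
  assumes \<phi>: "coboundary_map \<phi>" and "\<phi> u = 0" "\<phi> v = 0"
  shows "reg (\<lambda>u v. A u v + cobd \<phi> u v) u v k = reg A u v k - \<phi> (reg Y u v k)"
proof -
  let ?C = "\<lambda>u v. A u v + cobd \<phi> u v"
  have nth: "fls_nth (?C u v) k = fls_nth (A u v) k - \<phi> (fls_nth (Y u v) k)"
    "fls_nth (?C v u) k = fls_nth (A v u) k - \<phi> (fls_nth (Y v u) k)" for k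
    using assms by (simp_all add: fls_nth_cobd) (simp_all add: fls_nth_conv_vmode mode_simps)
  have sing: "singular_part (?C u v) = (\<lambda>k. singular_part (A u v) k - \<phi> (singular_part (Y u v) k))"
    "singular_part (?C v u) = (\<lambda>k. singular_part (A v u) k - \<phi> (singular_part (Y v u) k))"
    unfolding singular_part_def nth using \<phi> by (auto simp: fun_eq_iff coboundary_map_simps)
  obtain N1 where N1: "\<forall>j<N1. singular_part (A v u) j = 0" using singular_part_lower by blast
  obtain N2 where N2: "\<forall>j<N2. singular_part (Y v u) j = 0" using singular_part_lower by blast
  have "exp_D_neg (singular_part (?C v u)) k = exp_D_neg (singular_part (A v u)) k - 
      exp_D_neg (\<lambda>k. \<phi> (singular_part (Y v u) k)) k"
    unfolding sing by (rule exp_D_neg_diff[of "min N1 N2"])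
      (use N1 N2 \<phi> in \<open>auto simp: coboundary_map_simps\<close>)
  also have "exp_D_neg (\<lambda>k. \<phi> (singular_part (Y v u) k)) k = \<phi> (exp_D_neg (singular_part (Y v u)) k)"
    by (rule exp_D_neg_map[OF \<phi>, of N2]) (use N2 in auto)
  finally show ?thesis
    unfolding reg_def nth sing using \<phi>
    by (simp add: coboundary_map_simps scale_right_distrib scale_right_diff_distrib)
qed

lemma reg_eq_0_iff:
  "reg B u v k = 0 \<longleftrightarrow> fls_nth (B u v) k = singular_part (B u v) k +
     scale (1 / 2) (exp_D_neg (singular_part (B v u)) k - singular_part (B u v) k)"
proof -
  have "x + scale (1 / 2) (y - x) = scale (1 / 2) (x + y)" for x y
  proof -
    have "x + scale (1 / 2) (y - x) = scale (1 / 2) (x + x) + scale (1 / 2) (y - x)"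
      by (simp only: scale_half_double)
    also have "\<dots> = scale (1 / 2) (x + y)"
      by (simp flip: scale_right_distrib)
    finally show ?thesis .
  qed
  then show ?thesis by (simp add: reg_def)
qed

end


section \<open>Free generation and the filtration by degree\<close>

lemma (in vector_space) span_linear_image:
  assumes "w \<in> span S" "module_hom scale scale f" "\<And>x. x \<in> S \<Longrightarrow> f x \<in> span T"
  shows "f w \<in> span T"
  using assms(1)
proof (induction w rule: span_induct_alt)
  case base
  then show ?case by (simp add: module_hom.zero[OF assms(2)] span_zero)
next
  case (step c x y)
  then show ?case
    by (simp add: module_hom.add[OF assms(2)] module_hom.scale[OF assms(2)] span_add span_scale assms(3))
qed

text \<open>The letter that \<open>D\<close> makes of \<open>x\<close>, up to the factor
  \<open>snd x\<close>, because \<open>(D a)_(-m) = m a_(-m-1)\<close>.\<close>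

abbreviation inc :: "nat \<times> nat \<Rightarrow> nat \<times> nat" where
  "inc x \<equiv> (fst x, Suc (snd x))"

locale freely_generated_vertex_algebra = grading_restricted_vertex_algebra scale Y vac G
  for scale :: "complex \<Rightarrow> 'v::ab_group_add \<Rightarrow> 'v"
    and Y :: "'v \<Rightarrow> 'v \<Rightarrow> 'v fls"
    and vac :: 'v
    and G :: "int \<Rightarrow> 'v set" +
  fixes gens :: "'v list" and wt :: "nat \<Rightarrow> int"
  assumes free: "freely_generates gens"
    and gens_weight: "i < length gens \<Longrightarrow> gens ! i \<in> G (wt i)"
    and wt_pos: "i < length gens \<Longrightarrow> 0 < wt i"
begin

text \<open>The letter \<open>(i, m)\<close> stands for the operator \<open>a\<^sup>(\<^sup>i\<^sup>)\<^sub>-\<^sub>m\<close>, a multiset of letters for a monomial.\<close>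

definition letters :: "(nat \<times> nat) set" where
  "letters = {(i, m). i < length gens \<and> 1 \<le> m}"

definition monomials :: "(nat \<times> nat) multiset set" where
  "monomials = {M. set_mset M \<subseteq> letters}"

definition word_vec :: "(nat \<times> nat) list \<Rightarrow> 'v" where
  "word_vec w = foldr (\<lambda>(i, m). mode (gens ! i) (- int m)) w vac"

text \<open>Mode numbers are ignored, so that \<open>D\<close> preserves this degree to leading
  order; the true weight in \<open>V\<close> is \<open>weight\<close>.\<close>

definition deg :: "(nat \<times> nat) multiset \<Rightarrow> int" where
  "deg M = (\<Sum>x\<in>#M. wt (fst x))"

definition weight :: "(nat \<times> nat) multiset \<Rightarrow> int" where
  "weight M = (\<Sum>x\<in>#M. wt (fst x) + int (snd x) - 1)"

lemma word_vec_simps [simp]: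
  "word_vec [] = vac" "word_vec (x # w) = mode (gens ! fst x) (- int (snd x)) (word_vec w)"
  by (auto simp: word_vec_def split: prod.splits)

lemma deg_simps [simp]: "deg {#} = 0" "deg (add_mset x M) = wt (fst x) + deg M"
  by (auto simp: deg_def)

lemma weight_simps [simp]:
  "weight {#} = 0" "weight (add_mset x M) = wt (fst x) + int (snd x) - 1 + weight M"
  by (auto simp: weight_def)

lemma monomials_simps [simp]:
  "{#} \<in> monomials" "add_mset x M \<in> monomials \<longleftrightarrow> x \<in> letters \<and> M \<in> monomials"
  by (auto simp: monomials_def)

lemma mset_in_monomials: "mset w \<in> monomials \<longleftrightarrow> set w \<subseteq> letters"
  by (simp add: monomials_def)

lemma letters_D:
  "x \<in> letters \<Longrightarrow> fst x < length gens" "x \<in> letters \<Longrightarrow> 1 \<le> snd x"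
  "x \<in> letters \<Longrightarrow> 0 < wt (fst x)"
  "x \<in> letters \<Longrightarrow> gens ! fst x \<in> G (wt (fst x))"
  by (auto simp: letters_def wt_pos gens_weight)

lemma deg_nonneg: "M \<in> monomials \<Longrightarrow> 0 \<le> deg M"
  by (induction M) (auto dest: letters_D)

lemma deg_le_weight: "M \<in> monomials \<Longrightarrow> deg M \<le> weight M"
  by (induction M) (auto dest: letters_D)

lemma deg_eq_0: "M \<in> monomials \<Longrightarrow> deg M \<le> 0 \<Longrightarrow> M = {#}"
  by (cases M) (use letters_D(3) deg_nonneg in \<open>force simp: not_le[symmetric]\<close>)+

lemma weight_eq_0: "M \<in> monomials \<Longrightarrow> weight M \<le> 0 \<Longrightarrow> M = {#}"
  using deg_eq_0 deg_le_weight by force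

lemma word_vec_weight: "set w \<subseteq> letters \<Longrightarrow> word_vec w \<in> G (weight (mset w))"
proof (induction w)
  case (Cons x w)
  then have "mode (gens ! fst x) (- int (snd x)) (word_vec w) \<in>
      G (wt (fst x) + weight (mset w) - - int (snd x) - 1)"
    by (intro vmode_weight letters_D) auto
  then show ?case by (simp add: algebra_simps)
qed (auto simp: vac_weight)


section \<open>The basis of free generation, indexed by multisets of letters\<close>

definition pbw_index :: "(nat \<times> nat) multiset \<Rightarrow> nat list list" where
  "pbw_index M = map (\<lambda>i. rev (sorted_list_of_multiset (image_mset snd (filter_mset (\<lambda>x. fst x = i) M))))
     [0..<length gens]"

definition index_word :: "nat list list \<Rightarrow> (nat \<times> nat) list" where
  "index_word ms = concat (map (\<lambda>i. map (Pair i) (ms ! i)) [0..<length gens])"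

text \<open>Each multiset is realised by its one word in the prescribed order. Multisets, rather
  than ordered index lists, make the leading terms those of a polynomial algebra in the
  letters.\<close>

definition pbw_vec :: "(nat \<times> nat) multiset \<Rightarrow> 'v" where
  "pbw_vec M = word_vec (index_word (pbw_index M))"

lemma pbw_monomial_eq:
  assumes "length ms = length gens"
  shows "pbw_monomial gens ms = word_vec (index_word ms)"
proof -
  have zip: "zip gens ms = map (\<lambda>i. (gens ! i, ms ! i)) [0..<length gens]"
    using assms by (intro nth_equalityI) auto
  have inner: "foldr (\<lambda>(i, m). mode (gens ! i) (- int m)) (map (Pair i) js) v =
      foldr (\<lambda>j. mode (gens ! i) (- int j)) js v" for i js v
    by (induction js) auto
  have "foldr (\<lambda>(a, m). foldr (\<lambda>j. mode a (- int j)) m) (map (\<lambda>i. (gens ! i, ms ! i)) is) v =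
      foldr (\<lambda>(i, m). mode (gens ! i) (- int m)) (concat (map (\<lambda>i. map (Pair i) (ms ! i)) is)) v" for "is" v
    by (induction "is") (auto simp: inner)
  then show ?thesis
    unfolding pbw_monomial_def zip word_vec_def index_word_def .
qed

lemma mset_index_word:
  assumes "M \<in> monomials"
  shows "mset (index_word (pbw_index M)) = M"
proof -
  have "mset (concat (map (\<lambda>i. map (Pair i) (pbw_index M ! i)) [0..<n])) = filter_mset (\<lambda>x. fst x < n) M"
    if "n \<le> length gens" for n
    using that
  proof (induction n)
    case (Suc n)
    have "image_mset (Pair n) (image_mset snd (filter_mset (\<lambda>x. fst x = n) M)) =
        filter_mset (\<lambda>x. fst x = n) M"
      by (induction M) auto
    moreover have "filter_mset (\<lambda>x. fst x < Suc n) M =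
        filter_mset (\<lambda>x. fst x < n) M + filter_mset (\<lambda>x. fst x = n) M"
      by (induction M) auto
    ultimately show ?case
      using Suc by (simp add: pbw_index_def)
  qed simp
  from this[of "length gens"] have "mset (index_word (pbw_index M)) = filter_mset (\<lambda>x. fst x < length gens) M"
    by (simp add: index_word_def)
  also have "\<dots> = M"
    using assms unfolding filter_mset_eq_conv by (auto simp: monomials_def letters_def)
  finally show ?thesis .
qed

lemma pbw_index_in: "M \<in> monomials \<Longrightarrow> pbw_index M \<in> pbw_indices (length gens)"
  unfolding pbw_indices_def pbw_index_def
  by (auto simp: monomials_def letters_def sorted_wrt_rev)

lemma pbw_index_surj:
  assumes "ms \<in> pbw_indices (length gens)"
  shows "mset (index_word ms) \<in> monomials" "pbw_index (mset (index_word ms)) = ms"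
proof -
  have len: "length ms = length gens"
    and ms: "\<And>i. i < length gens \<Longrightarrow> sorted_wrt (\<ge>) (ms ! i) \<and> (\<forall>j\<in>set (ms ! i). j \<ge> 1)"
    using assms unfolding pbw_indices_def by auto
  show "mset (index_word ms) \<in> monomials"
    using ms by (auto simp: mset_in_monomials index_word_def letters_def)
  have f: "filter (\<lambda>x. fst x = i) (concat (map (\<lambda>j. map (Pair j) (ms ! j)) [0..<n])) =
      (if i < n then map (Pair i) (ms ! i) else [])" for i n
    by (induction n) (auto simp: filter_map o_def less_Suc_eq)
  show "pbw_index (mset (index_word ms)) = ms"
  proof (rule nth_equalityI)
    fix i assume "i < length (pbw_index (mset (index_word ms)))"
    then have i: "i < length gens" by (simp add: pbw_index_def)
    have "image_mset snd (filter_mset (\<lambda>x. fst x = i) (mset (index_word ms))) = mset (ms ! i)"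
      unfolding mset_filter[symmetric] index_word_def f using i
      by (simp add: image_mset.compositionality o_def flip: mset_map)
    moreover have "rev (sorted_list_of_multiset (mset (ms ! i))) = ms ! i"
    proof -
      have "sorted (rev (ms ! i))" using ms[OF i] by (simp add: sorted_wrt_rev)
      then have "sort (rev (ms ! i)) = rev (ms ! i)" by (rule sorted_sort_id)
      then have "sorted_list_of_multiset (mset (rev (ms ! i))) = rev (ms ! i)"
        by (simp only: sorted_list_of_multiset_mset)
      then show ?thesis by simp
    qed
    ultimately show "pbw_index (mset (index_word ms)) ! i = ms ! i"
      using i by (simp add: pbw_index_def)
  qed (simp add: pbw_index_def len)
qed

lemma pbw_index_image: "pbw_index ` monomials = pbw_indices (length gens)"
  using pbw_index_in pbw_index_surj by (auto intro!: image_eqI)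

lemma pbw_vec_eq: "pbw_vec M = pbw_monomial gens (pbw_index M)"
  unfolding pbw_vec_def by (rule pbw_monomial_eq[symmetric]) (simp add: pbw_index_def)

lemma pbw_vec_image: "pbw_vec ` monomials = pbw_monomial gens ` pbw_indices (length gens)"
  unfolding pbw_index_image[symmetric] image_image pbw_vec_eq ..

lemma inj_pbw_vec: "inj_on pbw_vec monomials"
proof (rule inj_onI)
  fix M N assume M: "M \<in> monomials" "N \<in> monomials" "pbw_vec M = pbw_vec N"
  then have "pbw_index M = pbw_index N"
    using free pbw_index_in by (auto simp: freely_generates_def pbw_vec_eq dest: inj_onD)
  then show "M = N" using M mset_index_word by metis
qed

lemma independent_pbw_vec: "independent (pbw_vec ` monomials)"
  and span_pbw_vec: "span (pbw_vec ` monomials) = UNIV"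
  using free by (auto simp: freely_generates_def pbw_vec_image)

lemma pbw_vec_empty [simp]: "pbw_vec {#} = vac"
  using mset_index_word[of "{#}"] by (simp add: pbw_vec_def)

lemma index_word_letters: "M \<in> monomials \<Longrightarrow> set (index_word (pbw_index M)) \<subseteq> letters"
  by (metis mset_in_monomials mset_index_word)

lemma pbw_vec_weight: "M \<in> monomials \<Longrightarrow> pbw_vec M \<in> G (weight M)"
  using word_vec_weight[OF index_word_letters] by (simp add: pbw_vec_def mset_index_word)

lemma pbw_expansion:
  assumes "v \<in> span (pbw_vec ` S)" "S \<subseteq> monomials"
  obtains A c where "finite A" "A \<subseteq> S" "\<And>M. M \<in> A \<Longrightarrow> c M \<noteq> 0"
    "v = (\<Sum>M\<in>A. scale (c M) (pbw_vec M))"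
proof -
  obtain t r where t: "finite t" "t \<subseteq> pbw_vec ` S" "v = (\<Sum>a\<in>t. scale (r a) a)"
    using assms(1) unfolding span_explicit by blast
  obtain A where A: "A \<subseteq> S" "finite A" "t = pbw_vec ` A"
    using finite_subset_image[OF t(1,2)] by blast
  have "inj_on pbw_vec A" using inj_pbw_vec A assms(2) inj_on_subset by blast
  then have v: "v = (\<Sum>M\<in>A. scale (r (pbw_vec M)) (pbw_vec M))"
    unfolding t A(3) by (subst sum.reindex) auto
  also have "\<dots> = (\<Sum>M\<in>{M\<in>A. r (pbw_vec M) \<noteq> 0}. scale (r (pbw_vec M)) (pbw_vec M))"
    using A(2) by (intro sum.mono_neutral_right) auto
  finally show ?thesis
    using A by (intro that[of "{M\<in>A. r (pbw_vec M) \<noteq> 0}" "\<lambda>M. r (pbw_vec M)"]) auto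
qed

lemma pbw_linear_extension:
  fixes s :: "complex \<Rightarrow> 'w::ab_group_add \<Rightarrow> 'w"
  assumes "vector_space s"
  obtains f where "module_hom scale s f" "\<And>M. M \<in> monomials \<Longrightarrow> f (pbw_vec M) = g M"
proof -
  interpret p: vector_space_pair scale s
    by (intro vector_space_pair.intro assms vector_space_axioms)
  obtain f where f: "Vector_Spaces.linear scale s f"
    "\<forall>x\<in>pbw_vec ` monomials. f x = g (the_inv_into monomials pbw_vec x)"
    using p.linear_independent_extend[OF independent_pbw_vec,
        of "\<lambda>x. g (the_inv_into monomials pbw_vec x)"] by blast
  show ?thesis
  proof (rule that)
    show "module_hom scale s f" using f(1) by (simp add: module_hom_iff_linear)
    show "f (pbw_vec M) = g M" if "M \<in> monomials" for M
      using f(2) that by (simp add: the_inv_into_f_f[OF inj_pbw_vec])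
  qed
qed

lemma pbw_functional:
  fixes g :: "(nat \<times> nat) multiset \<Rightarrow> complex"
  obtains f where "module_hom scale (*) f" "\<And>M. M \<in> monomials \<Longrightarrow> f (pbw_vec M) = g M"
proof -
  have "vector_space ((*) :: complex \<Rightarrow> _)" by unfold_locales (auto simp: algebra_simps)
  then show ?thesis using pbw_linear_extension[of "(*)" g] that by blast
qed

text \<open>The basis is homogeneous: an expansion is grouped by weight, and uniqueness of
  homogeneous components leaves only the group of weight \<open>n\<close>.\<close>

lemma G_eq_span: "v \<in> G n \<Longrightarrow> v \<in> span (pbw_vec ` {M\<in>monomials. weight M = n})"
proof -
  assume v: "v \<in> G n"
  have "v \<in> span (pbw_vec ` monomials)" by (simp add: span_pbw_vec)
  then obtain A c where A: "finite A" "A \<subseteq> monomials" "v = (\<Sum>M\<in>A. scale (c M) (pbw_vec M))"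
    using pbw_expansion[OF _ order.refl] by metis
  define d where "d k = (\<Sum>M\<in>{M\<in>A. weight M = k}. scale (c M) (pbw_vec M))" for k
  have v_eq: "v = sum d (weight ` A)"
    unfolding A(3) d_def by (rule sum.image_gen[OF A(1)])
  have d: "d k \<in> G k" for k
    unfolding d_def using A(2) pbw_vec_weight by (intro G_sum G_scale) auto
  have "v = (if n \<in> weight ` A then d n else 0)"
    unfolding v_eq by (rule homogeneous_component) (use A(1) d v in \<open>auto simp flip: v_eq\<close>)
  moreover have "d n \<in> span (pbw_vec ` {M\<in>monomials. weight M = n})"
    unfolding d_def using A(2) by (intro span_sum span_scale span_base) auto
  ultimately show ?thesis by (auto simp: span_zero split: if_splits)
qed

lemma G_negative: "v \<in> G n \<Longrightarrow> n < 0 \<Longrightarrow> v = 0"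
proof -
  assume *: "v \<in> G n" "n < 0"
  have "{M\<in>monomials. weight M = n} = {}"
    using deg_nonneg deg_le_weight *(2) by force
  then show "v = 0" using G_eq_span[OF *(1)] by (simp only: image_empty span_empty singleton_iff)
qed

lemma G_zero: "v \<in> G 0 \<Longrightarrow> v \<in> span {vac}"
proof -
  assume *: "v \<in> G 0"
  have "{M\<in>monomials. weight M = 0} \<subseteq> {{#}}"
    using weight_eq_0 by force
  then have "pbw_vec ` {M\<in>monomials. weight M = 0} \<subseteq> {vac}" by auto
  then show ?thesis using G_eq_span[OF *] span_mono by blast
qed

text \<open>This is the filtration whose associated graded algebra is commutative: the modes \<open>u\<^sub>n\<close> with
  \<open>n \<ge> 0\<close> lower the degree, and hence so do all commutators.\<close>

inductive fil :: "int \<Rightarrow> 'v \<Rightarrow> bool" where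
  vac: "0 \<le> N \<Longrightarrow> fil N vac"
| mode: "fil N w \<Longrightarrow> u \<in> G d \<Longrightarrow> n < 0 \<Longrightarrow> fil (N + d) (vmode Y u n w)"
| zero: "fil N 0"
| add: "fil N v \<Longrightarrow> fil N w \<Longrightarrow> fil N (v + w)"
| scale: "fil N v \<Longrightarrow> fil N (scale c v)"
| mono: "fil N v \<Longrightarrow> N \<le> N' \<Longrightarrow> fil N' v"

lemma fil_sum: "(\<And>x. x \<in> A \<Longrightarrow> fil N (f x)) \<Longrightarrow> fil N (sum f A)"
  by (induction A rule: infinite_finite_induct) (auto intro: fil.intros)

text \<open>Induction over the filtration with \<open>u\<close> arbitrary. Pushing
  \<open>u_n\<close> past \<open>t_m\<close> leaves modes of \<open>u_i t\<close>, of weight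
  \<open>d + e - i - 1\<close>, so one is already lost; if the new mode index is nonnegative, the
  induction hypothesis applies to \<open>u_i t\<close> in place of \<open>u\<close>.\<close>

lemma fil_mode_nonneg:
  assumes "fil N v" "u \<in> G d" "0 \<le> n"
  shows "fil (N + d - 1) (mode u n v)"
  using assms
proof (induction arbitrary: u d n rule: fil.induct)
  case (vac N)
  then show ?case by (simp add: creation_regular fil.zero)
next
  case (mode N w t e m)
  obtain I where I: "\<And>i. i \<ge> int I \<Longrightarrow> mode u i t = 0" using vmode_eventually_0 by metis
  have 1: "fil (N + e + d - 1) (mode t m (mode u n w))"
    using fil.mode[OF mode.IH[OF mode.prems] mode.hyps(2,3)] by (simp add: algebra_simps)
  have 2: "fil (N + e + d - 1) (mode (mode u (int i) t) (n + m - int i) w)" for i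
  proof (cases "n + m - int i < 0")
    case True
    have "fil (N + (d + e - int i - 1)) (mode (mode u (int i) t) (n + m - int i) w)"
      by (rule fil.mode[OF mode.hyps(1) vmode_weight[OF mode.prems(1) mode.hyps(2)] True])
    then show ?thesis by (rule fil.mono) simp
  next
    case False
    have "fil (N + (d + e - int i - 1) - 1) (mode (mode u (int i) t) (n + m - int i) w)"
      by (rule mode.IH[OF vmode_weight[OF mode.prems(1) mode.hyps(2)]]) (use False in simp)
    then show ?thesis by (rule fil.mono) simp
  qed
  show ?case
    by (subst commutator_formula[of I]) (use I 1 2 in \<open>auto intro!: fil.add fil_sum fil.scale\<close>)
next
  case (mono N v N')
  show ?case by (rule fil.mono[OF mono.IH[OF mono.prems]]) (use mono.hyps in simp)
qed (auto simp: mode_simps intro: fil.zero fil.add fil.scale)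

lemma fil_mode:
  assumes "fil N v" "u \<in> G d"
  shows "fil (N + d) (mode u n v)"
proof (cases "n < 0")
  case False
  then show ?thesis by (intro fil.mono[OF fil_mode_nonneg[OF assms]]) auto
qed (rule fil.mode[OF assms])

lemma fil_commutator:
  assumes "fil N w" "u \<in> G d" "v \<in> G e"
  shows "fil (N + d + e - 1) (mode u m (mode v n w) - mode v n (mode u m w))"
proof -
  obtain I where I: "\<And>i. i \<ge> int I \<Longrightarrow> mode u i v = 0" using vmode_eventually_0 by metis
  have "fil (N + d + e - 1) (mode (mode u (int i) v) (m + n - int i) w)" for i
    using fil_mode[OF assms(1) vmode_weight[OF assms(2,3)]] by (rule fil.mono) simp
  then show ?thesis
    by (subst commutator_formula[of I]) (use I in \<open>auto intro!: fil_sum fil.scale\<close>)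
qed

section \<open>Reordering words modulo lower degree\<close>

lemma fil_word_vec: "set w \<subseteq> letters \<Longrightarrow> fil (deg (mset w)) (word_vec w)"
proof (induction w)
  case (Cons x w)
  then have "fil (deg (mset w) + wt (fst x)) (word_vec (x # w))"
    unfolding word_vec_simps by (intro fil_mode letters_D) auto
  then show ?case by (simp add: add.commute)
qed (auto intro: fil.vac)

lemma fil_word_move:
  assumes "set p \<subseteq> letters" "x \<in> letters" "set q \<subseteq> letters"
  shows "fil (deg (mset (x # p @ q)) - 1) (word_vec (x # p @ q) - word_vec (p @ x # q))"
  using assms(1)
proof (induction p)
  case (Cons y p)
  have 1: "fil (deg (mset (p @ q)) + wt (fst x) + wt (fst y) - 1)
     (word_vec (x # y # p @ q) - word_vec (y # x # p @ q))"
    unfolding word_vec_simps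
    by (intro fil_commutator fil_word_vec letters_D) (use Cons assms in auto)
  have "fil (deg (mset (x # p @ q)) - 1 + wt (fst y))
     (mode (gens ! fst y) (- int (snd y)) (word_vec (x # p @ q) - word_vec (p @ x # q)))"
    by (intro fil_mode Cons.IH letters_D) (use Cons in auto)
  then have 2: "fil (deg (mset (p @ q)) + wt (fst x) + wt (fst y) - 1)
      (word_vec (y # x # p @ q) - word_vec (y # p @ x # q))"
    by (simp add: mode_simps algebra_simps)
  from fil.add[OF 1 2] show ?case by (simp add: algebra_simps)
qed (simp add: fil.zero)

text \<open>Commutativity of the associated graded algebra: the first letter of \<open>w\<close> is
  located in \<open>w'\<close> and moved to the front at the cost of lower terms, and the rest is
  permuted by induction.\<close>

lemma fil_word_perm:
  assumes "set w \<subseteq> letters" "mset w = mset w'"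
  shows "fil (deg (mset w) - 1) (word_vec w - word_vec w')"
  using assms
proof (induction w arbitrary: w')
  case (Cons x u)
  have "x \<in> set w'" using Cons.prems(2) by (metis list.set_intros(1) set_mset_mset)
  then obtain p q where w': "w' = p @ x # q" by (meson split_list)
  have perm: "mset u = mset (p @ q)" using Cons.prems(2) by (simp add: w')
  have sub: "set p \<subseteq> letters" "set q \<subseteq> letters" "x \<in> letters" "set u \<subseteq> letters"
    using Cons.prems(1) mset_eq_setD[OF perm] by auto
  have "fil (deg (mset u) - 1 + wt (fst x))
      (mode (gens ! fst x) (- int (snd x)) (word_vec u - word_vec (p @ q)))"
    by (intro fil_mode Cons.IH letters_D sub perm)
  then have 1: "fil (deg (mset (x # u)) - 1) (word_vec (x # u) - word_vec (x # p @ q))"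
    by (simp add: mode_simps algebra_simps)
  have 2: "fil (deg (mset (x # u)) - 1) (word_vec (x # p @ q) - word_vec (p @ x # q))"
    using fil_word_move[OF sub(1,3,2)] by (simp add: perm)
  from fil.add[OF 1 2] show ?case by (simp add: w')
qed (simp add: fil.zero)

lemma fil_word_pbw:
  assumes "set w \<subseteq> letters"
  shows "fil (deg (mset w) - 1) (word_vec w - pbw_vec (mset w))"
  unfolding pbw_vec_def
  by (rule fil_word_perm[OF assms]) (use assms in \<open>simp add: mset_index_word mset_in_monomials\<close>)

section \<open>Agreement of \<open>fil\<close> with the span of the basis monomials of bounded
  degree\<close>

definition pbw_fil :: "int \<Rightarrow> 'v set" where
  "pbw_fil N = span (pbw_vec ` {M\<in>monomials. deg M \<le> N})"

lemma pbw_fil_mono: "v \<in> pbw_fil N \<Longrightarrow> N \<le> N' \<Longrightarrow> v \<in> pbw_fil N'"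
  unfolding pbw_fil_def by (rule rev_subsetD[OF _ span_mono]) auto

lemma pbw_fil_imp_fil: "v \<in> pbw_fil N \<Longrightarrow> fil N v"
  unfolding pbw_fil_def
proof (induction v rule: span_induct_alt)
  case (step c x y)
  then obtain M where M: "M \<in> monomials" "deg M \<le> N" "x = pbw_vec M" by auto
  have "fil (deg M) (pbw_vec M)"
    using fil_word_vec[OF index_word_letters[OF M(1)]] by (simp add: pbw_vec_def mset_index_word M)
  then show ?case using step(2) M by (auto intro: fil.add fil.scale fil.mono)
qed (rule fil.zero)

lemma fil_negative: "fil N v \<Longrightarrow> N < 0 \<Longrightarrow> v = 0"
proof (induction rule: fil.induct)
  case (mode N w u d n)
  then show ?case by (cases "d < 0") (auto simp: mode_simps dest: G_negative)
qed auto

text \<open>A letter in front of a basis monomial gives a word, and ordering that word costs only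
  terms of lower degree, to which \<open>lower\<close> applies.\<close>

lemma pbw_fil_gen_step:
  assumes lower: "\<And>N v. N < k \<Longrightarrow> fil N v \<Longrightarrow> v \<in> pbw_fil N"
    and x: "x \<in> letters" and w: "w \<in> pbw_fil K" and le: "K + wt (fst x) \<le> k"
  shows "mode (gens ! fst x) (- int (snd x)) w \<in> pbw_fil (K + wt (fst x))"
  unfolding pbw_fil_def
proof (rule span_linear_image[OF w[unfolded pbw_fil_def]])
  show "module_hom scale scale (mode (gens ! fst x) (- int (snd x)))"
    using linear_right by (simp add: module_hom_iff_linear)
  fix y assume "y \<in> pbw_vec ` {M \<in> monomials. deg M \<le> K}"
  then obtain M where M: "M \<in> monomials" "deg M \<le> K" "y = pbw_vec M" by auto
  let ?w = "x # index_word (pbw_index M)"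
  have "fil (deg (mset ?w) - 1) (word_vec ?w - pbw_vec (mset ?w))"
    by (rule fil_word_pbw) (use x index_word_letters[OF M(1)] in auto)
  then have "word_vec ?w - pbw_vec (add_mset x M) \<in> pbw_fil (wt (fst x) + deg M - 1)"
    using le M by (intro lower) (auto simp: mset_index_word)
  then have "word_vec ?w - pbw_vec (add_mset x M) \<in> pbw_fil (K + wt (fst x))"
    by (rule pbw_fil_mono) (use M in simp)
  moreover have "pbw_vec (add_mset x M) \<in> pbw_fil (K + wt (fst x))"
    unfolding pbw_fil_def by (intro span_base imageI) (use x M in auto)
  ultimately have "(word_vec ?w - pbw_vec (add_mset x M)) + pbw_vec (add_mset x M) \<in> pbw_fil (K + wt (fst x))"
    unfolding pbw_fil_def by (rule span_add)
  then have "word_vec ?w \<in> pbw_fil (K + wt (fst x))" by simp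
  then show "mode (gens ! fst x) (- int (snd x)) y \<in> span (pbw_vec ` {M \<in> monomials. deg M \<le> K + wt (fst x)})"
    by (simp add: M pbw_vec_def pbw_fil_def)
qed

text \<open>Induction on the word. The iterate formula for \<open>(s_(-m) u)_n\<close> produces
  letters applied to \<open>u_(n+i) w\<close> with \<open>n + i < 0\<close>, covered by the
  hypothesis for \<open>u\<close>, and terms containing a nonnegative mode, which lose one degree
  and fall under \<open>lower\<close>.\<close>

lemma pbw_fil_word_step:
  assumes lower: "\<And>N v. N < k \<Longrightarrow> fil N v \<Longrightarrow> v \<in> pbw_fil N"
    and a: "set a \<subseteq> letters" and w: "w \<in> pbw_fil K" and n: "n < 0" and le: "K + weight (mset a) \<le> k"
  shows "mode (word_vec a) n w \<in> pbw_fil (K + weight (mset a))"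
  using a w n le
proof (induction a arbitrary: w n)
  case Nil
  then show ?case by (simp add: vacuum pbw_fil_def span_zero)
next
  case (Cons x a)
  let ?s = "gens ! fst x" and ?u = "word_vec a" and ?m = "snd x"
  have x: "x \<in> letters" and a: "set a \<subseteq> letters" using Cons.prems by auto
  note s = letters_D(4)[OF x] and u = word_vec_weight[OF a]
  have m: "1 \<le> ?m" using letters_D[OF x] by simp
  have K: "K + weight (mset a) + wt (fst x) \<le> K + weight (mset (x # a))" using m by simp
  have K': "K + weight (mset a) \<le> k" using K Cons.prems(4) letters_D(3)[OF x] by simp
  have w: "fil K w" by (rule pbw_fil_imp_fil[OF Cons.prems(2)])
  obtain I1 I2 :: nat where "\<forall>i\<ge>int I1. mode ?s i w = 0" "\<forall>i\<ge>int I2. mode ?u i w = 0"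
    using vmode_eventually_0 by metis
  then have I: "mode ?s (int i) w = 0" "mode ?u (n + int i) w = 0" if "i \<ge> I1 + I2 + nat \<bar>n\<bar>" for i
    using that by auto
  have 1: "mode ?s (- int ?m - int i) (mode ?u (n + int i) w) \<in> pbw_fil (K + weight (mset (x # a)))" for i
  proof (cases "n + int i < 0")
    case True
    have "mode ?u (n + int i) w \<in> pbw_fil (K + weight (mset a))"
      by (rule Cons.IH[OF a Cons.prems(2) True K'])
    then have "mode (gens ! fst (fst x, ?m + i)) (- int (snd (fst x, ?m + i))) (mode ?u (n + int i) w)
        \<in> pbw_fil (K + weight (mset a) + wt (fst (fst x, ?m + i)))"
      using x K Cons.prems(4)
      by (intro pbw_fil_gen_step[of k, OF lower]) (auto simp: letters_def)
    moreover have "- int ?m - int i = - int (?m + i)" by simp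
    ultimately show ?thesis using pbw_fil_mono[OF _ K] by (simp only: fst_conv snd_conv)
  next
    case False
    have "fil (K + weight (mset a) - 1 + wt (fst x)) (mode ?s (- int ?m - int i) (mode ?u (n + int i) w))"
      by (intro fil_mode[OF fil_mode_nonneg[OF w u] s]) (use False in simp)
    then have "mode ?s (- int ?m - int i) (mode ?u (n + int i) w) \<in>
        pbw_fil (K + weight (mset a) - 1 + wt (fst x))"
      by (rule lower[rotated]) (use K Cons.prems(4) in linarith)
    then show ?thesis by (rule pbw_fil_mono) (use K in linarith)
  qed
  have 2: "mode ?u (n + - int ?m - int i) (mode ?s (int i) w) \<in> pbw_fil (K + weight (mset (x # a)))" for i
  proof -
    have "fil (K + wt (fst x) - 1 + weight (mset a)) (mode ?u (n + - int ?m - int i) (mode ?s (int i) w))"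
      by (intro fil_mode[OF fil_mode_nonneg[OF w s] u]) simp
    then have "mode ?u (n + - int ?m - int i) (mode ?s (int i) w) \<in>
        pbw_fil (K + wt (fst x) - 1 + weight (mset a))"
      by (rule lower[rotated]) (use K Cons.prems(4) in linarith)
    then show ?thesis by (rule pbw_fil_mono) (use K in linarith)
  qed
  show ?case
    unfolding word_vec_simps
    by (subst iterate_formula[OF I])
      (use 1 2 in \<open>auto simp: pbw_fil_def intro!: span_sum span_scale span_diff\<close>)
qed

text \<open>Induction on the degree bound. The modes in \<open>fil\<close> belong to arbitrary
  homogeneous vectors; such a vector is a combination of words of its weight, and
  \<open>pbw_fil_word_step\<close> expands the modes of a word through letters.\<close>

lemma fil_imp_pbw_fil: "fil N v \<Longrightarrow> v \<in> pbw_fil N"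
proof -
  have "\<forall>N v. N < int k \<longrightarrow> fil N v \<longrightarrow> v \<in> pbw_fil N" for k
  proof (induction k)
    case 0
    then show ?case using fil_negative unfolding pbw_fil_def by (metis of_nat_0 span_zero)
  next
    case (Suc k)
    then have lower: "\<And>N v. N < int k \<Longrightarrow> fil N v \<Longrightarrow> v \<in> pbw_fil N" by blast
    have step: "mode u n w \<in> pbw_fil (K + d)"
      if "u \<in> G d" "w \<in> pbw_fil K" "K + d \<le> int k" "n < 0" for u d w K n
      unfolding pbw_fil_def
    proof (rule span_linear_image[OF G_eq_span[OF that(1)], where f = "\<lambda>u. mode u n w"])
      show "module_hom scale scale (\<lambda>u. mode u n w)"
        using linear_left by (simp add: module_hom_iff_linear)
      fix x assume "x \<in> pbw_vec ` {M \<in> monomials. weight M = d}"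
      then obtain M where M: "M \<in> monomials" "weight M = d" "x = pbw_vec M" by auto
      have "mode (word_vec (index_word (pbw_index M))) n w \<in>
          pbw_fil (K + weight (mset (index_word (pbw_index M))))"
        by (rule pbw_fil_word_step[OF lower])
          (use that M index_word_letters in \<open>auto simp: mset_index_word\<close>)
      then show "mode x n w \<in> span (pbw_vec ` {M \<in> monomials. deg M \<le> K + d})"
        by (simp add: M mset_index_word pbw_fil_def flip: pbw_vec_def)
    qed
    have "fil N v \<Longrightarrow> N \<le> int k \<Longrightarrow> v \<in> pbw_fil N" for N v
    proof (induction rule: fil.induct)
      case (vac N)
      then show ?case unfolding pbw_fil_def
        by (intro span_base) (auto intro!: image_eqI[of _ _ "{#}"])
    next
      case (mode N w u d n)
      show ?case
      proof (cases "d < 0")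
        case True
        then have "u = 0" using mode.hyps(2) G_negative by blast
        then show ?thesis by (simp add: mode_simps pbw_fil_def span_zero)
      next
        case False
        then show ?thesis using mode by (intro step) auto
      qed
    next
      case (mono N v N')
      then show ?case by (auto intro: pbw_fil_mono)
    qed (auto simp: pbw_fil_def intro: span_zero span_add span_scale)
    then show ?case by auto
  qed
  then show "fil N v \<Longrightarrow> v \<in> pbw_fil N"
  proof -
    have "N < int (nat (N + 1))" by linarith
    then show "fil N v \<Longrightarrow> v \<in> pbw_fil N"
      using \<open>\<And>k. \<forall>N v. N < int k \<longrightarrow> fil N v \<longrightarrow> v \<in> pbw_fil N\<close> by blast
  qed
qed

lemma fil_iff: "fil N v \<longleftrightarrow> v \<in> pbw_fil N"
  using fil_imp_pbw_fil pbw_fil_imp_fil by blast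


section \<open>The derivation on the associated graded algebra\<close>

lemma D_word_vec:
  "D (word_vec w) = (\<Sum>j<length w. scale (of_nat (snd (w ! j))) (word_vec (w[j := inc (w ! j)])))"
proof (induction w)
  case (Cons x w)
  have "mode (D (gens ! fst x)) (- int (snd x)) (word_vec w) =
      scale (of_nat (snd x)) (mode (gens ! fst x) (- int (Suc (snd x))) (word_vec w))"
  proof -
    have "- int (snd x) - 1 = - int (Suc (snd x))" by simp
    then show ?thesis unfolding mode_D_left by (simp only: of_int_minus of_int_of_nat_eq minus_minus)
  qed
  then show ?case
    unfolding length_Cons sum.lessThan_Suc_shift
    by (simp add: D_mode Cons.IH mode_simps add.commute)
qed (simp add: D_vac)

lemma inc_letters: "x \<in> letters \<Longrightarrow> inc x \<in> letters"
  by (auto simp: letters_def)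

text \<open>The functional below vanishes in degrees less than \<open>deg M\<close>, so it only sees the leading part
  of \<open>D\<close>, which is a derivation of the polynomial algebra.\<close>

lemma functional_D_pbw_vec:
  assumes f: "module_hom scale (*) f" "\<And>M. M \<in> monomials \<Longrightarrow> f (pbw_vec M) = g M"
    and M: "M \<in> monomials" and g: "\<And>M'. M' \<in> monomials \<Longrightarrow> deg M' < deg M \<Longrightarrow> g M' = 0"
  shows "f (D (pbw_vec M)) = (\<Sum>x\<in>#M. of_nat (snd x) * g (add_mset (inc x) (M - {#x#})))"
proof -
  define w where "w = index_word (pbw_index M)"
  have w: "mset w = M" "set w \<subseteq> letters" "pbw_vec M = word_vec w"
    using M by (auto simp: w_def mset_index_word pbw_vec_def dest: index_word_letters)
  have zero: "f v = 0" if "fil (deg M - 1) v" for v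
    using fil_imp_pbw_fil[OF that] unfolding pbw_fil_def
    by (induction v rule: span_induct_alt)
      (auto simp: module_hom.zero[OF f(1)] module_hom.add[OF f(1)] module_hom.scale[OF f(1)] f(2) g)
  have "f (word_vec (w[j := inc (w ! j)])) = g (add_mset (inc (w ! j)) (M - {#w ! j#}))"
    if j: "j < length w" for j
  proof -
    let ?w = "w[j := inc (w ! j)]"
    have ms: "mset ?w = add_mset (inc (w ! j)) (M - {#w ! j#})"
      using j by (simp add: mset_update w)
    have wj: "w ! j \<in># M" "w ! j \<in> letters" using j w by (auto simp flip: w(1))
    have sub: "set ?w \<subseteq> letters"
      using w(2) inc_letters[OF wj(2)] set_update_subset_insert[of w j "inc (w ! j)"] by blast
    have "deg (mset ?w) = deg (add_mset (w ! j) (M - {#w ! j#}))" by (simp add: ms)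
    then have "deg (mset ?w) = deg M" using wj by simp
    with fil_word_pbw[OF sub] have "f (word_vec ?w - pbw_vec (mset ?w)) = 0" by (intro zero) simp
    then have "f (word_vec ?w) = f (pbw_vec (mset ?w))" by (simp add: module_hom.diff[OF f(1)])
    also have "\<dots> = g (mset ?w)" using sub by (intro f(2)) (simp add: mset_in_monomials)
    finally show ?thesis by (simp add: ms)
  qed
  then have "f (D (pbw_vec M)) = (\<Sum>j<length w. of_nat (snd (w ! j)) * g (add_mset (inc (w ! j)) (M - {#w ! j#})))"
    unfolding w(3) D_word_vec by (simp add: module_hom.sum[OF f(1)] module_hom.scale[OF f(1)])
  also have "\<dots> = sum_list (map (\<lambda>x. of_nat (snd x) * g (add_mset (inc x) (M - {#x#}))) w)"
    by (simp add: sum_list_sum_nth atLeast0LessThan)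
  also have "\<dots> = (\<Sum>x\<in>#M. of_nat (snd x) * g (add_mset (inc x) (M - {#x#})))"
    unfolding w(1)[symmetric] by (simp flip: sum_mset_sum_list)
  finally show ?thesis .
qed

lemma functional_vanishes:
  assumes f: "module_hom scale (*) f" "\<And>M. M \<in> monomials \<Longrightarrow> f (pbw_vec M) = g M"
    and g: "\<And>M. M \<in> monomials \<Longrightarrow> deg M \<le> N \<Longrightarrow> g M = 0" and v: "fil N v"
  shows "f v = 0"
  using fil_imp_pbw_fil[OF v] unfolding pbw_fil_def
  by (induction v rule: span_induct_alt)
    (auto simp: module_hom.zero[OF f(1)] module_hom.add[OF f(1)] module_hom.scale[OF f(1)] f(2) g)

text \<open>Injectivity of \<open>D\<close> on nonconstant polynomials, applied in top degree. Among
  the monomials of top degree choose \<open>M\<close> with a letter \<open>(i, m)\<close> of largest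
  mode number. Raising this letter gives \<open>M'\<close>, which arises in no other way, so its
  coefficient in \<open>D v\<close> is \<open>c M\<close> times \<open>m\<close> times the
  multiplicity of the letter. \<open>N >= 0\<close> makes the top degree positive, hence
  \<open>M\<close> nonconstant.\<close>

lemma fil_D_cancel:
  assumes Dv: "fil N (D v)" and N: "0 \<le> N"
  shows "fil N v"
proof (rule ccontr)
  assume not: "\<not> fil N v"
  have "v \<in> span (pbw_vec ` monomials)" by (simp add: span_pbw_vec)
  then obtain A c where A: "finite A" "A \<subseteq> monomials" "\<And>M. M \<in> A \<Longrightarrow> c M \<noteq> 0"
    "v = (\<Sum>M\<in>A. scale (c M) (pbw_vec M))"
    using pbw_expansion[OF _ order.refl] by metis
  have "\<exists>M\<in>A. N < deg M"
  proof (rule ccontr)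
    assume "\<not> ?thesis"
    then have "v \<in> pbw_fil N"
      unfolding A(4) pbw_fil_def using A(2) by (intro span_sum span_scale span_base) force
    with not show False by (simp add: fil_iff)
  qed
  define d where "d = Max (deg ` A)"
  have d: "\<And>M. M \<in> A \<Longrightarrow> deg M \<le> d" "N < d" "d \<in> deg ` A"
  proof -
    have fin: "finite (deg ` A)" "deg ` A \<noteq> {}" using A(1) \<open>\<exists>M\<in>A. N < deg M\<close> by auto
    show "\<And>M. M \<in> A \<Longrightarrow> deg M \<le> d" "d \<in> deg ` A"
      unfolding d_def using fin by auto
    then show "N < d" using \<open>\<exists>M\<in>A. N < deg M\<close> by force
  qed
  define S where "S = (\<Union>M\<in>{M\<in>A. deg M = d}. set_mset M)"
  have S: "finite S" using A(1) by (simp add: S_def)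
  obtain M0 where "M0 \<in> A" "deg M0 = d" using d by auto
  then have "M0 \<noteq> {#}" using d(2) N by auto
  then have "S \<noteq> {}" using \<open>M0 \<in> A\<close> \<open>deg M0 = d\<close> by (auto simp: S_def)
  then have "Max (snd ` S) \<in> snd ` S" using S by (intro Max_in) auto
  then obtain i m where im: "(i, m) \<in> S" "m = Max (snd ` S)" by auto
  have max: "snd x \<le> m" if "x \<in> S" for x unfolding im(2) using S that by (intro Max_ge) auto
  obtain M where M: "M \<in> A" "deg M = d" "(i, m) \<in># M" using im by (auto simp: S_def)
  have im_let: "(i, m) \<in> letters" using M A(2) by (auto simp: monomials_def)
  define M' where "M' = add_mset (i, Suc m) (M - {#(i, m)#})"
  define g :: "(nat \<times> nat) multiset \<Rightarrow> complex" where "g K = (if K = M' then 1 else 0)" for K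
  have degM': "deg M' = d"
  proof -
    have "deg M' = deg (add_mset (i, m) (M - {#(i, m)#}))" by (simp add: M'_def)
    then show ?thesis using M by simp
  qed
  obtain f where f: "module_hom scale (*) f" "\<And>M. M \<in> monomials \<Longrightarrow> f (pbw_vec M) = g M"
    using pbw_functional by blast
  have fD: "f (D (pbw_vec K)) = (\<Sum>x\<in>#K. of_nat (snd x) * g (add_mset (inc x) (K - {#x#})))"
    if "K \<in> A" for K
    by (rule functional_D_pbw_vec[OF f]) (use A(2) d(1)[OF that] that degM' in \<open>auto simp: g_def\<close>)
  \<comment> \<open>By maximality \<open>(i, Suc m)\<close> occurs in no monomial of top degree, so
    in \<open>M'\<close> it can only be the letter just raised.\<close>
  have eq: "x = (i, m) \<and> K = M" if "K \<in> A" "x \<in># K" "add_mset (inc x) (K - {#x#}) = M'" for K x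
  proof -
    have "deg K = deg (add_mset x (K - {#x#}))" using that by simp
    also have "\<dots> = deg (add_mset (inc x) (K - {#x#}))" by simp
    finally have degK: "deg K = d" using that degM' by simp
    have "(i, Suc m) \<in># add_mset (inc x) (K - {#x#})" using that by (simp add: M'_def)
    moreover have "(i, Suc m) \<notin># K - {#x#}"
    proof
      assume "(i, Suc m) \<in># K - {#x#}"
      then have "(i, Suc m) \<in> S" using that degK by (auto simp: S_def dest: in_diffD)
      from max[OF this] show False by simp
    qed
    ultimately have x: "x = (i, m)" by (cases x) auto
    then have "K - {#x#} = M - {#x#}" using that by (simp add: M'_def)
    then have "K = M" using that(2) M(3) x by (metis insert_DiffM)
    with x show ?thesis by simp
  qed
  have "f (D (pbw_vec K)) = (if K = M then of_nat m * of_nat (count M (i, m)) else 0)" if K: "K \<in> A" for K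
  proof (cases "K = M")
    case True
    have "f (D (pbw_vec M)) = (\<Sum>x\<in>#M. if x = (i, m) then of_nat m else 0)"
      unfolding fD[OF M(1)]
      by (intro arg_cong[where f = sum_mset] image_mset_cong)
        (use eq[OF M(1)] in \<open>auto simp: g_def M'_def\<close>)
    then show ?thesis using True by (simp add: sum_mset_delta)
  next
    case False
    have "f (D (pbw_vec K)) = (\<Sum>x\<in>#K. 0)"
      unfolding fD[OF K]
      by (intro arg_cong[where f = sum_mset] image_mset_cong) (use eq[OF K] False in \<open>auto simp: g_def\<close>)
    then show ?thesis using False by simp
  qed
  then have "f (D v) = (\<Sum>K\<in>A. if K = M then c M * (of_nat m * of_nat (count M (i, m))) else 0)"
    unfolding A(4) D_simps module_hom.sum[OF f(1)] module_hom.scale[OF f(1)]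
    by (intro sum.cong) auto
  also have "\<dots> = c M * (of_nat m * of_nat (count M (i, m)))"
    using A(1) M(1) by simp
  also have "\<dots> \<noteq> 0"
    using A(3)[OF M(1)] M(3) im_let by (auto simp: letters_def)
  finally have "f (D v) \<noteq> 0" .
  moreover have "f (D v) = 0"
    by (rule functional_vanishes[OF f _ Dv]) (use degM' d(2) in \<open>auto simp: g_def\<close>)
  ultimately show False by simp
qed

text \<open>Here \<open>N = 0\<close> in \<open>fil_D_cancel\<close>: \<open>v\<close> has degree 0,
  is a multiple of \<open>vac\<close>, and so has weight 0.\<close>

lemma D_inj_weight:
  assumes "v \<in> G n" "0 < n" "D v = 0"
  shows "v = 0"
proof -
  have "fil 0 v" by (rule fil_D_cancel) (simp_all add: assms fil.zero)
  then have "v \<in> pbw_fil 0" by (rule fil_imp_pbw_fil)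
  also have "pbw_fil 0 \<subseteq> span {vac}"
    unfolding pbw_fil_def by (rule span_mono) (auto dest: deg_eq_0)
  also have "span {vac} \<subseteq> G 0"
    using vac_weight by (intro span_minimal G_subspace) auto
  finally show ?thesis using G_disjoint[OF assms(1)] assms(2) by auto
qed

end


section \<open>Quadratic monomials modulo the image of \<open>D\<close>\<close>

text \<open>In the polynomial algebra, where \<open>D x\<^sub>m = m x\<^sub>m\<^sub>+\<^sub>1\<close>, the functional with values
  \<open>(-1)^n / ((m - 1)! (n - 1)!)\<close> on \<open>x\<^sub>m y\<^sub>n\<close> with \<open>m + n\<close> fixed vanishes on the image of \<open>D\<close>.\<close>

definition pair_coeff :: "nat \<Rightarrow> nat \<Rightarrow> nat \<Rightarrow> nat \<times> nat \<Rightarrow> nat \<times> nat \<Rightarrow> complex" where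
  "pair_coeff i j K x y = (if fst x = i \<and> fst y = j \<and> snd x + snd y = K
     then (- 1) ^ snd y / (fact (snd x - 1) * fact (snd y - 1)) else 0)"

text \<open>Both orders are summed because the letters commute. For \<open>i = j\<close> and odd
  \<open>K\<close> they cancel, which is the source of the parity condition in
  \<open>quadratic\<close>, where \<open>K = m + 1\<close>.\<close>

definition pair_functional :: "nat \<Rightarrow> nat \<Rightarrow> nat \<Rightarrow> (nat \<times> nat) multiset \<Rightarrow> complex" where
  "pair_functional i j K M =
     (if size M = 2 then (\<Sum>x\<in>#M. \<Sum>y\<in>#M - {#x#}. pair_coeff i j K x y) else 0)"

lemma pair_functional_pair:
  "pair_functional i j K {#x, y#} = pair_coeff i j K x y + pair_coeff i j K y x"
  by (auto simp: pair_functional_def)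

text \<open>Since \<open>m / m! = 1 / (m - 1)!\<close>, the two terms have the same modulus, and
  only raising the second letter changes the sign.\<close>

lemma pair_coeff_D:
  assumes "1 \<le> snd x" "1 \<le> snd y"
  shows "of_nat (snd x) * pair_coeff i j K (inc x) y + of_nat (snd y) * pair_coeff i j K x (inc y) = 0"
proof -
  obtain a b where "snd x = Suc a" "snd y = Suc b"
    using assms by (metis Suc_le_D One_nat_def)
  then show ?thesis by (auto simp: pair_coeff_def simp del: of_nat_Suc)
qed

lemma size_2_obtains:
  assumes "size M = 2"
  obtains x y where "M = {#x, y#}"
proof -
  obtain x N where N: "M = add_mset x N" "size N = 1"
    using assms by (metis size_eq_Suc_imp_eq_union Suc_1 add_mset_add_single nat.inject size_add_mset One_nat_def)
  then obtain y where "N = {#y#}" by (metis size_1_singleton_mset)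
  with N that show ?thesis by blast
qed

lemma pair_functional_D:
  assumes "\<And>x. x \<in># M \<Longrightarrow> 1 \<le> snd x"
  shows "(\<Sum>x\<in>#M. of_nat (snd x) * pair_functional i j K (add_mset (inc x) (M - {#x#}))) = 0"
proof (cases "size M = 2")
  case True
  then obtain x y where M: "M = {#x, y#}" by (rule size_2_obtains)
  have "(\<Sum>x\<in>#M. of_nat (snd x) * pair_functional i j K (add_mset (inc x) (M - {#x#}))) =
      of_nat (snd x) * pair_functional i j K {#inc x, y#} + of_nat (snd y) * pair_functional i j K {#inc y, x#}"
    by (auto simp: M)
  also have "\<dots> =
     (of_nat (snd x) * pair_coeff i j K (inc x) y + of_nat (snd y) * pair_coeff i j K x (inc y)) +
     (of_nat (snd y) * pair_coeff i j K (inc y) x + of_nat (snd x) * pair_coeff i j K y (inc x))"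
    unfolding pair_functional_pair by (simp add: algebra_simps)
  also have "\<dots> = 0"
    using assms by (simp add: M pair_coeff_D del: snd_conv fst_conv)
  finally show ?thesis .
next
  case False
  have "(\<Sum>x\<in>#M. of_nat (snd x) * pair_functional i j K (add_mset (inc x) (M - {#x#}))) = (\<Sum>x\<in>#M. 0)"
  proof (intro arg_cong[where f = sum_mset] image_mset_cong)
    fix x assume "x \<in># M"
    then have "size (add_mset (inc x) (M - {#x#})) = size M"
      by (metis insert_DiffM size_add_mset)
    with False show "of_nat (snd x) * pair_functional i j K (add_mset (inc x) (M - {#x#})) = 0"
      by (simp only: pair_functional_def if_False mult_zero_right)
  qed
  then show ?thesis by simp
qed

lemma (in vector_space) independent_family:
  assumes "\<And>A c a. finite A \<Longrightarrow> A \<subseteq> K \<Longrightarrow> (\<Sum>a\<in>A. scale (c a) (f a)) = 0 \<Longrightarrow> a \<in> A \<Longrightarrow> c a = 0"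
  shows "inj_on f K" "independent (f ` K)"
proof -
  show inj: "inj_on f K"
  proof (rule inj_onI, rule ccontr)
    fix a b assume ab: "a \<in> K" "b \<in> K" "f a = f b" "a \<noteq> b"
    have "(\<Sum>x\<in>{a, b}. scale ((\<lambda>x. if x = a then 1 else - 1) x) (f x)) = 0"
      using ab by simp
    from assms[OF _ _ this, of a] ab show False by simp
  qed
  show "independent (f ` K)"
    unfolding independent_explicit_finite_subsets
  proof (intro allI impI ballI)
    fix S u v assume S: "S \<subseteq> f ` K" "finite S" "(\<Sum>v\<in>S. scale (u v) v) = 0" "v \<in> S"
    obtain A where A: "A \<subseteq> K" "finite A" "S = f ` A"
      using finite_subset_image[OF S(2,1)] by blast
    have "inj_on f A" using inj A(1) inj_on_subset by blast
    then have "(\<Sum>a\<in>A. scale (u (f a)) (f a)) = 0"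
      using S(3) unfolding A(3) by (simp add: sum.reindex)
    from assms[OF A(2,1) this] S(4) show "u v = 0" by (auto simp: A(3))
  qed
qed

context freely_generated_vertex_algebra
begin

text \<open>The triple \<open>(i, j, m)\<close> stands for \<open>a\<^sup>(\<^sup>i\<^sup>)\<^sub>-\<^sub>m a\<^sup>(\<^sup>j\<^sup>)\<close>, and \<open>(i, i, 0)\<close> for \<open>a\<^sup>(\<^sup>i\<^sup>)\<close>.  For \<open>i = j\<close>
  and even \<open>m > 0\<close>, skew-symmetry expresses the vector through those with smaller \<open>m\<close>.\<close>

definition quadratic :: "(nat \<times> nat \<times> nat) set" where
  "quadratic = {(i, j, m). i \<le> j \<and> j < length gens \<and> (if i = j then m = 0 \<or> odd m else 1 \<le> m)}"

text \<open>A generator is a word of one letter because \<open>a_(-1) vac = a\<close>; for the same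
  reason the second letter of a quadratic word has mode number 1.\<close>

definition quad_word :: "nat \<times> nat \<times> nat \<Rightarrow> (nat \<times> nat) list" where
  "quad_word = (\<lambda>(i, j, m). if m = 0 then [(i, 1)] else [(i, m), (j, 1)])"

text \<open>Up to nonzero factors, the functionals dual to \<open>quadratic\<close> modulo the image
  of \<open>D\<close>; \<open>m + 1\<close> is the total mode number of the quadratic word.\<close>

definition quad_functional :: "nat \<times> nat \<times> nat \<Rightarrow> (nat \<times> nat) multiset \<Rightarrow> complex" where
  "quad_functional = (\<lambda>(i, j, m) M.
     if m = 0 then (if M = {#(i, 1)#} then 1 else 0) else pair_functional i j (m + 1) M)"

lemma quad_word_letters: "p \<in> quadratic \<Longrightarrow> set (quad_word p) \<subseteq> letters"
  by (auto simp: quadratic_def quad_word_def letters_def split: if_splits)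

lemma quad_functional_D:
  assumes "M \<in> monomials"
  shows "(\<Sum>x\<in>#M. of_nat (snd x) * quad_functional p (add_mset (inc x) (M - {#x#}))) = 0"
proof -
  obtain i j m where p: "p = (i, j, m)" by (cases p)
  have pos: "1 \<le> snd x" if "x \<in># M" for x
    using assms that letters_D(2)[of x] by (auto simp: monomials_def)
  show ?thesis
  proof (cases "m = 0")
    \<comment> \<open>A raised letter has mode number at least 2, so \<open>D\<close> never produces
      \<open>{#(i, 1)#}\<close>.\<close>
    case True
    have "(\<Sum>x\<in>#M. of_nat (snd x) * quad_functional p (add_mset (inc x) (M - {#x#}))) =
      (\<Sum>x\<in>#M. 0 :: complex)"
      by (intro arg_cong[where f = sum_mset] image_mset_cong)
        (auto simp: quad_functional_def p True add_mset_eq_single dest: pos)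
    then show ?thesis by simp
  next
    case False
    then show ?thesis using pair_functional_D[OF pos] by (simp add: quad_functional_def p)
  qed
qed

lemma quad_functional_deg:
  assumes "quad_functional p M \<noteq> 0"
  shows "deg M = deg (mset (quad_word p))"
proof -
  obtain i j m where p: "p = (i, j, m)" by (cases p)
  show ?thesis
  proof (cases "m = 0")
    case True
    then show ?thesis using assms by (auto simp: quad_functional_def quad_word_def p split: if_splits)
  next
    case False
    then have "size M = 2" using assms by (auto simp: quad_functional_def pair_functional_def p split: if_splits)
    then obtain x y where "M = {#x, y#}" by (rule size_2_obtains)
    then show ?thesis
      using assms False
      by (auto simp: quad_functional_def p pair_functional_pair pair_coeff_def quad_word_def split: if_splits)
  qed
qed

text \<open>For \<open>i = j\<close> the two orders contribute \<open>(-1)^1\<close> and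
  \<open>(-1)^m\<close>, which add up as \<open>m\<close> is odd; for \<open>i < j\<close> one order
  contributes. Different \<open>m\<close> have different total mode numbers.\<close>

lemma quad_functional_word:
  assumes "p \<in> quadratic" "q \<in> quadratic"
  shows "quad_functional p (mset (quad_word q)) \<noteq> 0 \<longleftrightarrow> p = q"
proof -
  obtain i j m where p: "p = (i, j, m)" by (cases p)
  obtain i' j' m' where q: "q = (i', j', m')" by (cases q)
  consider "m = 0" | "m > 0" "m' = 0" | "m > 0" "m' > 0" by blast
  then show ?thesis
  proof cases
    case 3
    then show ?thesis
      using assms by (auto simp: p q quadratic_def quad_functional_def quad_word_def
          pair_functional_pair pair_coeff_def split: if_splits)
  qed (use assms in \<open>auto simp: p q quadratic_def quad_functional_def quad_word_def
      pair_functional_def split: if_splits\<close>)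
qed

text \<open>Let \<open>q\<close> have top degree among the indices with nonzero coefficient. By
  \<open>fil_D_cancel\<close> the vector under \<open>D\<close> has no larger degree, so the
  functional of \<open>q\<close> sees only the leading part of its image and kills it, while among
  the words it detects \<open>q\<close> alone.\<close>

lemma quadratic_independent_mod_D:
  assumes A: "finite A" "A \<subseteq> quadratic"
    and b: "\<And>p. p \<in> A \<Longrightarrow> b p = word_vec (quad_word p) + D (y p)"
    and v: "(\<Sum>p\<in>A. scale (c p) (b p)) = D v" and p: "p \<in> A"
  shows "c p = 0"
proof (rule ccontr)
  assume "c p \<noteq> 0"
  define B where "B = {p\<in>A. c p \<noteq> 0}"
  define \<delta> where "\<delta> p = deg (mset (quad_word p))" for p
  have "p \<in> B" using p \<open>c p \<noteq> 0\<close> by (simp add: B_def)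
  moreover have "B \<subseteq> A" by (simp add: B_def)
  ultimately have B: "finite B" "B \<noteq> {}" "B \<subseteq> quadratic"
    using A finite_subset by blast+
  have "Max (\<delta> ` B) \<in> \<delta> ` B" using B by (intro Max_in) auto
  then obtain q where q: "q \<in> B" "\<delta> q = Max (\<delta> ` B)" by auto
  have max: "\<delta> p \<le> \<delta> q" if "p \<in> B" for p unfolding q(2) using B(1) that by simp
  \<comment> \<open>The corrections \<open>D (y p)\<close> are moved into the vector under
    \<open>D\<close>.\<close>
  define u where "u = v - (\<Sum>p\<in>A. scale (c p) (y p))"
  have "(\<Sum>p\<in>A. scale (c p) (word_vec (quad_word p))) = D u"
  proof -
    have "D v = (\<Sum>p\<in>A. scale (c p) (word_vec (quad_word p)) + scale (c p) (D (y p)))"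
      unfolding v[symmetric] by (intro sum.cong) (simp_all add: b scale_right_distrib)
    then show ?thesis by (simp add: u_def D_simps sum.distrib)
  qed
  moreover have "(\<Sum>p\<in>A. scale (c p) (word_vec (quad_word p))) =
      (\<Sum>p\<in>B. scale (c p) (word_vec (quad_word p)))"
    unfolding B_def using A by (intro sum.mono_neutral_right) auto
  ultimately have Du: "D u = (\<Sum>p\<in>B. scale (c p) (word_vec (quad_word p)))" by simp
  have "fil (\<delta> q) (D u)"
    unfolding Du
  proof (intro fil_sum fil.scale)
    fix p assume "p \<in> B"
    then have "fil (\<delta> p) (word_vec (quad_word p))"
      unfolding \<delta>_def using B(3) by (intro fil_word_vec quad_word_letters) auto
    then show "fil (\<delta> q) (word_vec (quad_word p))"
      using max[OF \<open>p \<in> B\<close>] by (rule fil.mono)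
  qed
  moreover have "0 \<le> \<delta> q"
    unfolding \<delta>_def by (intro deg_nonneg) (use q(1) B(3) quad_word_letters mset_in_monomials in blast)
  ultimately have "fil (\<delta> q) u" by (rule fil_D_cancel)
  obtain f where f: "module_hom scale (*) f"
    "\<And>M. M \<in> monomials \<Longrightarrow> f (pbw_vec M) = quad_functional q M"
    using pbw_functional by blast
  have "f (D u) = 0"
    using fil_imp_pbw_fil[OF \<open>fil (\<delta> q) u\<close>] unfolding pbw_fil_def
  proof (induction u rule: span_induct_alt)
    case (step c x y)
    then obtain M where M: "M \<in> monomials" "deg M \<le> \<delta> q" "x = pbw_vec M" by auto
    have "f (D (pbw_vec M)) = (\<Sum>x\<in>#M. of_nat (snd x) * quad_functional q (add_mset (inc x) (M - {#x#})))"
      by (rule functional_D_pbw_vec[OF f M(1)])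
        (use quad_functional_deg[of q] M(2) in \<open>force simp: \<delta>_def\<close>)+
    with step M show ?case
      by (simp add: quad_functional_D D_simps module_hom.add[OF f(1)] module_hom.scale[OF f(1)])
  qed (simp add: D_simps module_hom.zero[OF f(1)])
  moreover have "f (word_vec (quad_word p)) = quad_functional q (mset (quad_word p))" if "p \<in> B" for p
  proof -
    have w: "set (quad_word p) \<subseteq> letters" using B(3) that by (intro quad_word_letters) auto
    have "f (word_vec (quad_word p) - pbw_vec (mset (quad_word p))) = 0"
    proof (rule functional_vanishes[OF f _ fil_word_pbw[OF w]])
      fix M assume "deg M \<le> deg (mset (quad_word p)) - 1"
      then have "deg M \<noteq> deg (mset (quad_word q))" using max[OF that] by (simp add: \<delta>_def)
      then show "quad_functional q M = 0" using quad_functional_deg by blast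
    qed
    then show ?thesis
      using w by (simp add: module_hom.diff[OF f(1)] f(2) mset_in_monomials)
  qed
  then have "f (D u) = (\<Sum>p\<in>B. c p * quad_functional q (mset (quad_word p)))"
    unfolding Du by (simp add: module_hom.sum[OF f(1)] module_hom.scale[OF f(1)])
  also have "\<dots> = (\<Sum>p\<in>B. if p = q then c q * quad_functional q (mset (quad_word q)) else 0)"
    using quad_functional_word[of q] q(1) B(3) by (intro sum.cong) auto
  also have "\<dots> = c q * quad_functional q (mset (quad_word q))"
    using q(1) B(1) by simp
  also have "\<dots> \<noteq> 0"
    using q(1) B(3) quad_functional_word[of q q] by (auto simp: B_def)
  ultimately show False by simp
qed


section \<open>Extending a map from generators modulo the image of \<open>D\<close>\<close>

text \<open>\<open>D\<close> is injective in positive weight, so the images under \<open>D\<close>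
  of a basis of weight \<open>n\<close> and the vectors \<open>b p\<close> are jointly independent
  and values can be prescribed on all of them.\<close>

lemma extend_by_weight:
  fixes n :: nat
  assumes \<phi>: "module_hom scale scale \<phi>" "\<And>v. v \<in> G (int n) \<Longrightarrow> \<phi> v \<in> G (int n)"
      "n = 0 \<Longrightarrow> \<phi> = (\<lambda>_. 0)"
    and b: "\<And>p. p \<in> J \<Longrightarrow> b p \<in> G (int (Suc n))" and t: "\<And>p. p \<in> J \<Longrightarrow> t p \<in> G (int (Suc n))"
    and indep: "\<And>A c v p. finite A \<Longrightarrow> A \<subseteq> J \<Longrightarrow> (\<Sum>p\<in>A. scale (c p) (b p)) = D v \<Longrightarrow> p \<in> A \<Longrightarrow> c p = 0"
  shows "\<exists>\<psi>. module_hom scale scale \<psi> \<and> (\<forall>v\<in>G (int (Suc n)). \<psi> v \<in> G (int (Suc n))) \<and>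
    (\<forall>v\<in>G (int n). \<psi> (D v) = D (\<phi> v)) \<and> (\<forall>p\<in>J. \<psi> (b p) = t p)"
proof -
  \<comment> \<open>In weight 0 the empty set replaces a basis: the space is spanned by
    \<open>vac\<close>, which \<open>D\<close> kills, and \<phi> is zero there.\<close>
  obtain E where E: "E \<subseteq> G (int n)" "independent E" "n > 0 \<Longrightarrow> G (int n) \<subseteq> span E" "n = 0 \<Longrightarrow> E = {}"
  proof (cases "n = 0")
    case True
    then show ?thesis using that[of "{}"] by (simp add: independent_empty)
  next
    case False
    obtain E where "E \<subseteq> G (int n)" "independent E" "G (int n) \<subseteq> span E"
      using maximal_independent_subset[of "G (int n)"] by blast
    with False show ?thesis by (intro that[of E]) auto
  qed
  define f where "f = case_sum D b"
  have fam: "c a = 0" if fin: "finite A" and A: "A \<subseteq> E <+> J"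
    and sum: "(\<Sum>a\<in>A. scale (c a) (f a)) = 0" and a: "a \<in> A" for A c a
  proof -
    define A1 where "A1 = {e. Inl e \<in> A}"
    define A2 where "A2 = {p. Inr p \<in> A}"
    have A_eq: "A = A1 <+> A2"
      by (auto simp: A1_def A2_def Plus_def image_iff) (metis sum.exhaust)
    have fin12: "finite A1" "finite A2" using fin unfolding A_eq by (simp_all add: finite_Plus_iff)
    have sub: "A1 \<subseteq> E" "A2 \<subseteq> J" using A by (auto simp: A1_def A2_def)
    have 0: "(\<Sum>e\<in>A1. scale (c (Inl e)) (D e)) + (\<Sum>p\<in>A2. scale (c (Inr p)) (b p)) = 0"
      using sum fin12 unfolding A_eq by (simp add: sum.Plus f_def)
    then have "(\<Sum>p\<in>A2. scale (c (Inr p)) (b p)) = D (- (\<Sum>e\<in>A1. scale (c (Inl e)) e))"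
      by (simp add: D_simps add_eq_0_iff)
    from indep[OF fin12(2) sub(2) this] have c2: "c (Inr p) = 0" if "p \<in> A2" for p using that .
    then have "D (\<Sum>e\<in>A1. scale (c (Inl e)) e) = 0" using 0 by (simp add: D_simps)
    moreover have "(\<Sum>e\<in>A1. scale (c (Inl e)) e) \<in> G (int n)"
      using sub(1) E(1) by (intro G_sum G_scale) auto
    ultimately have "n > 0 \<Longrightarrow> (\<Sum>e\<in>A1. scale (c (Inl e)) e) = 0"
      using D_inj_weight by force
    then have "c (Inl e) = 0" if "e \<in> A1" for e
    proof (cases "n = 0")
      case False
      then have sum0: "(\<Sum>e\<in>A1. scale ((\<lambda>e. c (Inl e)) e) e) = 0"
        using \<open>n > 0 \<Longrightarrow> (\<Sum>e\<in>A1. scale (c (Inl e)) e) = 0\<close> by simp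
      show ?thesis
        using E(2)[unfolded independent_explicit_finite_subsets, rule_format, OF sub(1) fin12(1) sum0 that] .
    qed (use E(4) sub(1) that in auto)
    with c2 a show "c a = 0" unfolding A_eq by auto
  qed
  have inj: "inj_on f (E <+> J)" and ind: "independent (f ` (E <+> J))"
    by (rule independent_family; erule (3) fam)+
  have "f ` (E <+> J) \<subseteq> G (int (Suc n))"
  proof
    fix x assume "x \<in> f ` (E <+> J)"
    then consider e where "e \<in> E" "x = D e" | p where "p \<in> J" "x = b p" by (auto simp: f_def)
    then show "x \<in> G (int (Suc n))"
    proof cases
      case 1
      then show ?thesis using D_weight[of e "int n"] E(1) by (auto simp: add.commute)
    qed (use b in blast)
  qed
  then obtain B where B: "f ` (E <+> J) \<subseteq> B" "B \<subseteq> G (int (Suc n))" "independent B" "G (int (Suc n)) \<subseteq> span B"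
    using maximal_independent_subset_extend[OF _ ind] by blast
  \<comment> \<open>On the remaining elements of the basis \<open>B\<close> of weight
    \<open>Suc n\<close> the choice is free; 0 is taken.\<close>
  define h where "h x = (if x \<in> f ` (E <+> J) then case_sum (\<lambda>e. D (\<phi> e)) t (inv_into (E <+> J) f x) else 0)" for x
  interpret p: vector_space_pair scale scale by unfold_locales
  obtain \<psi> where \<psi>: "Vector_Spaces.linear scale scale \<psi>" "\<forall>x\<in>B. \<psi> x = h x"
    using p.linear_independent_extend[OF B(3), of h] by blast
  then have lin: "module_hom scale scale \<psi>" by (simp add: module_hom_iff_linear)
  have on: "\<psi> (f a) = case_sum (\<lambda>e. D (\<phi> e)) t a" if "a \<in> E <+> J" for a
  proof -
    have fa: "f a \<in> f ` (E <+> J)" using that by (rule imageI)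
    then have "\<psi> (f a) = h (f a)" using \<psi>(2) B(1) by blast
    then show ?thesis by (simp only: h_def fa if_True inv_into_f_f[OF inj that])
  qed
  have D\<phi>: "D (\<phi> v) \<in> G (int (Suc n))" if "v \<in> G (int n)" for v
    using D_weight[OF \<phi>(2)[OF that]] by (simp add: add.commute)
  show ?thesis
  proof (intro exI[of _ \<psi>] conjI ballI lin)
    fix v assume "v \<in> G (int (Suc n))"
    have "h x \<in> G (int (Suc n))" for x
    proof (cases "x \<in> f ` (E <+> J)")
      case True
      then have "inv_into (E <+> J) f x \<in> E <+> J" by (rule inv_into_into)
      then show ?thesis using True t D\<phi> E(1) by (auto simp: h_def)
    qed (simp add: h_def G_0)
    then have "\<psi> x \<in> span (G (int (Suc n)))" if "x \<in> B" for x
      using \<psi>(2) that span_base by simp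
    then have "\<psi> v \<in> span (G (int (Suc n)))"
      using B(4) \<open>v \<in> G (int (Suc n))\<close> by (intro span_linear_image[OF _ lin, of v B]) auto
    then show "\<psi> v \<in> G (int (Suc n))"
      using span_minimal[OF order.refl G_subspace] by blast
  next
    fix v assume v: "v \<in> G (int n)"
    show "\<psi> (D v) = D (\<phi> v)"
    proof (cases "n = 0")
      case True
      then have "v \<in> span {vac}" using G_zero v by simp
      then obtain c where "v = scale c vac" by (auto simp: span_singleton)
      then show ?thesis using \<phi>(3)[OF True] by (simp add: D_simps D_vac module_hom.zero[OF lin])
    next
      case False
      then have "v \<in> span E" using E(3) v by auto
      then show ?thesis
      proof (induction v rule: span_induct_alt)
        case (step c x y)
        have "\<psi> (D x) = D (\<phi> x)" using on[OF InlI[OF step(1)]] by (simp add: f_def)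
        with step show ?case
          by (simp add: D_simps module_hom.add[OF lin] module_hom.scale[OF lin]
              module_hom.add[OF \<phi>(1)] module_hom.scale[OF \<phi>(1)])
      qed (simp add: D_simps module_hom.zero[OF lin] module_hom.zero[OF \<phi>(1)])
    qed
  next
    show "\<psi> (b p) = t p" if "p \<in> J" for p
      using on[OF InrI[OF that]] by (simp add: f_def)
  qed
qed

text \<open>\<open>D\<close> raises weights by one, so commuting with it links only consecutive
  weights, and maps for the single weights arise by dependent choice. They are glued along the
  homogeneous basis of monomials.\<close>

lemma coboundary_map_exists:
  fixes w :: "'p \<Rightarrow> nat"
  assumes w: "\<And>p. p \<in> I \<Longrightarrow> 0 < w p"
    and b: "\<And>p. p \<in> I \<Longrightarrow> b p \<in> G (int (w p))" and t: "\<And>p. p \<in> I \<Longrightarrow> t p \<in> G (int (w p))"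
    and indep: "\<And>A c v p. finite A \<Longrightarrow> A \<subseteq> I \<Longrightarrow> (\<Sum>p\<in>A. scale (c p) (b p)) = D v \<Longrightarrow> p \<in> A \<Longrightarrow> c p = 0"
  shows "\<exists>\<phi>. coboundary_map \<phi> \<and> (\<forall>p\<in>I. \<phi> (b p) = t p)"
proof -
  define P where "P n \<phi> \<longleftrightarrow> module_hom scale scale \<phi> \<and> (\<forall>v\<in>G (int n). \<phi> v \<in> G (int n)) \<and>
    (n = 0 \<longrightarrow> \<phi> = (\<lambda>_. 0)) \<and> (\<forall>p\<in>I. w p = n \<longrightarrow> \<phi> (b p) = t p)" for n :: nat and \<phi>
  define Q where "Q n \<phi> \<psi> \<longleftrightarrow> (\<forall>v\<in>G (int n). \<psi> (D v) = D (\<phi> v))" for n :: nat and \<phi> \<psi> :: "'v \<Rightarrow> 'v"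
  have "\<exists>\<phi>. \<forall>n. P n (\<phi> n) \<and> Q n (\<phi> n) (\<phi> (Suc n))"
  proof (rule dependent_nat_choice)
    have "module_hom scale scale (\<lambda>_. 0)" by unfold_locales auto
    then have "P 0 (\<lambda>_. 0)" using w by (force simp: P_def G_0)
    then show "\<exists>\<phi>. P 0 \<phi>" by blast
    fix \<phi> n assume "P n \<phi>"
    then have \<phi>: "module_hom scale scale \<phi>" "\<And>v. v \<in> G (int n) \<Longrightarrow> \<phi> v \<in> G (int n)"
      "n = 0 \<Longrightarrow> \<phi> = (\<lambda>_. 0)" by (auto simp: P_def)
    have "\<exists>\<psi>. module_hom scale scale \<psi> \<and> (\<forall>v\<in>G (int (Suc n)). \<psi> v \<in> G (int (Suc n))) \<and>
      (\<forall>v\<in>G (int n). \<psi> (D v) = D (\<phi> v)) \<and> (\<forall>p\<in>{p\<in>I. w p = Suc n}. \<psi> (b p) = t p)"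
    proof (rule extend_by_weight[OF \<phi>])
      show "b p \<in> G (int (Suc n))" "t p \<in> G (int (Suc n))" if "p \<in> {p\<in>I. w p = Suc n}" for p
        using b[of p] t[of p] that by auto
      show "c p = 0" if "finite A" "A \<subseteq> {p\<in>I. w p = Suc n}" "(\<Sum>p\<in>A. scale (c p) (b p)) = D v" "p \<in> A"
        for A c v p
        by (rule indep[OF that(1) _ that(3,4)]) (use that(2) in auto)
    qed
    then show "\<exists>\<psi>. P (Suc n) \<psi> \<and> Q n \<phi> \<psi>" unfolding P_def Q_def by auto
  qed
  then obtain \<phi> where \<phi>: "\<And>n. P n (\<phi> n)" "\<And>n. Q n (\<phi> n) (\<phi> (Suc n))" by blast
  have lin: "module_hom scale scale (\<phi> n)" for n using \<phi>(1) by (simp add: P_def)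
  obtain \<Phi> where \<Phi>: "module_hom scale scale \<Phi>"
    "\<And>M. M \<in> monomials \<Longrightarrow> \<Phi> (pbw_vec M) = \<phi> (nat (weight M)) (pbw_vec M)"
    using pbw_linear_extension[OF vector_space_axioms, of "\<lambda>M. \<phi> (nat (weight M)) (pbw_vec M)"] by blast
  have eq: "\<Phi> v = \<phi> n v" if "v \<in> G (int n)" for v n
    using G_eq_span[OF that]
  proof (induction v rule: span_induct_alt)
    case (step c x y)
    then have "\<Phi> x = \<phi> n x" using \<Phi>(2) by auto
    with step show ?case
      by (simp add: module_hom.add[OF lin] module_hom.scale[OF lin]
          module_hom.add[OF \<Phi>(1)] module_hom.scale[OF \<Phi>(1)])
  qed (simp add: module_hom.zero[OF lin] module_hom.zero[OF \<Phi>(1)])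
  have zero: "\<Phi> 0 = 0" by (rule module_hom.zero[OF \<Phi>(1)])
  have "\<Phi> v \<in> G n" if "v \<in> G n" for v n
  proof (cases "n < 0")
    case True
    then show ?thesis using G_negative[OF that] by (simp add: zero G_0)
  next
    case False
    then obtain k where "n = int k" by (metis nat_0_le not_le)
    then show ?thesis using eq[of v k] \<phi>(1)[of k] that by (simp add: P_def)
  qed
  moreover have "\<Phi> (D v) = D (\<Phi> v)" for v
  proof (induction v rule: homogeneous_induct)
    case (add u v)
    then show ?case by (simp add: D_simps module_hom.add[OF \<Phi>(1)])
  next
    case (homogeneous n v)
    show ?case
    proof (cases "n < 0")
      case True
      then show ?thesis using G_negative[OF homogeneous] by (simp add: zero D_simps)
    next
      case False
      then obtain k where k: "n = int k" by (metis nat_0_le not_le)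
      have "D v \<in> G (int (Suc k))" using D_weight[OF homogeneous] by (simp add: k add.commute)
      then show ?thesis using eq[of v k] eq[of "D v" "Suc k"] \<phi>(2)[of k] homogeneous
        by (simp add: Q_def k)
    qed
  qed
  moreover have "\<Phi> vac = 0"
    using eq[of vac 0] vac_weight \<phi>(1)[of 0] by (simp add: P_def)
  ultimately have "coboundary_map \<Phi>"
    using \<Phi>(1) by (auto simp: coboundary_map_def module_hom_iff_linear)
  moreover have "\<Phi> (b p) = t p" if "p \<in> I" for p
    using eq[OF b[OF that]] \<phi>(1)[of "w p"] that by (simp add: P_def)
  ultimately show ?thesis by blast
qed

theorem normalizing_coboundary_map:
  assumes A: "skew_symmetric A" "graded_map A"
  shows "\<exists>\<phi>. coboundary_map \<phi> \<and> (\<forall>i<length gens. \<phi> (gens ! i) = 0) \<and>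
    (\<forall>i<length gens. \<forall>j<length gens. \<forall>k.
      \<phi> (reg Y (gens ! i) (gens ! j) (int k)) = reg A (gens ! i) (gens ! j) (int k))"
proof -
  \<comment> \<open>\<open>a_(-m)\<close> is the coefficient of \<open>x^(m-1)\<close>, so
    \<open>m >= 1\<close> stands for coefficient \<open>m - 1\<close> of \<open>R\<close>, and odd
    \<open>m\<close> for even powers; \<open>m = 0\<close> prescribes the value 0 on a
    generator.\<close>
  define b where "b = (\<lambda>(i, j, m). if m = 0 then gens ! i else reg Y (gens ! i) (gens ! j) (int (m - 1)))"
  define t where "t = (\<lambda>(i, j, m). if m = 0 then 0 else reg A (gens ! i) (gens ! j) (int (m - 1)))"
  define w where "w = (\<lambda>(i, j, m). nat (if m = 0 then wt i else wt i + wt j + int (m - 1)))"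
  have q: "i < length gens" "j < length gens" "0 < wt i" "0 < wt j" if "(i, j, m) \<in> quadratic" for i j m :: nat
    using that wt_pos by (auto simp: quadratic_def)
  have "\<exists>y. b p = word_vec (quad_word p) + D y" if "p \<in> quadratic" for p
  proof -
    obtain i j m where p: "p = (i, j, m)" by (cases p)
    note ij = q[OF that[unfolded p]]
    show ?thesis
    proof (cases "m = 0")
      case True
      then show ?thesis
        by (intro exI[of _ 0]) (simp add: p b_def quad_word_def creation D_simps)
    next
      case False
      obtain x where "mode (gens ! i) (- 1 - int (m - 1)) (gens ! j) =
          reg Y (gens ! i) (gens ! j) (int (m - 1)) + D x"
        using reg_Y_mod_D[OF gens_weight[OF ij(1)] gens_weight[OF ij(2)]] by blast
      moreover have "- 1 - int (m - 1) = - int m" using False by simp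
      ultimately show ?thesis using False
        by (intro exI[of _ "- x"]) (simp add: p b_def quad_word_def creation D_simps)
    qed
  qed
  then obtain y where y: "\<And>p. p \<in> quadratic \<Longrightarrow> b p = word_vec (quad_word p) + D (y p)" by metis
  have "\<exists>\<phi>. coboundary_map \<phi> \<and> (\<forall>p\<in>quadratic. \<phi> (b p) = t p)"
  proof (rule coboundary_map_exists)
    fix p assume pq: "p \<in> quadratic"
    obtain i j m where p: "p = (i, j, m)" by (cases p)
    note ij = q[OF pq[unfolded p]]
    show "0 < w p" using ij by (simp add: w_def p)
    show "b p \<in> G (int (w p))"
      using ij gens_weight reg_weight[OF graded_map_Y gens_weight[OF ij(1)] gens_weight[OF ij(2)]]
      by (auto simp: b_def w_def p)
    show "t p \<in> G (int (w p))"
      using ij G_0 reg_weight[OF A(2) gens_weight[OF ij(1)] gens_weight[OF ij(2)]]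
      by (auto simp: t_def w_def p)
  next
    show "c p = 0" if "finite S" "S \<subseteq> quadratic" "(\<Sum>p\<in>S. scale (c p) (b p)) = D v" "p \<in> S" for S c v p
      using that y by (intro quadratic_independent_mod_D[of S b y c v p]) auto
  qed
  then obtain \<phi> where \<phi>: "coboundary_map \<phi>" "\<And>p. p \<in> quadratic \<Longrightarrow> \<phi> (b p) = t p" by blast
  have gen: "\<phi> (gens ! i) = 0" if "i < length gens" for i
    using \<phi>(2)[of "(i, i, 0)"] that by (simp add: quadratic_def b_def t_def)
  have less: "\<phi> (reg Y (gens ! i) (gens ! j) (int k)) = reg A (gens ! i) (gens ! j) (int k)"
    if "i < j" "j < length gens" for i j k
    using \<phi>(2)[of "(i, j, Suc k)"] that by (simp add: quadratic_def b_def t_def)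
  have "\<phi> (reg Y (gens ! i) (gens ! i) (int k)) = reg A (gens ! i) (gens ! i) (int k)"
    if "i < length gens" "even k" for i k
    using \<phi>(2)[of "(i, i, Suc k)"] that by (simp add: quadratic_def b_def t_def)
  then have eq: "\<phi> (reg Y (gens ! i) (gens ! i) (int k)) = reg A (gens ! i) (gens ! i) (int k)"
    if "i < length gens" for i k
    using map_reg_diagonal[OF \<phi>(1) A(1)] that by blast
  have "\<phi> (reg Y (gens ! i) (gens ! j) (int k)) = reg A (gens ! i) (gens ! j) (int k)"
    if "i < length gens" "j < length gens" for i j k
  proof (cases i j rule: linorder_cases)
    case greater
    then show ?thesis using map_reg_swap[OF \<phi>(1) A(1) less] that by blast
  qed (use less eq that in auto)
  then show ?thesis using \<phi>(1) gen by blast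
qed

end


section \<open>Convergence from the singular parts\<close>

context grading_restricted_vertex_algebra
begin

lemma converges_to_rational_add:
  assumes "converges_to_rational n c" "converges_to_rational n d"
  shows "converges_to_rational n (\<lambda>ns. c ns + d ns)"
  unfolding converges_to_rational_iff
proof
  fix v' assume v': "v' \<in> graded_dual"
  obtain f g where "radial_expansion n (\<lambda>ns. v' (c ns)) f" "radial_expansion n (\<lambda>ns. v' (d ns)) g"
    using assms v' unfolding converges_to_rational_iff by meson
  from radial_expansion_add[OF this] show "\<exists>f. radial_expansion n (\<lambda>ns. v' (c ns + d ns)) f"
    using v' by (auto simp: graded_dual_simps)
qed

lemma converges_to_rational_scale:
  assumes "converges_to_rational n c"
  shows "converges_to_rational n (\<lambda>ns. scale a (c ns))"
  unfolding converges_to_rational_iff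
proof
  fix v' assume v': "v' \<in> graded_dual"
  obtain f where "radial_expansion n (\<lambda>ns. v' (c ns)) f"
    using assms v' unfolding converges_to_rational_iff by meson
  from radial_expansion_cmult[OF this] show "\<exists>f. radial_expansion n (\<lambda>ns. v' (scale a (c ns))) f"
    using v' by (auto simp: graded_dual_simps)
qed

lemma converges_to_rational_0: "converges_to_rational n (\<lambda>ns. 0)"
  unfolding converges_to_rational_iff using radial_expansion_0 by (auto simp: graded_dual_simps)

lemma converges_to_rational_sum:
  assumes "\<And>x. x \<in> A \<Longrightarrow> converges_to_rational n (c x)"
  shows "converges_to_rational n (\<lambda>ns. \<Sum>x\<in>A. c x ns)"
  using assms
  by (induction A rule: infinite_finite_induct)
    (auto intro: converges_to_rational_0 converges_to_rational_add)

lemma iterated_modes_linear: "module_hom scale scale (iterated_modes ss ns)"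
proof (induction ss ns rule: list_induct2')
  case (4 s ss n ns)
  show ?case
    by unfold_locales
      (simp_all add: module_hom.add[OF 4] module_hom.scale[OF 4] mode_simps)
qed (unfold_locales, auto simp: iterated_modes_def)+

lemmas iterated_modes_simps =
  hom_simps[OF iterated_modes_linear]

lemma iterated_modes_snoc:
  assumes "length ns = length ss + 1"
  shows "iterated_modes (ss @ [s]) (ns[length ss := m]) v = iterated_modes ss ns (mode s m v)"
proof -
  obtain ms n where ns: "ns = ms @ [n]" "length ms = length ss"
    using assms by (cases ns rule: rev_cases) auto
  then have "ns[length ss := m] = ms @ [m]" by (simp flip: ns(2))
  moreover have "zip ss (ms @ [n]) = zip ss ms"
    using zip_append[of ss ms "[]" "[n]"] ns(2) by simp
  ultimately show ?thesis using ns by (simp add: iterated_modes_def zip_append)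
qed

text \<open>\<open>product_rationality\<close> with \<open>s\<close> as the last operator,
  multiplied by the power \<open>- k\<close> of the last variable.\<close>

lemma converges_iterated_modes_snoc:
  "converges_to_rational (length ss + 1)
    (\<lambda>ns. iterated_modes ss ns (mode s (ns ! length ss - k) v))"
  unfolding converges_to_rational_iff
proof
  fix v' assume v': "v' \<in> graded_dual"
  obtain f where "radial_expansion (length ss + 1) (\<lambda>ns. v' (iterated_modes (ss @ [s]) ns v)) f"
    using product_rationality[OF v', of "ss @ [s]"] by auto
  from radial_expansion_shift[OF this, of "length ss" k]
  show "\<exists>f. radial_expansion (length ss + 1) (\<lambda>ns. v' (iterated_modes ss ns (mode s (ns ! length ss - k) v))) f"
    by (subst radial_expansion_cong[where
          d = "\<lambda>ns. v' (iterated_modes (ss @ [s]) (ns[length ss := ns ! length ss - k]) v)"])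
      (auto simp: iterated_modes_snoc)
qed

text \<open>For a single term \<open>w x^(-l)\<close> this is
  \<open>e^(xD) (-x)^(-l) w = (-1)^l x^(-l) Y(w, x) vac\<close>, by \<open>mode_vac\<close>.\<close>

lemma exp_D_neg_polar:
  assumes pos: "\<And>k. k \<ge> 0 \<Longrightarrow> F k = 0" and neg: "\<And>k. k < - int L \<Longrightarrow> F k = 0"
  shows "exp_D_neg F k = (\<Sum>l\<in>{1..L}. scale ((- 1) ^ l) (mode (F (- int l)) (- 1 - k - int l) vac))"
proof -
  define I where "I = nat (k + int L + 1)"
  have "exp_D_neg F k = (\<Sum>i<I. scale ((- 1) powi (k - int i) / fact i) ((D ^^ i) (F (k - int i))))"
    by (rule exp_D_neg_eq[OF neg]) (auto simp: I_def)
  also have "\<dots> = (\<Sum>i\<in>{i\<in>{..<I}. k < int i}. scale ((- 1) powi (k - int i) / fact i) ((D ^^ i) (F (k - int i))))"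
  proof (rule sum.mono_neutral_right)
    show "\<forall>i\<in>{..<I} - {i \<in> {..<I}. k < int i}.
        scale ((- 1) powi (k - int i) / fact i) ((D ^^ i) (F (k - int i))) = 0"
    proof
      fix i assume "i \<in> {..<I} - {i \<in> {..<I}. k < int i}"
      then have "F (k - int i) = 0" by (intro pos) auto
      then show "scale ((- 1) powi (k - int i) / fact i) ((D ^^ i) (F (k - int i))) = 0"
        by (simp add: D_pow_simps)
    qed
  qed auto
  also have "\<dots> = (\<Sum>l\<in>{l\<in>{1..L}. 0 \<le> k + int l}. scale ((- 1) ^ l) (mode (F (- int l)) (- 1 - k - int l) vac))"
  proof (rule sum.reindex_bij_witness[of _ "\<lambda>l. nat (k + int l)" "\<lambda>i. nat (int i - k)"])
    fix i assume i: "i \<in> {i\<in>{..<I}. k < int i}"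
    define l where "l = nat (int i - k)"
    have l: "k - int i = - int l" "- 1 - k - int l = - 1 - int i" using i by (auto simp: l_def)
    show "scale ((- 1) ^ nat (int i - k)) (mode (F (- int (nat (int i - k)))) (- 1 - k - int (nat (int i - k))) vac) =
      scale ((- 1) powi (k - int i) / fact i) ((D ^^ i) (F (k - int i)))"
      unfolding l_def[symmetric] l by (simp add: mode_vac power_int_minus_one_minus)
  qed (auto simp: I_def)
  also have "\<dots> = (\<Sum>l\<in>{1..L}. scale ((- 1) ^ l) (mode (F (- int l)) (- 1 - k - int l) vac))"
  proof (rule sum.mono_neutral_left)
    show "\<forall>l\<in>{1..L} - {l \<in> {1..L}. 0 \<le> k + int l}.
        scale ((- 1) ^ l) (mode (F (- int l)) (- 1 - k - int l) vac) = 0"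
    proof
      fix l assume "l \<in> {1..L} - {l \<in> {1..L}. 0 \<le> k + int l}"
      then have "mode (F (- int l)) (- 1 - k - int l) vac = 0" by (intro creation_regular) auto
      then show "scale ((- 1) ^ l) (mode (F (- int l)) (- 1 - k - int l) vac) = 0" by simp
    qed
  qed auto
  finally show ?thesis .
qed

text \<open>A singular term \<open>w x^(-n-1)\<close> is written as a shift of \<open>Y(1, x) w\<close>.\<close>

lemma converges_iterated_modes_normalized:
  assumes "\<And>k. reg B u v k = 0"
  shows "converges_to_rational (length ss + 1)
    (\<lambda>ns. iterated_modes ss ns (vmode B u (ns ! length ss) v))"
proof -
  let ?S = "singular_part (B u v)" and ?T = "singular_part (B v u)"
  obtain N1 N2 where N1: "\<forall>j<N1. ?S j = 0" and N2: "\<forall>j<N2. ?T j = 0"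
    using singular_part_lower by meson
  define L where "L = nat (max (- N1) (- N2))"
  have S: "?S k = 0" if "k \<ge> 0 \<or> k < - int L" for k
  proof (cases "k \<ge> 0")
    case False
    then have "k < N1" using that unfolding L_def by linarith
    then show ?thesis using N1 by blast
  qed (simp add: singular_part_def)
  have T: "?T k = 0" if "k \<ge> 0 \<or> k < - int L" for k
  proof (cases "k \<ge> 0")
    case False
    then have "k < N2" using that unfolding L_def by linarith
    then show ?thesis using N2 by blast
  qed (simp add: singular_part_def)
  have S_eq: "?S (- n - 1) = (\<Sum>l\<in>{1..L}. mode vac (n - int l) (?S (- int l)))" for n
  proof (cases "- n - 1 \<ge> 0 \<or> - n - 1 < - int L")
    case True
    then have "n - int l \<noteq> - 1" if "l \<in> {1..L}" for l using that by auto
    then show ?thesis using S[OF True] by (simp add: vacuum)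
  next
    case False
    have "(\<Sum>l\<in>{1..L}. mode vac (n - int l) (?S (- int l))) =
        (\<Sum>l\<in>{1..L}. if l = nat (n + 1) then ?S (- n - 1) else 0)"
      using False by (intro sum.cong) (auto simp: vacuum)
    moreover have "nat (n + 1) \<in> {1..L}" using False by auto
    ultimately show ?thesis by simp
  qed
  have T_eq: "exp_D_neg ?T (- n - 1) =
      (\<Sum>l\<in>{1..L}. scale ((- 1) ^ l) (mode (?T (- int l)) (n - int l) vac))" for n
    by (subst exp_D_neg_polar[of _ L]) (use T in auto)
  have B_eq: "vmode B u n v = scale (1 / 2)
      ((\<Sum>l\<in>{1..L}. mode vac (n - int l) (?S (- int l))) +
       (\<Sum>l\<in>{1..L}. scale ((- 1) ^ l) (mode (?T (- int l)) (n - int l) vac)))" for n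
    using assms[of "- n - 1"] unfolding reg_def S_eq T_eq by (simp add: vmode_def)
  show ?thesis
    unfolding B_eq iterated_modes_simps
    by (intro converges_to_rational_scale converges_to_rational_add converges_to_rational_sum
        converges_iterated_modes_snoc)
qed

lemma converges_product_from_cocycle:
  assumes "cocycle B" "\<And>k. reg B u v k = 0"
  shows "converges_to_rational 2 (\<lambda>ns. vmode B s (ns ! 0) (mode u (ns ! 1) v))"
  unfolding converges_to_rational_iff
proof
  fix v' assume v': "v' \<in> graded_dual"
  obtain f where f: "radial_expansion 2 (\<lambda>ns. v' (vmode B s (ns ! 0) (mode u (ns ! 1) v)) +
                v' (mode s (ns ! 0) (vmode B u (ns ! 1) v))) f"
    using assms(1) v' unfolding cocycle_iff dual_expansion_iff by meson
  have "converges_to_rational (length [s] + 1) (\<lambda>ns. iterated_modes [s] ns (vmode B u (ns ! length [s]) v))"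
    by (rule converges_iterated_modes_normalized[OF assms(2)])
  then obtain g where "radial_expansion (length [s] + 1)
      (\<lambda>ns. v' (iterated_modes [s] ns (vmode B u (ns ! length [s]) v))) g"
    using v' unfolding converges_to_rational_iff by meson
  then have "radial_expansion 2 (\<lambda>ns. v' (mode s (ns ! 0) (vmode B u (ns ! 1) v))) g"
    by (subst radial_expansion_cong[where d = "\<lambda>ns. v' (iterated_modes [s] ns (vmode B u (ns ! length [s]) v))"])
      (auto simp: length_Suc_conv numeral_2_eq_2)
  from radial_expansion_add[OF f radial_expansion_cmult[OF this, of "- 1"]]
  show "\<exists>f. radial_expansion 2 (\<lambda>ns. v' (vmode B s (ns ! 0) (mode u (ns ! 1) v))) f"
    by auto
qed

end

theorem theorem3p4:
  fixes scale :: "complex \<Rightarrow> 'v::ab_group_add \<Rightarrow> 'v"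
    and Y :: "'v \<Rightarrow> 'v \<Rightarrow> 'v fls"
    and vac :: 'v
    and G :: "int \<Rightarrow> 'v set"
    and gens :: "'v list"
  assumes V: "grading_restricted_vertex_algebra scale Y vac G"
    and free: "grading_restricted_vertex_algebra.freely_generates scale Y vac gens"
    and homogeneous: "\<forall>a\<in>set gens. \<exists>n>0. a \<in> G n"
    and cls: "C \<in> grading_restricted_vertex_algebra.H2_half scale Y vac G"
  shows "\<exists>Y1\<in>C.
    grading_restricted_vertex_algebra.cocycle scale Y vac G Y1 \<and>
    (\<forall>i<length gens. \<forall>j<length gens. \<forall>k.
       fls_nth (Y1 (gens ! i) (gens ! j)) k =
         singular_part (Y1 (gens ! i) (gens ! j)) k +
         scale (1 / 2)
           (grading_restricted_vertex_algebra.exp_D_neg scale Y vac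
              (singular_part (Y1 (gens ! j) (gens ! i))) k -
            singular_part (Y1 (gens ! i) (gens ! j)) k)) \<and>
    (\<forall>ss u v. set ss \<subseteq> set gens \<longrightarrow> u \<in> set gens \<longrightarrow> v \<in> set gens \<longrightarrow>
       grading_restricted_vertex_algebra.converges_to_rational scale G (length ss + 1)
         (\<lambda>ns. grading_restricted_vertex_algebra.iterated_modes Y ss ns
                 (vmode Y1 u (ns ! length ss) v))) \<and>
    (\<forall>s\<in>set gens. \<forall>u\<in>set gens. \<forall>v\<in>set gens.
       grading_restricted_vertex_algebra.converges_to_rational scale G 2
         (\<lambda>ns. vmode Y1 s (ns ! 0) (vmode Y u (ns ! 1) v)))"
proof -
  interpret grading_restricted_vertex_algebra scale Y vac G by (rule V)
  have "\<forall>i\<in>{..<length gens}. \<exists>n. 0 < n \<and> gens ! i \<in> G n"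
    using homogeneous by (meson lessThan_iff nth_mem)
  then obtain wt where wt: "\<And>i. i < length gens \<Longrightarrow> 0 < wt i \<and> gens ! i \<in> G (wt i)"
    by (metis lessThan_iff)
  interpret freely_generated_vertex_algebra scale Y vac G gens wt
    by unfold_locales (use free wt in auto)
  obtain A where A: "cocycle A"
    and C: "C = {(Y1, Y2). cocycle Y1 \<and> cocycle Y2 \<and> coboundary (\<lambda>u v. Y2 u v - Y1 u v)} `` {A}"
    using cls unfolding H2_half_def by (auto elim!: quotientE)
  have sk: "skew_symmetric A" "graded_map A" using A by (simp_all add: cocycle_iff)
  obtain \<phi> where \<phi>: "coboundary_map \<phi>" "\<forall>i<length gens. \<phi> (gens ! i) = 0"
    "\<forall>i<length gens. \<forall>j<length gens. \<forall>k.
      \<phi> (reg Y (gens ! i) (gens ! j) (int k)) = reg A (gens ! i) (gens ! j) (int k)"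
    using normalizing_coboundary_map[OF sk] by blast
  define B where "B = (\<lambda>u v. A u v + cobd \<phi> u v)"
  have B: "cocycle B" unfolding B_def by (rule cocycle_add[OF A cocycle_cobd[OF \<phi>(1)]])
  have "coboundary (\<lambda>u v. B u v - A u v)"
    unfolding coboundary_def
  proof (intro exI conjI)
    show "\<forall>u v n. vmode (\<lambda>u v. B u v - A u v) u n v =
        mode (\<phi> u) n v - \<phi> (mode u n v) + mode u n (\<phi> v)"
      using vmode_cobd[OF \<phi>(1)] by (simp add: B_def vmode_def)
  qed (use \<phi>(1) in \<open>simp_all add: coboundary_map_def\<close>)
  then have BC: "B \<in> C" using A B by (simp add: C)
  \<comment> \<open>Negative powers vanish by skew-symmetry of \<open>B\<close>; at the other powers
    \<phi> was chosen to cancel \<open>reg A\<close>.\<close>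
  have reg: "reg B (gens ! i) (gens ! j) k = 0" if "i < length gens" "j < length gens" for i j k
  proof (cases "k < 0")
    case True
    then show ?thesis using B by (intro reg_negative) (simp add: cocycle_iff)
  next
    case False
    then have "\<phi> (reg Y (gens ! i) (gens ! j) k) = reg A (gens ! i) (gens ! j) k"
      using \<phi>(3) that by (metis nat_0_le not_le)
    then show ?thesis
      unfolding B_def using reg_add_cobd[OF \<phi>(1), of "gens ! i" "gens ! j" A k] \<phi>(2) that by simp
  qed
  have reg': "reg B u v k = 0" if "u \<in> set gens" "v \<in> set gens" for u v k
    using reg that by (metis in_set_conv_nth)
  show ?thesis
    using BC B reg reg_eq_0_iff converges_iterated_modes_normalized[OF reg']
      converges_product_from_cocycle[OF B reg'] by blast
qed

end
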